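(* Let $N\ge 2$ be an integer and $0\le\beta<N$, and let $\alpha_N=N\left(\frac{N\pi^{N/2}}{\Gamma(\frac N2+1)}\right)^{\frac1{N-1}}$. For $0\le\alpha\le\alpha_N$ define $$AT(\alpha,\beta)=\sup_{\|\nabla u\|_N\le 1}\frac{1}{\|u\|_N^{N-\beta}}\int_{\mathbb{R}^N}\phi_N\left(\alpha\left(1-\frac{\beta}{N}\right)|u|^{\frac{N}{N-1}}\right)\frac{dx}{|x|^{\beta}},$$ the supremum being over $u\in W^{1,N}(\mathbb{R}^N)\setminus\{0\}$ with $\|\nabla u\|_N\le1$. Then there exist positive constants $c=c(N,\beta)$ and $C=C(N,\beta)$ such that for all $\alpha<\alpha_N$ close enough to $\alpha_N$, $$\frac{c(N,\beta)}{\left(1-\left(\frac{\alpha}{\alpha_N}\right)^{N-1}\right)^{(N-\beta)/N}}\le AT(\alpha,\beta)\le\frac{C(N,\beta)}{\left(1-\left(\frac{\alpha}{\alpha_N}\right)^{N-1}\right)^{(N-\beta)/N}}.$$ Moreover, the constant $\alpha_N$ is sharp in the sense that $AT(\alpha_N,\beta)=\infty$.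
   Context: $\phi_N(t)=e^t-\sum_{j=0}^{N-2}\frac{t^j}{j!}$. $\|\cdot\|_N$ denotes the $L^N(\mathbb{R}^N)$ norm. "For all $\alpha<\alpha_N$ close enough to $\alpha_N$" means: there is $\alpha_0=\alpha_0(N,\beta)<\alpha_N$ such that the bounds hold for all $\alpha\in(\alpha_0,\alpha_N)$. *)

theory Defs
  imports "HOL-Analysis.Analysis"
begin

definition phi :: "nat \<Rightarrow> real \<Rightarrow> real" where
  "phi N t = exp t - (\<Sum>j=0..N-2. t ^ j / fact j)"

definition alpha_crit :: "nat \<Rightarrow> real" where
  "alpha_crit N =
     real N * (real N * pi powr (real N / 2) / Gamma (real N / 2 + 1)) powr (1 / (real N - 1))"

definition Lp_space :: "real \<Rightarrow> ('a::euclidean_space \<Rightarrow> 'b::euclidean_space) set" where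
  "Lp_space p =
     {f. f \<in> borel_measurable lborel \<and> integrable lborel (\<lambda>x. norm (f x) powr p)}"

definition Lp_norm :: "real \<Rightarrow> ('a::euclidean_space \<Rightarrow> 'b::euclidean_space) \<Rightarrow> real" where
  "Lp_norm p f = (\<integral>x. norm (f x) powr p \<partial>lborel) powr (1 / p)"

definition partial_deriv :: "'n::finite \<Rightarrow> (real ^ 'n \<Rightarrow> real) \<Rightarrow> real ^ 'n \<Rightarrow> real" where
  "partial_deriv i f x = frechet_derivative f (at x) (axis i 1)"

primrec C_k :: "nat \<Rightarrow> (real ^ 'n::finite \<Rightarrow> real) \<Rightarrow> bool" where
  "C_k 0 f \<longleftrightarrow> continuous_on UNIV f"
| "C_k (Suc k) f \<longleftrightarrow> f differentiable_on UNIV \<and> (\<forall>i. C_k k (partial_deriv i f))"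

definition test_function :: "(real ^ 'n::finite \<Rightarrow> real) \<Rightarrow> bool" where
  "test_function f \<longleftrightarrow> (\<forall>k. C_k k f) \<and> compact (closure {x. f x \<noteq> 0})"

definition locally_integrable :: "('a::euclidean_space \<Rightarrow> 'b::euclidean_space) \<Rightarrow> bool" where
  "locally_integrable f \<longleftrightarrow> (\<forall>K. compact K \<longrightarrow> set_integrable lborel K f)"

definition has_weak_gradient ::
    "(real ^ 'n::finite \<Rightarrow> real) \<Rightarrow> (real ^ 'n \<Rightarrow> real ^ 'n) \<Rightarrow> bool" where
  "has_weak_gradient u g \<longleftrightarrow> locally_integrable u \<and> locally_integrable g \<and>
     (\<forall>f i. test_function f \<longrightarrow>
        (\<integral>x. u x * partial_deriv i f x \<partial>lborel) = - (\<integral>x. g x $ i * f x \<partial>lborel))"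

definition sobolev_W1 :: "real \<Rightarrow> (real ^ 'n::finite \<Rightarrow> real) set" where
  "sobolev_W1 p = {u \<in> Lp_space p. \<exists>g \<in> Lp_space p. has_weak_gradient u g}"

text \<open>Elements of the Sobolev space are represented by Borel functions rather than by almost
  everywhere classes. The weak gradient is unique almost everywhere, so the bound on the norm of
  the gradient does not depend on which weak gradient witnesses it. A function counts as zero if
  it vanishes almost everywhere.\<close>

definition admissible :: "(real ^ 'n::finite \<Rightarrow> real) set" where
  "admissible = {u \<in> sobolev_W1 (real CARD('n)). \<not> (AE x in lborel. u x = 0) \<and>
     (\<exists>g \<in> Lp_space (real CARD('n)).
        has_weak_gradient u g \<and> Lp_norm (real CARD('n)) g \<le> 1)}"

text \<open>The integrand is nonnegative, so \<^const>\<open>ennreal\<close> does not truncate. Its value at the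
  origin, where Isabelle's division by zero yields 0, is irrelevant to the integral.\<close>

definition AT_quotient :: "real \<Rightarrow> real \<Rightarrow> (real ^ 'n::finite \<Rightarrow> real) \<Rightarrow> ennreal" where
  "AT_quotient \<alpha> \<beta> u = (let N = CARD('n) in
     ennreal (1 / Lp_norm (real N) u powr (real N - \<beta>)) *
     (\<integral>\<^sup>+ x. ennreal (phi N (\<alpha> * (1 - \<beta> / real N) * \<bar>u x\<bar> powr (real N / (real N - 1)))
                     / norm x powr \<beta>) \<partial>lborel))"

text \<open>The dimension \<open>N\<close> is the cardinality of the index type passed as first argument.\<close>

definition AT :: "'n::finite itself \<Rightarrow> real \<Rightarrow> real \<Rightarrow> ennreal" where
  "AT _ \<alpha> \<beta> = (SUP u \<in> (admissible :: (real ^ 'n \<Rightarrow> real) set). AT_quotient \<alpha> \<beta> u)"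

end

theory Submission
  imports Defs
begin

text \<open>The upper bound rests on the sharp singular Moser--Trudinger inequality, obtained without
  symmetrization by the method of D. Adams. A function \<open>u\<close> is mollified and cut at the height
  \<open>\<theta>\<close> with \<open>\<theta>\<^sup>N = 1 - (\<alpha> / \<alpha>\<^sub>N)\<^sup>N\<^sup>-\<^sup>1\<close>. Following each ray up to its first exit
  from \<open>{\<bar>u\<bar> > \<theta>}\<close> bounds \<open>\<bar>u\<bar> - \<theta>\<close> by the Riesz potential of the gradient restricted to that
  set, with the sharp constant. O'Neil's rearrangement argument reduces this to a one-dimensional
  potential, and Adams' lemma bounds the resulting exponential integral by a constant times
  \<open>\<bar>{\<bar>u\<bar> > \<theta>}\<bar>\<close> to the power \<open>1 - \<beta> / N\<close>; Chebyshev's inequality then gives the power of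
  \<open>\<theta>\<close>. Where \<open>\<bar>u\<bar> \<le> \<theta>\<close> the integrand is at most a multiple of
  \<open>\<bar>u\<bar>\<^sup>N / \<bar>x\<bar>\<^sup>\<beta>\<close>, and Fatou's lemma removes the mollification. For the lower bound, and for the
  divergence at \<open>\<alpha>\<^sub>N\<close>, the truncated logarithm on the annulus \<open>exp (-T) < \<bar>x\<bar> < 1\<close> is tested with
  \<open>T = 1 / (1 - \<alpha> / \<alpha>\<^sub>N)\<close>, respectively \<open>T\<close> tending to infinity.\<close>

section \<open>Adams' one-dimensional lemma\<close>

text \<open>Since the quotient is infinite at the critical exponent, that exponent can be used only
  on a set of finite measure; its measure, at most ||u||^N / \<theta>^N, is what produces the rate.
  The height is forced: |u|^p \<le> (1 + h)^(p-1) ((|u| - \<theta>)^p + \<theta>^p h^(1-p)) turns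
  \<alpha> into \<open>alpha_crit N\<close> exactly when (1 + h)^(p-1) is their ratio, and for this
  h the second term stays bounded exactly when \<theta>^N is of the order 1 - (\<alpha> /
  \<open>alpha_crit N\<close>)^(N-1). The real obstacle is criticality. In a logarithmic variable s
  there remains the integral of exp(-(s - Y(s)^p)), and Hoelder's inequality alone gives no decay of
  the integrand. Adams' observation is that a small s - Y(s)^p forces the energy beyond s to be
  O(1/s), which is too little for another such point to lie far away; the bad sets are therefore
  short intervals. The parameter of the test functions is, up to a factor, the maximiser of
  T^((N-\<beta>)/N) exp(-(1 - \<alpha> / \<open>alpha_crit N\<close>) (N-\<beta>) T).\<close>

lemma powr_add_le_weighted:
  fixes a e h p :: real
  assumes a: "0 \<le> a" and e: "0 \<le> e" and h: "0 < h" and p: "1 < p"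
  shows "(a + e) powr p \<le> (1 + h) powr (p - 1) * (a powr p + e powr p * h powr (1 - p))"
proof (cases "a = 0 \<or> e = 0")
  case True
  have 1: "1 \<le> (1 + h) powr (p - 1)" using h p by (intro ge_one_powr_ge_zero) auto
  have "1 \<le> ((1 + h) / h) powr (p - 1)" using h p by (intro ge_one_powr_ge_zero) auto
  also have "\<dots> = (1 + h) powr (p - 1) * h powr (1 - p)"
    using h by (simp add: powr_divide powr_diff)
  finally have 2: "1 \<le> (1 + h) powr (p - 1) * h powr (1 - p)" .
  show ?thesis
  proof (cases "a = 0")
    case True
    then show ?thesis using mult_left_mono[OF 2, of "e powr p"] by (simp add: mult_ac)
  next
    case False
    with \<open>a = 0 \<or> e = 0\<close> show ?thesis using mult_right_mono[OF 1, of "a powr p"] by simp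
  qed
next
  case False
  \<comment> \<open>Convexity of x^p with the weights 1/(1+h) and h/(1+h), applied to a/s and e/t.
    The zero cases are separated because convexity is used on the open half-line.\<close>
  define s where "s = 1 / (1 + h)"
  define t where "t = h / (1 + h)"
  have s: "0 < s" and t: "0 < t" and st: "s + t = 1"
    using h by (auto simp: s_def t_def field_simps)
  have cv: "convex_on {0<..} (\<lambda>x::real. x powr p)"
    using powr_convex[of p] p by simp
  have "((1 - t) *\<^sub>R (a / s) + t *\<^sub>R (e / t)) powr p \<le> (1 - t) * (a / s) powr p + t * (e / t) powr p"
    by (rule convex_onD[OF cv]) (use s t st a e False in auto)
  also have "(1 - t) *\<^sub>R (a / s) + t *\<^sub>R (e / t) = a + e"
    using s t st by (simp add: eq_diff_eq flip: st)
  also have "(1 - t) * (a / s) powr p = s powr (1 - p) * a powr p"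
  proof -
    have "1 - t = s" using st by simp
    then show ?thesis using s a by (simp add: powr_divide powr_diff)
  qed
  also have "t * (e / t) powr p = t powr (1 - p) * e powr p"
    using t e by (simp add: powr_divide powr_diff)
  also have "s powr (1 - p) = (1 + h) powr (p - 1)"
    using h by (simp add: s_def powr_divide powr_diff)
  also have "t powr (1 - p) = (1 + h) powr (p - 1) * h powr (1 - p)"
    using h by (simp add: t_def powr_divide powr_diff)
  finally show ?thesis by (simp add: algebra_simps)
qed

lemma powr_add_le_twice:
  fixes a e p :: real
  assumes a: "0 \<le> a" and e: "0 \<le> e" and p: "1 < p" "p \<le> 2"
  shows "(a + e) powr p \<le> 2 * (a powr p + e powr p)"
proof -
  have "(a + e) powr p \<le> 2 powr (p - 1) * (a powr p + e powr p)"
    using powr_add_le_weighted[OF a e, of 1 p] p by simp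
  also have "\<dots> \<le> 2 powr 1 * (a powr p + e powr p)"
    using p by (intro mult_right_mono powr_mono) auto
  finally show ?thesis by simp
qed

lemma powr_le_self_of_ge_1:
  fixes x a :: real assumes "1 \<le> x" "a \<le> 1" shows "x powr a \<le> x"
  using powr_mono[of a 1 x] assms by simp

text \<open>Here \<open>Y\<close> is a normalized one-dimensional potential in the logarithmic variable \<open>\<sigma>\<close> and
  \<open>L \<sigma>\<close> is the part of the \<open>N\<close>-energy located beyond \<open>\<sigma>\<close>.\<close>

locale adams =
  fixes N :: nat and Y L :: "real \<Rightarrow> real" and p :: real
  assumes N: "2 \<le> N" and p_def: "p = real N / (real N - 1)"
  assumes L0: "\<And>s. 0 < s \<Longrightarrow> 0 \<le> L s" and L1: "\<And>s. 0 < s \<Longrightarrow> L s \<le> 1"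
  assumes Y0: "\<And>s. 0 < s \<Longrightarrow> 0 \<le> Y s"
  assumes Y1: "\<And>s. 0 < s \<Longrightarrow>
    Y s \<le> s powr (1/p) * (1 - L s) powr (1 / real N) + real N * L s powr (1 / real N)"
  assumes Y2: "\<And>s t. 0 < s \<Longrightarrow> s < t \<Longrightarrow>
    Y t \<le> s powr (1/p) + ((t - s) powr (1/p) + real N) * L s powr (1 / real N)"
begin

text \<open>Adams' function. In the variable \<open>s\<close> the critical exponential integral
  becomes the integral of exp(-q * defect s) over the half-line for some q > 0, so everything
  depends on how long the sublevel sets of \<open>defect\<close> are.\<close>

definition "defect s = s - Y s powr p"

definition "C0 = 4 * (real N powr p) * (real N - 1)"

lemma p_gt1: "1 < p" and p_le2: "p \<le> 2" and pm1: "p - 1 = 1 / (real N - 1)"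
  and pN: "(1 / real N) * p = 1 / (real N - 1)"
proof -
  have "2 \<le> real N" using N by simp
  then show "1 < p" "p \<le> 2" "p - 1 = 1 / (real N - 1)" "(1 / real N) * p = 1 / (real N - 1)"
    by (auto simp: p_def field_simps)
qed

lemma one_le_Np: "1 \<le> real N powr p" "2 \<le> C0"
proof -
  have "2 \<le> real N" using N by simp
  then show a: "1 \<le> real N powr p" using p_gt1 by (intro ge_one_powr_ge_zero) auto
  have "1 * 1 \<le> (real N powr p) * (real N - 1)" using a \<open>2 \<le> real N\<close> by (intro mult_mono) auto
  then show "2 \<le> C0" unfolding C0_def by linarith
qed

lemma powr_inv_p: "0 \<le> x \<Longrightarrow> (x powr (1/p)) powr p = x"
  using p_gt1 by (simp add: powr_powr)

text \<open>The energy 1 - l left before \<open>s\<close> cannot reach the full value s^(1/p):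
  Bernoulli's inequality gives a relative loss l/(N-1), half of which pays for merging in the
  contribution of the energy l. Read backwards, a small defect at \<open>s\<close> forces L s =
  O(1/s).\<close>

lemma defect_lower:
  assumes s: "0 < s"
  shows "s * L s / (2 * (real N - 1)) - C0 \<le> defect s"
proof (cases "L s = 0")
  case True
  have "Y s powr p \<le> (s powr (1/p)) powr p"
    using Y1[OF s] Y0[OF s] True p_gt1 N by (intro powr_mono2) (auto)
  then show ?thesis using True s one_le_Np by (simp add: defect_def powr_inv_p)
next
  case False
  have n: "1 \<le> real N - 1" using N by simp
  define l where "l = L s"
  \<comment> \<open>Half of the relative loss l/(N-1): the product (1 + h)(1 - 2h) is still at most
    1 - h, and as l/h is a constant, the second term stays below a multiple of N^p that
    \<open>C0\<close> absorbs.\<close>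
  define h where "h = l / (2 * (real N - 1))"
  have l: "0 < l" "l \<le> 1" using False L0[OF s] L1[OF s] by (auto simp: l_def)
  have h: "0 < h" "h \<le> 1" using l n by (auto simp: h_def divide_simps)
  have a: "(s powr (1/p) * (1 - l) powr (1 / real N)) powr p = s * (1 - l) powr (1 / (real N - 1))"
    using s l p_gt1 by (simp add: powr_mult powr_powr pN[simplified])
  have e: "(real N * l powr (1 / real N)) powr p = real N powr p * l powr (1 / (real N - 1))"
    using l by (simp add: powr_mult powr_powr pN[simplified])
  \<comment> \<open>Bernoulli's inequality as the weighted arithmetic-geometric mean inequality for
    1 - l and 1.\<close>
  have bern: "(1 - l) powr (1 / (real N - 1)) \<le> 1 - l / (real N - 1)"
  proof (cases "l = 1")
    case True then show ?thesis using n by (simp add: field_simps)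
  next
    case False
    have "(1 - l) powr (1 / (real N - 1)) * 1 powr (1 - 1 / (real N - 1)) \<le> 1 / (real N - 1) * (1 - l) + (1 - 1 / (real N - 1)) * 1"
      by (rule Youngs_inequality_0) (use n l False in \<open>auto simp: field_simps\<close>)
    also have "\<dots> = 1 - l / (real N - 1)" by (simp add: diff_divide_distrib)
    finally show ?thesis by simp
  qed
  have hl: "l powr (1 / (real N - 1)) * h powr (1 - p) \<le> 2 * (real N - 1)"
  proof -
    have "l powr (1 / (real N - 1)) * h powr (1 - p) = (l / h) powr (1 / (real N - 1))"
    proof -
      have "1 - p = - (1 / (real N - 1))" using pm1 by simp
      then show ?thesis using l h by (simp only: powr_minus) (simp add: powr_divide field_simps)
    qed
    also have "l / h = 2 * (real N - 1)" using l n by (simp add: h_def)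
    also have "(2 * (real N - 1)) powr (1 / (real N - 1)) \<le> 2 * (real N - 1)"
      using n by (intro powr_le_self_of_ge_1) auto
    finally show ?thesis .
  qed
  have "Y s powr p \<le> (s powr (1/p) * (1 - l) powr (1 / real N) + real N * l powr (1 / real N)) powr p"
    using Y1[OF s] Y0[OF s] p_gt1 by (intro powr_mono2) (auto simp: l_def)
  also have "\<dots> \<le> (1 + h) powr (p - 1) * (s * (1 - l) powr (1 / (real N - 1)) +
      real N powr p * l powr (1 / (real N - 1)) * h powr (1 - p))"
    unfolding a[symmetric] e[symmetric]
    by (rule powr_add_le_weighted) (use h p_gt1 in auto)
  also have "\<dots> \<le> (1 + h) * (s * (1 - l / (real N - 1)) + real N powr p * (2 * (real N - 1)))"
  proof (rule mult_mono)
    show "(1 + h) powr (p - 1) \<le> 1 + h" using h p_le2 by (intro powr_le_self_of_ge_1) auto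
    show "s * (1 - l) powr (1 / (real N - 1)) + real N powr p * l powr (1 / (real N - 1)) * h powr (1 - p)
        \<le> s * (1 - l / (real N - 1)) + real N powr p * (2 * (real N - 1))"
      unfolding mult.assoc by (rule add_mono[OF mult_left_mono[OF bern] mult_left_mono[OF hl]]) (use s in auto)
    show "0 \<le> s * (1 - l) powr (1 / (real N - 1)) + real N powr p * l powr (1 / (real N - 1)) * h powr (1 - p)"
      using s by simp
  qed (use h in auto)
  also have "\<dots> = (1 + h) * (s * (1 - l / (real N - 1))) + (1 + h) * (real N powr p * (2 * (real N - 1)))"
    by (simp add: algebra_simps)
  also have "\<dots> \<le> s * (1 - l / (2 * (real N - 1))) + 2 * (real N powr p * (2 * (real N - 1)))"
  proof (intro add_mono mult_right_mono)
    have "l / (real N - 1) = 2 * h" using n by (simp add: h_def field_simps)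
    then have "(1 + h) * (1 - l / (real N - 1)) = (1 + h) * (1 - 2 * h)" by simp
    also have "\<dots> \<le> 1 - h" using h by (simp add: algebra_simps)
    finally have "s * ((1 + h) * (1 - l / (real N - 1))) \<le> s * (1 - h)" using s by (intro mult_left_mono) auto
    then show "(1 + h) * (s * (1 - l / (real N - 1))) \<le> s * (1 - l / (2 * (real N - 1)))"
      by (simp add: h_def mult_ac)
  qed (use h n in auto)
  finally show ?thesis by (simp add: defect_def C0_def l_def algebra_simps)
qed

text \<open>By \<open>Y2\<close> the energy beyond \<open>s\<close>, at most K/s, would have to
  carry the potential from \<open>s\<close> on to \<open>t\<close>. It is so small that t - s
  reappears on the right with a factor of at most 1/2 and can be absorbed.\<close>

lemma defect_gap:
  assumes s: "0 < s" "s < t" and lam: "defect t \<le> lam" and K: "s * L s \<le> K" "0 < K" and sK: "8 ^ (N - 1) * K < s"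
  shows "t - s \<le> 2 * lam + 2 * 8 ^ (N - 1) * K + real N powr p"
proof -
  have n: "1 \<le> real N - 1" using N by simp
  \<comment> \<open>The power of 8 makes (L s / h)^(1/(N-1)) at most 1/8, so that with the factors 2
    from \<open>powr_add_le_twice\<close> and 1 + h \<le> 2 the coefficient of t - s is 1/2. The
    cost is h * s = 8^(N-1) * K, and \<open>sK\<close> ensures h \<le> 1.\<close>
  define h where "h = 8 ^ (N - 1) * K / s"
  have h: "0 < h" "h \<le> 1" using K s sK by (auto simp: h_def)
  define d where "d = t - s"
  have d: "0 < d" using s by (simp add: d_def)
  define r where "r = 1 / (real N - 1)"
  have r: "0 < r" "r \<le> 1" using n by (auto simp: r_def)
  have e1: "((d powr (1/p) + real N) * L s powr (1 / real N)) powr p \<le> 2 * (d + real N powr p) * L s powr r"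
  proof -
    have "((d powr (1/p) + real N) * L s powr (1 / real N)) powr p = (d powr (1/p) + real N) powr p * L s powr r"
      using L0[OF s(1)] by (simp add: powr_mult powr_powr pN[simplified] r_def)
    also have "\<dots> \<le> 2 * ((d powr (1/p)) powr p + real N powr p) * L s powr r"
      using p_gt1 p_le2 by (intro mult_right_mono powr_add_le_twice) auto
    finally show ?thesis using d by (simp add: powr_inv_p)
  qed
  have e2: "L s powr r * h powr (1 - p) \<le> 1 / 8"
  proof -
    have "1 - p = - r" using pm1 by (simp add: r_def)
    then have "L s powr r * h powr (1 - p) = (L s / h) powr r"
      using L0[OF s(1)] h by (simp only: powr_minus) (simp add: powr_divide field_simps)
    also have "\<dots> \<le> ((1/8) ^ (N - 1)) powr r"
    proof (intro powr_mono2)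
      show "L s / h \<le> (1 / 8) ^ (N - 1)"
        using K h s by (simp add: h_def field_simps power_divide)
    qed (use r h L0[OF s(1)] in auto)
    also have "\<dots> = ((1/8) powr (real N - 1)) powr r"
      using N by (simp add: powr_realpow[symmetric])
    also have "\<dots> = 1 / 8" using n by (simp add: powr_powr r_def)
    finally show ?thesis .
  qed
  have "t - lam \<le> Y t powr p" using lam by (simp add: defect_def)
  also have "\<dots> \<le> (s powr (1/p) + (d powr (1/p) + real N) * L s powr (1 / real N)) powr p"
    using Y2[OF s] Y0[of t] s p_gt1 by (intro powr_mono2) (auto simp: d_def)
  also have "\<dots> \<le> (1 + h) powr (p - 1) * ((s powr (1/p)) powr p +
      ((d powr (1/p) + real N) * L s powr (1 / real N)) powr p * h powr (1 - p))"
    by (rule powr_add_le_weighted) (use h p_gt1 d in auto)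
  also have "\<dots> \<le> (1 + h) * (s + 2 * (d + real N powr p) * (1 / 8))"
  proof (rule mult_mono)
    show "(1 + h) powr (p - 1) \<le> 1 + h" using h p_le2 by (intro powr_le_self_of_ge_1) auto
    have "((d powr (1/p) + real N) * L s powr (1 / real N)) powr p * h powr (1 - p) \<le> 2 * (d + real N powr p) * (1 / 8)"
      using mult_right_mono[OF e1, of "h powr (1 - p)"] mult_left_mono[OF e2, of "2 * (d + real N powr p)"] d
      by (simp add: mult_ac)
    then show "(s powr (1/p)) powr p + ((d powr (1/p) + real N) * L s powr (1 / real N)) powr p * h powr (1 - p)
        \<le> s + 2 * (d + real N powr p) * (1 / 8)"
      using s by (simp add: powr_inv_p)
    show "0 \<le> (s powr (1/p)) powr p + ((d powr (1/p) + real N) * L s powr (1 / real N)) powr p * h powr (1 - p)"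
      by simp
  qed (use h in auto)
  also have "\<dots> = s + h * s + (1 + h) * ((d + real N powr p) / 4)" by (simp add: field_simps)
  also have "\<dots> \<le> s + h * s + 2 * ((d + real N powr p) / 4)"
    using h d by (intro add_left_mono mult_right_mono) auto
  also have "h * s = 8 ^ (N - 1) * K" using s by (simp add: h_def)
  finally show ?thesis unfolding d_def mult.assoc by argo
qed

text \<open>The bound of \<open>defect_gap\<close> for lam = k and K = 2 (N-1) k, per unit of k
  \<ge> 1. As \<open>cA * k\<close> also exceeds 8^(N-1) * K, points beyond \<open>cA * k\<close>
  satisfy the largeness hypothesis of that lemma.\<close>

definition "cA = 2 + 4 * 8 ^ (N - 1) * (real N - 1) + real N powr p"

lemma cA_pos: "2 \<le> cA"
proof -
  have "2 \<le> real N" using N by simp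
  then have "0 \<le> 4 * 8 ^ (N - 1) * (real N - 1)" by (intro mult_nonneg_nonneg) auto
  then show ?thesis using one_le_Np by (simp add: cA_def)
qed

text \<open>Two points of the sublevel set \<open>{defect + C0 + 1 \<le> k}\<close> beyond \<open>cA * k\<close> are at most
  \<open>cA * k\<close> apart, so one centre \<open>z k\<close> serves for each level.\<close>

lemma sublevel_localized:
  "\<exists>z :: nat \<Rightarrow> real. \<forall>s>0. s / cA - C0 - 2 \<le> defect s \<or>
      (\<exists>k. real k - C0 - 2 \<le> defect s \<and> \<bar>s - z k\<bar> \<le> cA * real k)"
proof -
  \<comment> \<open>An arbitrary point of the level-k set beyond \<open>cA * k\<close>, if there is
    one: by the gap bound below every other such point lies within \<open>cA * k\<close> of it,
    whichever was chosen.\<close>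
  define z where "z k = (SOME s. 0 < s \<and> defect s + C0 + 1 \<le> real k \<and> cA * real k < s)" for k
  have "s / cA - C0 - 2 \<le> defect s \<or>
      (\<exists>k. real k - C0 - 2 \<le> defect s \<and> \<bar>s - z k\<bar> \<le> cA * real k)" if s: "0 < s" for s
  proof (rule disjCI)
    assume neg: "\<not> (\<exists>k. real k - C0 - 2 \<le> defect s \<and> \<bar>s - z k\<bar> \<le> cA * real k)"
    have n: "1 \<le> real N - 1" using N by simp
    have Fs: "- C0 \<le> defect s" if "0 < s" for s
    proof -
      have "0 \<le> s * L s / (2 * (real N - 1))" using that L0[OF that] n by simp
      then show ?thesis using defect_lower[OF that] by linarith
    qed
    \<comment> \<open>Rounding \<open>defect s + C0 + 1\<close> up adds less than one more, hence
      the 2 in the statement. The extra 1 guarantees k \<ge> 1, which lets N^p be bounded by N^p * k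
      in the gap estimate.\<close>
    define k where "k = nat \<lceil>defect s + C0 + 1\<rceil>"
    have k: "defect s + C0 + 1 \<le> real k" "real k < defect s + C0 + 2" "1 \<le> real k"
      using Fs[OF s] unfolding k_def by linarith+
    have "\<not> cA * real k < s"
    proof
      assume "cA * real k < s"
      with k s have ex: "\<exists>s. 0 < s \<and> defect s + C0 + 1 \<le> real k \<and> cA * real k < s" by blast
      have z: "0 < z k" "defect (z k) + C0 + 1 \<le> real k" "cA * real k < z k"
        using someI_ex[OF ex] unfolding z_def by auto
      have gap: "b - a \<le> cA * real k"
        if ab: "0 < a" "a < b" "defect a + C0 + 1 \<le> real k" "defect b + C0 + 1 \<le> real k" "cA * real k < a" for a b
      proof -
        have K: "a * L a \<le> 2 * (real N - 1) * real k"
        proof -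
          have "a * L a / (2 * (real N - 1)) \<le> real k" using defect_lower[OF ab(1)] ab(3) by simp
          then show ?thesis using n by (simp add: divide_le_eq mult_ac)
        qed
        have le: "8 ^ (N - 1) * (2 * (real N - 1) * real k) \<le> cA * real k"
        proof -
          have "8 ^ (N - 1) * (2 * (real N - 1)) \<le> cA"
          proof -
            have "0 \<le> (8::real) ^ (N - 1) * (2 * (real N - 1))" using n by (intro mult_nonneg_nonneg) auto
            moreover have "cA = 2 + 2 * (8 ^ (N - 1) * (2 * (real N - 1))) + real N powr p"
              by (simp add: cA_def)
            ultimately show ?thesis using one_le_Np by linarith
          qed
          then show ?thesis using k(3) by (simp add: mult.assoc[symmetric] mult_right_mono)
        qed
        have "b - a \<le> 2 * real k + 2 * 8 ^ (N - 1) * (2 * (real N - 1) * real k) + real N powr p"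
          using ab le k n one_le_Np by (intro defect_gap[OF ab(1,2) _ K]) (linarith, simp, linarith)
        also have "\<dots> \<le> 2 * real k + 2 * 8 ^ (N - 1) * (2 * (real N - 1) * real k) + real N powr p * real k"
          using k one_le_Np mult_left_mono[of 1 "real k" "real N powr p"] by auto
        also have "\<dots> = cA * real k" by (simp add: cA_def algebra_simps)
        finally show ?thesis .
      qed
      have "\<bar>s - z k\<bar> \<le> cA * real k"
      proof (cases s "z k" rule: linorder_cases)
        case less then show ?thesis using gap[OF s less k(1) z(2)] \<open>cA * real k < s\<close> by simp
      next
        case equal then show ?thesis using cA_pos k by simp
      next
        case greater then show ?thesis using gap[OF z(1) greater z(2) k(1) z(3)] by simp
      qed
      with neg k show False by force
    qed
    then have "s \<le> cA * real k" by simp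
    then have "s / cA \<le> real k" using cA_pos by (simp add: divide_le_eq mult_ac)
    then show "s / cA - C0 - 2 \<le> defect s" using k by linarith
  qed
  then show ?thesis by blast
qed

end

section \<open>Radial integrals and the bathtub principle\<close>

lemma nn_integral_Holder:
  fixes f g :: "'a \<Rightarrow> real"
  assumes [measurable]: "f \<in> borel_measurable M" "g \<in> borel_measurable M"
    and f0: "\<And>x. 0 \<le> f x" and g0: "\<And>x. 0 \<le> g x"
    and p: "1 < p" and q: "1 < q" and pq: "1 / p + 1 / q = 1"
    and A: "(\<integral>\<^sup>+x. ennreal (f x powr p) \<partial>M) \<le> ennreal A" "0 \<le> A"
    and C: "(\<integral>\<^sup>+x. ennreal (g x powr q) \<partial>M) \<le> ennreal C" "0 \<le> C"
  shows "(\<integral>\<^sup>+x. ennreal (f x * g x) \<partial>M) \<le> ennreal (A powr (1/p) * C powr (1/q))"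
proof (cases "A = 0 \<or> C = 0")
  case True
  have "AE x in M. f x * g x = 0"
    using True
  proof
    assume "A = 0"
    then have "(\<integral>\<^sup>+x. ennreal (f x powr p) \<partial>M) = 0" using A by simp
    then have "AE x in M. ennreal (f x powr p) = 0" by (subst (asm) nn_integral_0_iff_AE) auto
    then show ?thesis by eventually_elim (auto)
  next
    assume "C = 0"
    then have "(\<integral>\<^sup>+x. ennreal (g x powr q) \<partial>M) = 0" using C by simp
    then have "AE x in M. ennreal (g x powr q) = 0" by (subst (asm) nn_integral_0_iff_AE) auto
    then show ?thesis by eventually_elim (auto)
  qed
  then have "(\<integral>\<^sup>+x. ennreal (f x * g x) \<partial>M) = (\<integral>\<^sup>+x. 0 \<partial>M)"
    by (intro nn_integral_cong_AE) (auto elim: eventually_mono)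
  then show ?thesis by simp
next
  case False
  then have A0: "0 < A" and C0: "0 < C" using A C by auto
  \<comment> \<open>Young's inequality is applied to f/a and g/c, normalised by the prescribed
    bounds instead of the norms; a zero bound had to be treated before because of the
    division.\<close>
  define a where "a = A powr (1/p)"
  define c where "c = C powr (1/q)"
  have a: "0 < a" and c: "0 < c" and ap: "a powr p = A" and cq: "c powr q = C"
    using A0 C0 p q by (auto simp: a_def c_def powr_powr)
  have "(\<integral>\<^sup>+x. ennreal (f x * g x) \<partial>M)
      \<le> (\<integral>\<^sup>+x. ennreal (a * c / (p * A)) * ennreal (f x powr p) + ennreal (a * c / (q * C)) * ennreal (g x powr q) \<partial>M)"
  proof (rule nn_integral_mono)
    fix x
    have "f x / a * (g x / c) \<le> (f x / a) powr p / p + (g x / c) powr q / q"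
      by (rule Youngs_inequality) (use p q pq f0 g0 a c in auto)
    then have "(a * c) * (f x / a * (g x / c)) \<le> (a * c) * ((f x / a) powr p / p + (g x / c) powr q / q)"
      using a c by (intro mult_left_mono) auto
    then have "f x * g x \<le> a * c / (p * A) * f x powr p + a * c / (q * C) * g x powr q"
      using a c f0 g0 ap cq by (simp add: powr_divide distrib_left mult_ac)
    then show "ennreal (f x * g x) \<le> ennreal (a * c / (p * A)) * ennreal (f x powr p) + ennreal (a * c / (q * C)) * ennreal (g x powr q)"
      using a c A0 C0 p q by (simp add: ennreal_mult[symmetric] ennreal_plus[symmetric] ennreal_leI del: ennreal_plus)
  qed
  also have "\<dots> = ennreal (a * c / (p * A)) * (\<integral>\<^sup>+x. ennreal (f x powr p) \<partial>M)
      + ennreal (a * c / (q * C)) * (\<integral>\<^sup>+x. ennreal (g x powr q) \<partial>M)"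
    by (simp add: nn_integral_add nn_integral_cmult)
  also have "\<dots> \<le> ennreal (a * c / (p * A)) * ennreal A + ennreal (a * c / (q * C)) * ennreal C"
    by (intro add_mono mult_left_mono A C) auto
  also have "\<dots> = ennreal (a * c / p + a * c / q)"
    using a c A0 C0 p q by (simp add: ennreal_mult[symmetric] ennreal_plus[symmetric] del: ennreal_plus)
  also have "a * c / p + a * c / q = a * c"
    using pq by (metis distrib_left mult.right_neutral times_divide_eq_right)
  finally show ?thesis by (simp add: a_def c_def)
qed

text \<open>Jensen's inequality, as Hoelder's inequality against the constant 1 on a space of total
  mass 1.\<close>

lemma nn_integral_prob_powr_le:
  fixes f :: "'a \<Rightarrow> real"
  assumes [measurable]: "f \<in> borel_measurable M" and f0: "\<And>x. 0 \<le> f x" and p: "1 < p"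
    and M: "emeasure M (space M) = 1" and A: "(\<integral>\<^sup>+x. ennreal (f x powr p) \<partial>M) \<le> ennreal A" "0 \<le> A"
  shows "(\<integral>\<^sup>+x. ennreal (f x) \<partial>M) \<le> ennreal (A powr (1/p))"
proof -
  have "(\<integral>\<^sup>+x. ennreal (f x * 1) \<partial>M) \<le> ennreal (A powr (1/p) * 1 powr (1 / (p / (p - 1))))"
    by (rule nn_integral_Holder) (use p f0 A M in \<open>auto simp: field_simps\<close>)
  then show ?thesis by simp
qed

section \<open>Dilations, translations and reflections\<close>

lemma nn_integral_lborel_affine:
  fixes t :: "'a::euclidean_space"
  assumes [measurable]: "f \<in> borel_measurable borel" and c: "c \<noteq> 0"
  shows "(\<integral>\<^sup>+x. f x \<partial>lborel) = ennreal (\<bar>c\<bar> ^ DIM('a)) * (\<integral>\<^sup>+x. f (t + c *\<^sub>R x) \<partial>lborel)"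
  by (subst lborel_affine[OF c, of t])
     (simp add: nn_integral_density nn_integral_distr nn_integral_cmult)

lemma nn_integral_lborel_translate:
  fixes t :: "'a::euclidean_space"
  assumes [measurable]: "f \<in> borel_measurable borel"
  shows "(\<integral>\<^sup>+x. f (t + x) \<partial>lborel) = (\<integral>\<^sup>+x. f x \<partial>lborel)"
  by (subst nn_integral_lborel_affine[of f 1 t]) auto

lemma nn_integral_lborel_reflect:
  fixes t :: "'a::euclidean_space"
  assumes [measurable]: "f \<in> borel_measurable borel"
  shows "(\<integral>\<^sup>+x. f (t - x) \<partial>lborel) = (\<integral>\<^sup>+x. f x \<partial>lborel)"
  by (subst nn_integral_lborel_affine[of f "-1" t]) auto

section \<open>Integrals of radial functions\<close>

lemma unit_ball_vol_nat_pos: "0 < unit_ball_vol (real n)"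
  by simp

lemma DIM_ge_1: "1 \<le> real DIM('a::euclidean_space)"
  using DIM_positive[where 'a='a] by linarith

text \<open>Half-lines form an intersection-stable generator, and both sides give {..a} the volume
  of the ball of radius a, or 0 for negative a. Polar coordinates are thereby replaced by the volume
  formula for balls.\<close>

lemma distr_norm_lborel:
  "distr (lborel :: 'a::euclidean_space measure) borel norm
    = density lborel (\<lambda>r. ennreal (real DIM('a) * unit_ball_vol DIM('a) * r ^ (DIM('a) - 1)) * indicator {0..} r)"
  (is "?M = ?D")
proof (rule measure_eqI_generator_eq)
  let ?E = "range (atMost :: real \<Rightarrow> _)"
  let ?n = "DIM('a)" let ?b = "unit_ball_vol (real DIM('a))"
  have [simp]: "0 \<le> ?b" by simp
  show "Int_stable ?E" by (auto simp: Int_stable_def)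
  show "?E \<subseteq> Pow UNIV" by simp
  show "sets ?M = sigma_sets UNIV ?E" "sets ?D = sigma_sets UNIV ?E"
    by (simp_all add: borel_eq_atMost)
  have M: "emeasure ?M {..a} = ennreal (?b * max a 0 ^ ?n)" for a
  proof -
    have "norm -` {..a} \<inter> space lborel = cball (0::'a) a" by auto
    then have "emeasure ?M {..a} = emeasure lborel (cball (0::'a) a)" by (subst emeasure_distr) auto
    also have "\<dots> = ennreal (?b * max a 0 ^ ?n)"
    proof (cases "0 \<le> a")
      case True then show ?thesis by (simp add: emeasure_cball)
    next
      case False then show ?thesis by simp
    qed
    finally show ?thesis .
  qed
  have D: "emeasure ?D {..a} = ennreal (?b * max a 0 ^ ?n)" for a
  proof -
    have "emeasure ?D {..a} = (\<integral>\<^sup>+r. ennreal (real ?n * ?b * r ^ (?n - 1)) * indicator {0..} r * indicator {..a} r \<partial>lborel)"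
      by (subst emeasure_density) auto
    also have "\<dots> = (\<integral>\<^sup>+r. ennreal (real ?n * ?b * r ^ (?n - 1)) * indicator {0..a} r \<partial>lborel)"
      by (intro nn_integral_cong) (auto split: split_indicator)
    also have "\<dots> = ennreal (?b * max a 0 ^ ?n)"
    proof (cases "0 \<le> a")
      case True
      have "(\<integral>\<^sup>+r. ennreal (real ?n * ?b * r ^ (?n - 1)) * indicator {0..a} r \<partial>lborel) = ennreal (?b * a ^ ?n - ?b * 0 ^ ?n)"
        by (rule nn_integral_FTC_Icc) (use True in \<open>auto intro!: derivative_eq_intros mult_nonneg_nonneg\<close>)
      then show ?thesis using True by simp
    qed simp
    finally show ?thesis .
  qed
  show "emeasure ?M X = emeasure ?D X" if "X \<in> ?E" for X
    using that by (auto simp only: M D)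
  show "range (\<lambda>i::nat. {..real i}) \<subseteq> ?E" by auto
  show "(\<Union>i::nat. {..real i}) = UNIV"
    by (auto intro: real_arch_simple)
  show "emeasure ?M {..real i} \<noteq> \<infinity>" for i by (simp add: M)
qed

lemma nn_integral_radial:
  fixes f :: "real \<Rightarrow> ennreal"
  assumes [measurable]: "f \<in> borel_measurable borel"
  shows "(\<integral>\<^sup>+x. f (norm (x::'a::euclidean_space)) \<partial>lborel)
    = (\<integral>\<^sup>+r. ennreal (real DIM('a) * unit_ball_vol DIM('a) * r ^ (DIM('a) - 1)) * indicator {0..} r * f r \<partial>lborel)"
proof -
  have "(\<integral>\<^sup>+x. f (norm (x::'a)) \<partial>lborel) = (\<integral>\<^sup>+r. f r \<partial>distr (lborel :: 'a measure) borel norm)"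
    by (simp add: nn_integral_distr)
  then show ?thesis by (simp add: distr_norm_lborel nn_integral_density)
qed

lemma nn_integral_powr_Icc:
  fixes a c :: real
  assumes a: "-1 < a" and c: "0 \<le> c"
  shows "(\<integral>\<^sup>+x. ennreal (x powr a) * indicator {0..c} x \<partial>lborel) = ennreal (c powr (a + 1) / (a + 1))"
  by (rule nn_integral_has_integral_lebesgue'[OF _ has_integral_powr_from_0[OF a c]]) simp

lemma nn_integral_norm_powr_ball:
  assumes g: "g < real DIM('a)" and R: "0 \<le> R"
  shows "(\<integral>\<^sup>+x. ennreal (norm (x::'a::euclidean_space) powr (-g)) * indicator {x. norm x \<le> R} x \<partial>lborel)
    = ennreal (real DIM('a) * unit_ball_vol DIM('a) / (real DIM('a) - g) * R powr (real DIM('a) - g))"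
proof -
  let ?n = "real DIM('a)" let ?b = "unit_ball_vol (real DIM('a))"
  have [simp]: "0 \<le> ?b" by simp
  have "(\<integral>\<^sup>+x. ennreal (norm (x::'a) powr (-g)) * indicator {x. norm x \<le> R} x \<partial>lborel)
      = (\<integral>\<^sup>+x. (\<lambda>r. ennreal (r powr (-g)) * indicator {..R} r) (norm (x::'a)) \<partial>lborel)"
    by (intro nn_integral_cong) (auto split: split_indicator)
  also have "\<dots> = (\<integral>\<^sup>+r. ennreal (?n * ?b * r ^ (DIM('a) - 1)) * indicator {0..} r * (ennreal (r powr (-g)) * indicator {..R} r) \<partial>lborel)"
    by (rule nn_integral_radial) measurable
  also have "\<dots> = (\<integral>\<^sup>+r. ennreal (?n * ?b) * (ennreal (r powr (?n - 1 - g)) * indicator {0..R} r) \<partial>lborel)"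
  proof (intro nn_integral_cong_AE)
    have "AE r::real in lborel. r \<noteq> 0" by (rule AE_lborel_singleton)
    then show "AE r in lborel. ennreal (?n * ?b * r ^ (DIM('a) - 1)) * indicator {0..} r * (ennreal (r powr (-g)) * indicator {..R} r)
       = ennreal (?n * ?b) * (ennreal (r powr (?n - 1 - g)) * indicator {0..R} r)"
    proof eventually_elim
      case (elim r)
      have "r powr (?n - 1 - g) = r ^ (DIM('a) - 1) * r powr (-g)" if "0 < r"
        using that DIM_positive[where 'a='a]
        by (simp add: powr_realpow[symmetric] powr_add[symmetric] algebra_simps of_nat_diff Suc_leI)
      then show ?case using elim
        by (auto split: split_indicator simp: ennreal_mult[symmetric] mult_ac)
    qed
  qed
  also have "\<dots> = ennreal (?n * ?b) * ennreal (R powr (?n - 1 - g + 1) / (?n - 1 - g + 1))"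
    using g R by (subst nn_integral_cmult, measurable) (subst nn_integral_powr_Icc, auto)
  also have "\<dots> = ennreal (?n * ?b / (?n - g) * R powr (?n - g))"
    using g by (simp add: ennreal_mult[symmetric])
  finally show ?thesis .
qed

lemma nn_integral_norm_powr_annulus:
  assumes a: "0 < a" and ab: "a \<le> c"
  shows "(\<integral>\<^sup>+x. ennreal (norm (x::'a::euclidean_space) powr (- real DIM('a))) * indicator {x. a \<le> norm x \<and> norm x \<le> c} x \<partial>lborel)
    = ennreal (real DIM('a) * unit_ball_vol DIM('a) * ln (c / a))"
proof -
  let ?n = "real DIM('a)" let ?b = "unit_ball_vol (real DIM('a))"
  have [simp]: "0 \<le> ?b" by simp
  have "(\<integral>\<^sup>+x. ennreal (norm (x::'a) powr (-?n)) * indicator {x. a \<le> norm x \<and> norm x \<le> c} x \<partial>lborel)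
      = (\<integral>\<^sup>+x. (\<lambda>r. ennreal (r powr (-?n)) * indicator {a..c} r) (norm (x::'a)) \<partial>lborel)"
    by (intro nn_integral_cong) (auto split: split_indicator)
  also have "\<dots> = (\<integral>\<^sup>+r. ennreal (?n * ?b * r ^ (DIM('a) - 1)) * indicator {0..} r * (ennreal (r powr (-?n)) * indicator {a..c} r) \<partial>lborel)"
    by (rule nn_integral_radial) measurable
  also have "\<dots> = (\<integral>\<^sup>+r. ennreal (?n * ?b) * (ennreal (1 / r) * indicator {a..c} r) \<partial>lborel)"
  proof (intro nn_integral_cong)
    fix r :: real
    have "1 / r = r ^ (DIM('a) - 1) * r powr (-?n)" if "0 < r"
      using that DIM_positive[where 'a='a]
      by (simp add: powr_realpow[symmetric] of_nat_diff Suc_leI powr_minus_divide powr_diff)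
    then show "ennreal (?n * ?b * r ^ (DIM('a) - 1)) * indicator {0..} r * (ennreal (r powr (-?n)) * indicator {a..c} r)
       = ennreal (?n * ?b) * (ennreal (1 / r) * indicator {a..c} r)" using a
      by (auto split: split_indicator simp: ennreal_mult[symmetric] mult_ac)
  qed
  also have "\<dots> = ennreal (?n * ?b) * ennreal (ln c - ln a)"
    using a ab by (subst nn_integral_cmult, measurable) (subst nn_integral_FTC_Icc[where F=ln], auto intro!: DERIV_ln_divide)
  also have "\<dots> = ennreal (?n * ?b * ln (c / a))"
    using a ab by (simp add: ennreal_mult[symmetric] ln_div)
  finally show ?thesis .
qed

section \<open>The ball as the extremal set for a decreasing kernel\<close>

lemma ball_of_volume:
  assumes t: "0 \<le> t"
  defines "R \<equiv> (t / unit_ball_vol DIM('a)) powr (1 / real DIM('a))"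
  shows "emeasure lborel {x::'a::euclidean_space. norm x \<le> R} = ennreal t"
proof -
  have "{x::'a. norm x \<le> R} = cball 0 R" by auto
  moreover have "R ^ DIM('a) = t / unit_ball_vol DIM('a)"
  proof -
    have "R ^ DIM('a) = R powr real DIM('a)" using t by (cases "R = 0") (auto simp: powr_realpow R_def)
    also have "\<dots> = t / unit_ball_vol DIM('a)" using t by (simp add: R_def powr_powr)
    finally show ?thesis .
  qed
  ultimately show ?thesis
    by (simp add: emeasure_cball R_def unit_ball_vol_nat_pos[THEN less_imp_neq, symmetric])
qed

text \<open>Bathtub principle: if D is the ball about \<open>y\<close> with the measure of
  \<open>A\<close>, then A - D and D - A have equal measure, while the kernel is at most R^(-g) on
  the first and, off the centre, at least R^(-g) on the second. Exchanging them can only increase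
  the integral.\<close>

lemma nn_integral_norm_powr_le_ball:
  fixes A :: "'a::euclidean_space set"
  assumes A[measurable]: "A \<in> sets borel" and t: "emeasure lborel A = ennreal t" "0 \<le> t"
    and g: "0 \<le> g" "g < real DIM('a)"
  shows "(\<integral>\<^sup>+x. ennreal (norm (x - y) powr (-g)) * indicator A x \<partial>lborel)
    \<le> ennreal (real DIM('a) * unit_ball_vol DIM('a) / (real DIM('a) - g)
        * (t / unit_ball_vol DIM('a)) powr ((real DIM('a) - g) / real DIM('a)))"
proof (cases "t = 0")
  case True
  then have "A \<in> null_sets lborel" using t by (auto simp: null_sets_def)
  then have "AE x in lborel. x \<notin> A" by (rule AE_not_in)
  then have "AE x in lborel. ennreal (norm (x - y) powr (-g)) * indicator A x = 0"
    by eventually_elim auto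
  then have "(\<integral>\<^sup>+x. ennreal (norm (x - y) powr (-g)) * indicator A x \<partial>lborel) = (\<integral>\<^sup>+(x::'a). 0 \<partial>lborel)"
    by (rule nn_integral_cong_AE)
  then show ?thesis by simp
next
  case False
  define R where "R = (t / unit_ball_vol DIM('a)) powr (1 / real DIM('a))"
  define K where "K x = norm (x - y) powr (-g)" for x
  define D where "D = {x. norm (x - y) \<le> R}"
  have [measurable]: "D \<in> sets borel" "K \<in> borel_measurable borel"
    unfolding D_def K_def[abs_def] by measurable
  have Rpos: "0 < R" and R0: "0 \<le> R" using t False
    by (auto simp: R_def unit_ball_vol_nat_pos[THEN less_imp_neq, symmetric])
  have eD: "emeasure lborel D = ennreal t"
  proof -
    have "emeasure lborel D = (\<integral>\<^sup>+x. indicator D x \<partial>lborel)" by simp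
    also have "\<dots> = (\<integral>\<^sup>+x. indicator D (y + x) \<partial>lborel)"
      by (rule nn_integral_lborel_translate[symmetric]) measurable
    also have "\<dots> = (\<integral>\<^sup>+x. indicator {x::'a. norm x \<le> R} x \<partial>lborel)"
      by (intro nn_integral_cong) (auto simp: D_def split: split_indicator)
    also have "\<dots> = emeasure lborel {x::'a. norm x \<le> R}" by simp
    finally show ?thesis using ball_of_volume[OF t(2), where 'a='a] by (simp add: R_def)
  qed
  have sw: "emeasure lborel (A - D) = emeasure lborel (D - A)"
  proof -
    have "emeasure lborel (A - D) + emeasure lborel (A \<inter> D) = emeasure lborel (D - A) + emeasure lborel (A \<inter> D)"
    proof -
      have "emeasure lborel (A - D) + emeasure lborel (A \<inter> D) = emeasure lborel ((A - D) \<union> (A \<inter> D))"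
        by (rule plus_emeasure) auto
      also have "(A - D) \<union> (A \<inter> D) = A" by auto
      also have "emeasure lborel A = emeasure lborel D" using t eD by simp
      also have "emeasure lborel D = emeasure lborel ((D - A) \<union> (A \<inter> D))"
        by (rule arg_cong[where f="emeasure lborel"]) auto
      also have "\<dots> = emeasure lborel (D - A) + emeasure lborel (A \<inter> D)"
        by (rule plus_emeasure[symmetric]) auto
      finally show ?thesis .
    qed
    moreover have "emeasure lborel (A \<inter> D) \<noteq> \<infinity>"
      using emeasure_mono[of "A \<inter> D" A lborel] t by (auto simp: top_unique)
    ultimately show ?thesis by (simp add: ennreal_add_left_cancel add.commute)
  qed
  have "(\<integral>\<^sup>+x. ennreal (K x) * indicator A x \<partial>lborel)
     = (\<integral>\<^sup>+x. ennreal (K x) * indicator (A \<inter> D) x + ennreal (K x) * indicator (A - D) x \<partial>lborel)"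
    by (intro nn_integral_cong) (auto split: split_indicator)
  also have "\<dots> \<le> (\<integral>\<^sup>+x. ennreal (K x) * indicator (A \<inter> D) x + ennreal (R powr (-g)) * indicator (A - D) x \<partial>lborel)"
  proof (intro nn_integral_mono add_left_mono)
    fix x
    show "ennreal (K x) * indicator (A - D) x \<le> ennreal (R powr (-g)) * indicator (A - D) x"
    proof (cases "x \<in> A - D")
      case True
      then have "K x \<le> R powr (-g)" unfolding K_def using g Rpos by (intro powr_mono2') (auto simp: D_def)
      then show ?thesis using True by (simp add: ennreal_leI)
    next
      case False
      then show ?thesis by simp
    qed
  qed
  also have "\<dots> = (\<integral>\<^sup>+x. ennreal (K x) * indicator (A \<inter> D) x \<partial>lborel) + ennreal (R powr (-g)) * emeasure lborel (D - A)"
    by (subst nn_integral_add) (auto simp: nn_integral_cmult sw)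
  finally have 1: "(\<integral>\<^sup>+x. ennreal (K x) * indicator A x \<partial>lborel)
    \<le> (\<integral>\<^sup>+x. ennreal (K x) * indicator (A \<inter> D) x \<partial>lborel) + ennreal (R powr (-g)) * emeasure lborel (D - A)" .
  have "ennreal (R powr (-g)) * emeasure lborel (D - A) = (\<integral>\<^sup>+x. ennreal (R powr (-g)) * indicator (D - A) x \<partial>lborel)"
    by (simp add: nn_integral_cmult)
  also have "\<dots> \<le> (\<integral>\<^sup>+x. ennreal (K x) * indicator (D - A) x \<partial>lborel)"
  proof (intro nn_integral_mono_AE)
    \<comment> \<open>At x = y the convention \<open>0 powr (-g) = 0\<close> breaks the comparison,
      so this null set is discarded.\<close>
    have "AE x in lborel. x \<noteq> y" by (rule AE_lborel_singleton)
    then show "AE x in lborel. ennreal (R powr (-g)) * indicator (D - A) x \<le> ennreal (K x) * indicator (D - A) x"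
    proof eventually_elim
      case (elim x)
      then show ?case unfolding K_def using g
        by (auto simp: D_def split: split_indicator intro!: ennreal_leI powr_mono2')
    qed
  qed
  finally have "(\<integral>\<^sup>+x. ennreal (K x) * indicator A x \<partial>lborel)
    \<le> (\<integral>\<^sup>+x. ennreal (K x) * indicator (A \<inter> D) x \<partial>lborel) + (\<integral>\<^sup>+x. ennreal (K x) * indicator (D - A) x \<partial>lborel)"
    using 1 by (metis (no_types, lifting) add_left_mono order_trans)
  also have "(\<integral>\<^sup>+x. ennreal (K x) * indicator (A \<inter> D) x \<partial>lborel) + (\<integral>\<^sup>+x. ennreal (K x) * indicator (D - A) x \<partial>lborel)
      = (\<integral>\<^sup>+x. ennreal (K x) * indicator D x \<partial>lborel)"
    by (subst nn_integral_add[symmetric]) (auto intro!: nn_integral_cong split: split_indicator)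
  also have "\<dots> = (\<integral>\<^sup>+x. ennreal (K (y + x)) * indicator D (y + x) \<partial>lborel)"
    by (rule nn_integral_lborel_translate[symmetric]) measurable
  also have "\<dots> = (\<integral>\<^sup>+x. ennreal (norm (x::'a) powr (-g)) * indicator {x. norm x \<le> R} x \<partial>lborel)"
    by (intro nn_integral_cong) (auto simp: D_def K_def split: split_indicator)
  also have "\<dots> = ennreal (real DIM('a) * unit_ball_vol DIM('a) / (real DIM('a) - g) * R powr (real DIM('a) - g))"
    by (rule nn_integral_norm_powr_ball[OF g(2) R0])
  also have "R powr (real DIM('a) - g) = (t / unit_ball_vol DIM('a)) powr ((real DIM('a) - g) / real DIM('a))"
    unfolding R_def powr_powr by simp
  finally show ?thesis by (simp add: K_def)
qed

section \<open>Rearrangement of Riesz potentials\<close>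

text \<open>In the application \<open>F\<close> is the length of the mollified gradient cut down to
  a set {|w| > th}, and \<open>m\<close> is Chebyshev's bound for the measure of that set. The
  numbers n, b, p are parameters tied by equations, so that constants built from them can be quoted
  outside without mentioning \<open>F\<close> and \<open>m\<close>.\<close>

locale rearrangement =
  fixes F :: "'a::euclidean_space \<Rightarrow> real" and m p n b :: real
  assumes F_meas[measurable]: "F \<in> borel_measurable borel"
    and F_nonneg: "\<And>x. 0 \<le> F x"
    and dim2: "2 \<le> DIM('a)"
    and n_eq: "n = real DIM('a)"
    and b_eq: "b = unit_ball_vol (real DIM('a))"
    and p_eq: "p = n / (n - 1)"
    and m_pos: "0 < m"
    and F_norm: "(\<integral>\<^sup>+x. ennreal (F x powr n) \<partial>lborel) \<le> 1"
    and F_supp: "emeasure lborel {x. 0 < F x} \<le> ennreal m"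
begin



text \<open>\<open>fs\<close> is the decreasing rearrangement of \<open>F\<close>, written as the length of the set of levels whose
  superlevel set has measure greater than \<open>s\<close>; \<open>Gam t\<close> bounds the mean of the Riesz potential of
  \<open>F\<close> over any set of measure \<open>t\<close>, up to the factor \<open>n * b\<close>.\<close>

definition "mu l = measure lborel {x. l < F x}"
text \<open>Radius of the ball of volume \<open>t\<close>.\<close>

definition "rho t = (t / b) powr (1 / n)"
definition "Gam t = (\<integral>\<^sup>+l. indicator {0<..} l * ennreal (min (rho (mu l)) (mu l * rho t / t)) \<partial>lborel)"
definition "fs s = measure lborel {l. 0 < l \<and> s < mu l}"
text \<open>Energy of \<open>fs\<close> on (0, t). With t = m exp(-s) it becomes the energy beyond
  \<open>s\<close> in the logarithmic variable.\<close>

definition "L t = enn2real (\<integral>\<^sup>+s. indicator {0<..<t} s * ennreal (fs s powr n) \<partial>lborel)"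

lemma b_pos: "0 < b" by (simp add: b_eq)

lemma n2: "2 \<le> n" using dim2 by (simp add: n_eq)

lemma emeasure_superlevel: "0 \<le> l \<Longrightarrow> emeasure lborel {x. l < F x} = ennreal (mu l)"
  unfolding mu_def
proof (rule emeasure_eq_ennreal_measure)
  assume "0 \<le> l"
  then have "emeasure lborel {x. l < F x} \<le> emeasure lborel {x. 0 < F x}"
    by (intro emeasure_mono) auto
  also have "\<dots> \<le> ennreal m" by (rule F_supp)
  finally show "emeasure lborel {x. l < F x} \<noteq> top" by (auto simp: top_unique)
qed

lemma mu_nonneg: "0 \<le> mu l" by (simp add: mu_def)

lemma mu_le_m: "0 \<le> l \<Longrightarrow> mu l \<le> m"
proof -
  assume l: "0 \<le> l"
  have "ennreal (mu l) \<le> emeasure lborel {x. 0 < F x}"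
    unfolding emeasure_superlevel[OF l, symmetric] using l by (intro emeasure_mono) auto
  also have "\<dots> \<le> ennreal m" by (rule F_supp)
  finally show ?thesis using m_pos by simp
qed

lemma mu_antimono: "0 \<le> l \<Longrightarrow> l \<le> l' \<Longrightarrow> mu l' \<le> mu l"
proof -
  assume l: "0 \<le> l" "l \<le> l'"
  have "emeasure lborel {x. l' < F x} \<le> emeasure lborel {x. l < F x}"
    using l by (intro emeasure_mono) auto
  then have "ennreal (mu l') \<le> ennreal (mu l)"
    using emeasure_superlevel[of l] emeasure_superlevel[of l'] l by auto
  then show ?thesis using mu_nonneg by simp
qed

lemma mu_meas[measurable]: "mu \<in> borel_measurable borel"
  unfolding mu_def[abs_def] measure_def by measurable

lemma rho_meas[measurable]: "rho \<in> borel_measurable borel"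
  unfolding rho_def[abs_def] by measurable

lemma fs_meas[measurable]: "fs \<in> borel_measurable borel"
  unfolding fs_def[abs_def] measure_def by measurable

lemma rho_nonneg: "0 \<le> rho t" by (simp add: rho_def)

lemma fs_nonneg: "0 \<le> fs t" by (simp add: fs_def)

lemma rho_div: "0 < t \<Longrightarrow> rho t / t = t powr (1 / n - 1) / b powr (1 / n)"
  by (simp add: rho_def powr_divide powr_diff)

lemma rho_div_antimono: "0 < s \<Longrightarrow> s \<le> t \<Longrightarrow> rho t / t \<le> rho s / s"
  using n2 by (simp add: rho_div divide_right_mono powr_mono2')

lemma Gam_antimono: "0 < s \<Longrightarrow> s \<le> t \<Longrightarrow> Gam t \<le> Gam s"
proof -
  assume s: "0 < s" "s \<le> t"
  have "mu l * rho t / t \<le> mu l * rho s / s" for l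
    using mult_left_mono[OF rho_div_antimono[OF s] mu_nonneg[of l]] by simp
  then show ?thesis unfolding Gam_def
    by (intro nn_integral_mono mult_left_mono ennreal_leI min.mono) auto
qed

lemma kernel_le:
  fixes A :: "'a set"
  assumes [measurable]: "A \<in> sets borel" and "emeasure lborel A = ennreal t" "0 \<le> t"
  shows "(\<integral>\<^sup>+x. ennreal (norm (x - y) powr (1 - n)) * indicator A x \<partial>lborel) \<le> ennreal (n * b * rho t)"
  using nn_integral_norm_powr_le_ball[OF assms, of "n - 1" y] n2 unfolding rho_def by (simp add: b_eq n_eq[symmetric])

text \<open>After slicing \<open>F\<close> by its levels, the bathtub bound applies to the kernel integrated either over
  \<open>E\<close> or over the superlevel set; the minimum of the two is what \<open>Gam\<close> integrates.\<close>

lemma potential_average_le: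
  assumes E[measurable]: "E \<in> sets borel" and t: "emeasure lborel E = ennreal t" "0 < t"
  shows "(\<integral>\<^sup>+x. indicator E x * (\<integral>\<^sup>+y. ennreal (F y * norm (x - y) powr (1 - n)) \<partial>lborel) \<partial>lborel)
    \<le> ennreal (n * b * t) * Gam t"
proof -
  define k where "k x y = ennreal (norm (x - y) powr (1 - n))" for x y :: 'a
  have [measurable]: "(\<lambda>(x, y). k x y) \<in> borel_measurable (borel \<Otimes>\<^sub>M borel)"
    unfolding k_def[abs_def] by measurable
  define K where "K y = (\<integral>\<^sup>+x. k x y * indicator E x \<partial>lborel)" for y
  have [measurable]: "K \<in> borel_measurable borel" unfolding K_def[abs_def] by measurable
  have layer: "ennreal (F y) = (\<integral>\<^sup>+l. indicator {0<..} l * indicator {x. l < F x} y \<partial>lborel)" for y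
  proof -
    have "(\<integral>\<^sup>+l. indicator {0<..} l * indicator {x. l < F x} y \<partial>lborel) = (\<integral>\<^sup>+l. indicator {0<..<F y} l \<partial>lborel)"
      by (intro nn_integral_cong) (auto split: split_indicator)
    then show ?thesis using F_nonneg[of y] by simp
  qed
  have pt: "(\<integral>\<^sup>+y. indicator {x. l < F x} y * K y \<partial>lborel)
      \<le> ennreal (n * b * t) * ennreal (min (rho (mu l)) (mu l * rho t / t))" if l: "0 < l" for l
  proof -
    have 1: "(\<integral>\<^sup>+y. indicator {x. l < F x} y * K y \<partial>lborel) \<le> ennreal (n * b * rho t * mu l)"
    proof -
      have "(\<integral>\<^sup>+y. indicator {x. l < F x} y * K y \<partial>lborel) \<le> (\<integral>\<^sup>+y. indicator {x. l < F x} y * ennreal (n * b * rho t) \<partial>lborel)"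
        unfolding K_def k_def using t by (intro nn_integral_mono mult_left_mono kernel_le) auto
      also have "\<dots> = ennreal (mu l) * ennreal (n * b * rho t)"
        using l by (subst nn_integral_multc) (auto simp: emeasure_superlevel)
      finally show ?thesis using mu_nonneg[of l] rho_nonneg[of t] n2 b_pos by (simp add: ennreal_mult[symmetric] mult_ac)
    qed
    have 2: "(\<integral>\<^sup>+y. indicator {x. l < F x} y * K y \<partial>lborel) \<le> ennreal (n * b * rho (mu l) * t)"
    proof -
      have "(\<integral>\<^sup>+y. indicator {x. l < F x} y * K y \<partial>lborel)
          = (\<integral>\<^sup>+y. \<integral>\<^sup>+x. indicator E x * (indicator {x. l < F x} y * k x y) \<partial>lborel \<partial>lborel)"
        unfolding K_def by (intro nn_integral_cong, subst nn_integral_cmult[symmetric]) (auto simp: mult_ac intro!: nn_integral_cong)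
      also have "\<dots> = (\<integral>\<^sup>+x. \<integral>\<^sup>+y. indicator E x * (indicator {x. l < F x} y * k x y) \<partial>lborel \<partial>lborel)"
        by (rule lborel_pair.Fubini') measurable
      also have "\<dots> = (\<integral>\<^sup>+x. indicator E x * (\<integral>\<^sup>+y. ennreal (norm (y - x) powr (1 - n)) * indicator {x. l < F x} y \<partial>lborel) \<partial>lborel)"
        unfolding k_def by (intro nn_integral_cong, subst nn_integral_cmult[symmetric]) (auto simp: mult_ac norm_minus_commute intro!: nn_integral_cong)
      also have "\<dots> \<le> (\<integral>\<^sup>+x. indicator E x * ennreal (n * b * rho (mu l)) \<partial>lborel)"
        using l mu_nonneg by (intro nn_integral_mono mult_left_mono kernel_le emeasure_superlevel) auto
      also have "\<dots> = ennreal t * ennreal (n * b * rho (mu l))"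
        by (subst nn_integral_multc) (auto simp: t)
      finally show ?thesis using t rho_nonneg[of "mu l"] n2 b_pos by (simp add: ennreal_mult[symmetric] mult_ac)
    qed
    have "ennreal (n * b * t) * ennreal (min (rho (mu l)) (mu l * rho t / t))
        = ennreal (n * b * t * min (rho (mu l)) (mu l * rho t / t))"
      using t b_pos mu_nonneg[of l] rho_nonneg n2 by (intro ennreal_mult[symmetric]) auto
    also have "n * b * t * min (rho (mu l)) (mu l * rho t / t) = min (n * b * rho (mu l) * t) (n * b * rho t * mu l)"
      using t b_pos n2 by (simp add: min_mult_distrib_left mult_ac)
    finally show ?thesis using 1 2 by (simp add: min_def)
  qed
  have "(\<integral>\<^sup>+x. indicator E x * (\<integral>\<^sup>+y. ennreal (F y * norm (x - y) powr (1 - n)) \<partial>lborel) \<partial>lborel)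
     = (\<integral>\<^sup>+x. \<integral>\<^sup>+y. indicator E x * (ennreal (F y) * k x y) \<partial>lborel \<partial>lborel)"
    unfolding k_def using F_nonneg
    by (intro nn_integral_cong, subst nn_integral_cmult[symmetric]) (auto simp: ennreal_mult)
  also have "\<dots> = (\<integral>\<^sup>+y. \<integral>\<^sup>+x. indicator E x * (ennreal (F y) * k x y) \<partial>lborel \<partial>lborel)"
    by (rule lborel_pair.Fubini') measurable
  also have "\<dots> = (\<integral>\<^sup>+y. ennreal (F y) * K y \<partial>lborel)"
    unfolding K_def by (intro nn_integral_cong, subst nn_integral_cmult[symmetric]) (auto simp: mult_ac intro!: nn_integral_cong)
  also have "\<dots> = (\<integral>\<^sup>+y. \<integral>\<^sup>+l. indicator {0<..} l * indicator {x. l < F x} y * K y \<partial>lborel \<partial>lborel)"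
    by (intro nn_integral_cong, subst layer, subst nn_integral_multc[symmetric]) auto
  also have "\<dots> = (\<integral>\<^sup>+l. \<integral>\<^sup>+y. indicator {0<..} l * indicator {x. l < F x} y * K y \<partial>lborel \<partial>lborel)"
    by (rule lborel_pair.Fubini') measurable
  also have "\<dots> = (\<integral>\<^sup>+l. indicator {0<..} l * (\<integral>\<^sup>+y. indicator {x. l < F x} y * K y \<partial>lborel) \<partial>lborel)"
    by (intro nn_integral_cong, subst nn_integral_cmult[symmetric]) (auto simp: mult_ac)
  also have "\<dots> \<le> (\<integral>\<^sup>+l. ennreal (n * b * t) * (indicator {0<..} l * ennreal (min (rho (mu l)) (mu l * rho t / t))) \<partial>lborel)"
  proof (rule nn_integral_mono)
    fix l :: real
    show "indicator {0<..} l * (\<integral>\<^sup>+y. indicator {x. l < F x} y * K y \<partial>lborel)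
      \<le> ennreal (n * b * t) * (indicator {0<..} l * ennreal (min (rho (mu l)) (mu l * rho t / t)))"
      using pt[of l] by (auto split: split_indicator)
  qed
  also have "\<dots> = ennreal (n * b * t) * Gam t"
    unfolding Gam_def by (rule nn_integral_cmult) measurable
  finally show ?thesis .
qed

text \<open>Finiteness is the point: by Chebyshev's inequality and \<open>F_norm\<close> every level
  in the set satisfies l^n * s \<le> 1, so the levels are bounded.\<close>

lemma emeasure_fs:
  assumes s: "0 < s"
  shows "emeasure lborel {l. 0 < l \<and> s < mu l} = ennreal (fs s)"
  unfolding fs_def
proof (rule emeasure_eq_ennreal_measure)
  have "{l. 0 < l \<and> s < mu l} \<subseteq> {0..(1 / s) powr (1 / n)}"
  proof
    fix l assume "l \<in> {l. 0 < l \<and> s < mu l}"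
    then have l: "0 < l" "s < mu l" by auto
    have "ennreal (l powr n * s) \<le> ennreal (l powr n * mu l)" using l by (intro ennreal_leI mult_left_mono) auto
    also have "\<dots> = ennreal (l powr n) * emeasure lborel {x. l < F x}"
      using l mu_nonneg by (simp add: emeasure_superlevel ennreal_mult)
    also have "\<dots> = (\<integral>\<^sup>+x. ennreal (l powr n) * indicator {x. l < F x} x \<partial>lborel)"
      by (subst nn_integral_cmult) auto
    also have "\<dots> \<le> (\<integral>\<^sup>+x. ennreal (F x powr n) \<partial>lborel)"
      using l n2 by (intro nn_integral_mono) (auto split: split_indicator intro!: ennreal_leI powr_mono2)
    also have "\<dots> \<le> 1" by (rule F_norm)
    finally have "l powr n \<le> 1 / s" using s by (simp add: field_simps)
    then have "(l powr n) powr (1 / n) \<le> (1 / s) powr (1 / n)" using n2 by (intro powr_mono2) auto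
    then show "l \<in> {0..(1 / s) powr (1 / n)}" using l n2 by (simp add: powr_powr)
  qed
  then have "emeasure lborel {l. 0 < l \<and> s < mu l} \<le> emeasure lborel {0..(1 / s) powr (1 / n)}"
    by (intro emeasure_mono) auto
  then show "emeasure lborel {l. 0 < l \<and> s < mu l} \<noteq> top" by (auto simp: top_unique)
qed

lemma layer_powr:
  assumes "0 \<le> a"
  shows "ennreal (a powr n) = (\<integral>\<^sup>+l. ennreal (n * l powr (n - 1)) * indicator {0..a} l \<partial>lborel)"
proof -
  have "(\<integral>\<^sup>+l. ennreal (n * l powr (n - 1)) * indicator {0..a} l \<partial>lborel)
      = ennreal n * (\<integral>\<^sup>+l. ennreal (l powr (n - 1)) * indicator {0..a} l \<partial>lborel)"
    using n2 by (subst nn_integral_cmult[symmetric]) (auto simp: ennreal_mult mult_ac)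
  also have "\<dots> = ennreal n * ennreal (a powr (n - 1 + 1) / (n - 1 + 1))"
    using n2 assms by (subst nn_integral_powr_Icc) auto
  finally show ?thesis using n2 by (simp add: ennreal_mult[symmetric])
qed

text \<open>One half of equimeasurability. Both n-th powers are expanded over levels
  \<open>l\<close>; since \<open>mu\<close> is decreasing, l < fs s implies s < mu l up to null
  sets, and integrating in \<open>s\<close> first returns the distribution function of
  \<open>F\<close>.\<close>

lemma fs_norm: "(\<integral>\<^sup>+s. indicator {0<..} s * ennreal (fs s powr n) \<partial>lborel) \<le> 1"
proof -
  define w where "w l = ennreal (n * l powr (n - 1))" for l :: real
  have [measurable]: "w \<in> borel_measurable borel" unfolding w_def[abs_def] by measurable
  have "(\<integral>\<^sup>+s. indicator {0<..} s * ennreal (fs s powr n) \<partial>lborel)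
     = (\<integral>\<^sup>+s. \<integral>\<^sup>+l. indicator {0<..} s * (w l * indicator {0..fs s} l) \<partial>lborel \<partial>lborel)"
    unfolding layer_powr[OF fs_nonneg] w_def by (intro nn_integral_cong nn_integral_cmult[symmetric]) auto
  also have "\<dots> \<le> (\<integral>\<^sup>+s. \<integral>\<^sup>+l. indicator {0<..} l * w l * indicator {s. 0 < s \<and> s < mu l} s \<partial>lborel \<partial>lborel)"
  proof (rule nn_integral_mono, rule nn_integral_mono_AE)
    fix s :: real
    have "AE l in lborel. l \<noteq> 0 \<and> l \<noteq> fs s"
      using AE_lborel_singleton[of 0] AE_lborel_singleton[of "fs s"] by eventually_elim auto
    then show "AE l in lborel. indicator {0<..} s * (w l * indicator {0..fs s} l) \<le> indicator {0<..} l * w l * indicator {s. 0 < s \<and> s < mu l} s"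
    proof eventually_elim
      case (elim l)
      have "s < mu l" if "0 < s" "0 < l" "l < fs s"
      proof (rule ccontr)
        assume "\<not> s < mu l"
        have "{l. 0 < l \<and> s < mu l} \<subseteq> {0..l}"
        proof
          fix l' assume "l' \<in> {l. 0 < l \<and> s < mu l}"
          then have "0 < l'" "s < mu l'" by auto
          then show "l' \<in> {0..l}" using mu_antimono[of l l'] that \<open>\<not> s < mu l\<close> by force
        qed
        then have "emeasure lborel {l. 0 < l \<and> s < mu l} \<le> emeasure lborel {0..l}"
          by (intro emeasure_mono) auto
        then show False using that emeasure_fs[of s] by simp
      qed
      then show ?case using elim by (auto split: split_indicator)
    qed
  qed
  also have "\<dots> = (\<integral>\<^sup>+l. \<integral>\<^sup>+s. indicator {0<..} l * w l * indicator {s. 0 < s \<and> s < mu l} s \<partial>lborel \<partial>lborel)"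
    by (rule lborel_pair.Fubini') measurable
  also have "\<dots> = (\<integral>\<^sup>+l. indicator {0<..} l * w l * ennreal (mu l) \<partial>lborel)"
  proof (intro nn_integral_cong)
    fix l
    have "{s. 0 < s \<and> s < mu l} = {0<..<mu l}" by auto
    then show "(\<integral>\<^sup>+s. indicator {0<..} l * w l * indicator {s. 0 < s \<and> s < mu l} s \<partial>lborel) = indicator {0<..} l * w l * ennreal (mu l)"
      using mu_nonneg by (subst nn_integral_cmult) auto
  qed
  also have "\<dots> = (\<integral>\<^sup>+l. \<integral>\<^sup>+y. indicator {0<..} l * w l * indicator {x. l < F x} y \<partial>lborel \<partial>lborel)"
    by (intro nn_integral_cong, subst nn_integral_cmult) (auto simp: emeasure_superlevel split: split_indicator)
  also have "\<dots> = (\<integral>\<^sup>+y. \<integral>\<^sup>+l. indicator {0<..} l * w l * indicator {x. l < F x} y \<partial>lborel \<partial>lborel)"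
    by (rule lborel_pair.Fubini') measurable
  also have "\<dots> \<le> (\<integral>\<^sup>+y. \<integral>\<^sup>+l. w l * indicator {0..F y} l \<partial>lborel \<partial>lborel)"
    by (intro nn_integral_mono) (auto split: split_indicator)
  also have "\<dots> = (\<integral>\<^sup>+x. ennreal (F x powr n) \<partial>lborel)"
    unfolding w_def layer_powr[OF F_nonneg] ..
  finally show ?thesis using F_norm by (rule order_trans)
qed

section \<open>Energy on intervals and its consequences by Hoelder's inequality\<close>

lemma fs_part:
  assumes [measurable]: "A \<in> sets borel" and A: "A \<subseteq> {0<..}"
  shows "(\<integral>\<^sup>+s. indicator A s * ennreal (fs s powr n) \<partial>lborel)
    = ennreal (enn2real (\<integral>\<^sup>+s. indicator A s * ennreal (fs s powr n) \<partial>lborel))" (is ?t1)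
    and "(\<integral>\<^sup>+s. indicator A s * ennreal (fs s powr n) \<partial>lborel) \<le> 1" (is ?t2)
proof -
  have "(\<integral>\<^sup>+s. indicator A s * ennreal (fs s powr n) \<partial>lborel) \<le> (\<integral>\<^sup>+s. indicator {0<..} s * ennreal (fs s powr n) \<partial>lborel)"
    using A by (intro nn_integral_mono) (auto split: split_indicator)
  also have "\<dots> \<le> 1" by (rule fs_norm)
  finally show ?t2 .
  then have "(\<integral>\<^sup>+s. indicator A s * ennreal (fs s powr n) \<partial>lborel) < top"
    by (rule le_less_trans) simp
  then show ?t1 by simp
qed

lemma L_eq: "(\<integral>\<^sup>+s. indicator {0<..<t} s * ennreal (fs s powr n) \<partial>lborel) = ennreal (L t)"
  unfolding L_def by (rule fs_part) auto

lemma L_nonneg: "0 \<le> L t" by (simp add: L_def)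

lemma L_le_1: "L t \<le> 1"
proof -
  have "ennreal (L t) \<le> 1" unfolding L_eq[symmetric] by (rule fs_part(2)) auto
  then show ?thesis by simp
qed

lemma L_rest:
  assumes "0 < t"
  shows "(\<integral>\<^sup>+s. indicator {t..<u} s * ennreal (fs s powr n) \<partial>lborel) \<le> ennreal (1 - L t)"
proof -
  define D where "D = enn2real (\<integral>\<^sup>+s. indicator {t..<u} s * ennreal (fs s powr n) \<partial>lborel)"
  have D: "(\<integral>\<^sup>+s. indicator {t..<u} s * ennreal (fs s powr n) \<partial>lborel) = ennreal D"
    unfolding D_def using assms by (intro fs_part) auto
  have "ennreal (L t + D) = (\<integral>\<^sup>+s. indicator {0<..<t} s * ennreal (fs s powr n) \<partial>lborel)
      + (\<integral>\<^sup>+s. indicator {t..<u} s * ennreal (fs s powr n) \<partial>lborel)"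
    unfolding D L_eq using L_nonneg by (simp add: D_def)
  also have "\<dots> = (\<integral>\<^sup>+s. indicator {0<..<t} s * ennreal (fs s powr n) + indicator {t..<u} s * ennreal (fs s powr n) \<partial>lborel)"
    by (rule nn_integral_add[symmetric]) auto
  also have "\<dots> \<le> (\<integral>\<^sup>+s. indicator {0<..} s * ennreal (fs s powr n) \<partial>lborel)"
    using assms by (intro nn_integral_mono) (auto split: split_indicator)
  also have "\<dots> \<le> 1" by (rule fs_norm)
  finally have "L t + D \<le> 1" by simp
  then show ?thesis unfolding D by (intro ennreal_leI) simp
qed

lemma L_rest':
  assumes "0 < t"
  shows "(\<integral>\<^sup>+s. indicator {t..<u} s * ennreal (fs s powr n) \<partial>lborel) \<le> ennreal (L u)"
  unfolding L_eq[symmetric] using assms by (intro nn_integral_mono) (auto split: split_indicator)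

lemma L_mono: "t \<le> u \<Longrightarrow> L t \<le> L u"
proof -
  assume "t \<le> u"
  then have "ennreal (L t) \<le> ennreal (L u)"
    unfolding L_eq[symmetric] by (intro nn_integral_mono) (auto split: split_indicator)
  then show ?thesis using L_nonneg by simp
qed

lemma p_gt1: "1 < p" and n_p: "1 / n + 1 / p = 1" and p_inv: "1 / p = 1 - 1 / n"
  using n2 by (auto simp: p_eq field_simps)

lemma fs_Holder_low:
  assumes t: "0 < t"
  shows "(\<integral>\<^sup>+s. indicator {0<..<t} s * ennreal (fs s) \<partial>lborel) \<le> ennreal (t powr (1/p) * L t powr (1/n))"
proof -
  have "(\<integral>\<^sup>+s. ennreal (fs s * indicator {0<..<t} s * indicator {0<..<t} s) \<partial>lborel) \<le> ennreal (L t powr (1/n) * t powr (1/p))"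
  proof (rule nn_integral_Holder)
    show "(\<integral>\<^sup>+s. ennreal ((fs s * indicator {0<..<t} s) powr n) \<partial>lborel) \<le> ennreal (L t)"
      unfolding L_eq[symmetric] by (intro nn_integral_mono) (auto split: split_indicator)
    have "(\<integral>\<^sup>+s. ennreal (indicator {0<..<t} s powr p) \<partial>lborel) = (\<integral>\<^sup>+s. indicator {0<..<t} s \<partial>lborel)"
      by (intro nn_integral_cong) (auto split: split_indicator)
    then show "(\<integral>\<^sup>+s. ennreal (indicator {0<..<t} s powr p) \<partial>lborel) \<le> ennreal t" using t by simp
  qed (use n2 p_gt1 n_p t L_nonneg fs_nonneg in auto)
  also have "(\<integral>\<^sup>+s. ennreal (fs s * indicator {0<..<t} s * indicator {0<..<t} s) \<partial>lborel) = (\<integral>\<^sup>+s. indicator {0<..<t} s * ennreal (fs s) \<partial>lborel)"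
    by (intro nn_integral_cong) (auto split: split_indicator)
  finally show ?thesis by (simp add: mult_ac)
qed

text \<open>The factor rho s / (n s) is the derivative of \<open>rho\<close>, a multiple of s^(1/n -
  1), and (1/n - 1) p = -1: its p-th power is 1/s up to a constant. This coincidence produces the
  logarithm. The energy bound \<open>D\<close> is left free because it will be 1 - L t, L u or
  1.\<close>

lemma fs_Holder_high:
  assumes t: "0 < t" "t \<le> u" and D: "0 \<le> D" "(\<integral>\<^sup>+s. indicator {t..<u} s * ennreal (fs s powr n) \<partial>lborel) \<le> ennreal D"
  shows "(\<integral>\<^sup>+s. indicator {t..<u} s * ennreal (rho s / (n * s) * fs s) \<partial>lborel)
    \<le> ennreal (ln (u / t) powr (1/p) * D powr (1/n) / (n * b powr (1/n)))"
proof -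
  have lnn: "0 \<le> ln (u / t)" using t by simp
  have "(\<integral>\<^sup>+s. ennreal (fs s * indicator {t..<u} s * (s powr (1/n - 1) * indicator {t..<u} s)) \<partial>lborel) \<le> ennreal (D powr (1/n) * ln (u / t) powr (1/p))"
  proof (rule nn_integral_Holder)
    show "(\<integral>\<^sup>+s. ennreal ((fs s * indicator {t..<u} s) powr n) \<partial>lborel) \<le> ennreal D"
      by (rule order_trans[OF _ D(2)]) (intro nn_integral_mono, auto split: split_indicator)
    have "(1/n - 1) * p = -1" using n2 by (simp add: p_eq field_simps)
    then have "(\<integral>\<^sup>+s. ennreal ((s powr (1/n - 1) * indicator {t..<u} s) powr p) \<partial>lborel) \<le> (\<integral>\<^sup>+s. ennreal (1 / s) * indicator {t..u} s \<partial>lborel)"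
      using t by (intro nn_integral_mono) (auto split: split_indicator simp: powr_powr powr_minus_divide)
    also have "\<dots> = ennreal (ln u - ln t)" using t by (subst nn_integral_FTC_Icc[where F=ln]) (auto intro!: DERIV_ln_divide)
    finally show "(\<integral>\<^sup>+s. ennreal ((s powr (1/n - 1) * indicator {t..<u} s) powr p) \<partial>lborel) \<le> ennreal (ln (u / t))"
      using t by (simp add: ln_div)
  qed (use n2 p_gt1 n_p t D lnn fs_nonneg in auto)
  then have "ennreal (1 / (n * b powr (1/n))) * (\<integral>\<^sup>+s. ennreal (fs s * indicator {t..<u} s * (s powr (1/n - 1) * indicator {t..<u} s)) \<partial>lborel)
     \<le> ennreal (1 / (n * b powr (1/n))) * ennreal (D powr (1/n) * ln (u / t) powr (1/p))"
    by (intro mult_left_mono) auto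
  also have "\<dots> = ennreal (ln (u / t) powr (1/p) * D powr (1/n) / (n * b powr (1/n)))"
    using n2 by (simp add: ennreal_mult[symmetric] mult_ac)
  also have "ennreal (1 / (n * b powr (1/n))) * (\<integral>\<^sup>+s. ennreal (fs s * indicator {t..<u} s * (s powr (1/n - 1) * indicator {t..<u} s)) \<partial>lborel)
    = (\<integral>\<^sup>+s. indicator {t..<u} s * ennreal (rho s / (n * s) * fs s) \<partial>lborel)"
  proof (subst nn_integral_cmult[symmetric], measurable, intro nn_integral_cong)
    fix s
    have "rho s / (n * s) * fs s = 1 / (n * b powr (1/n)) * (fs s * s powr (1/n - 1))" if "0 < s"
    proof -
      have "rho s / (n * s) * fs s = (rho s / s) * fs s / n" by simp
      then show ?thesis unfolding rho_div[OF that] by (simp add: mult_ac)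
    qed
    then show "ennreal (1 / (n * b powr (1/n))) * ennreal (fs s * indicator {t..<u} s * (s powr (1/n - 1) * indicator {t..<u} s))
      = indicator {t..<u} s * ennreal (rho s / (n * s) * fs s)"
      using t n2 fs_nonneg by (auto split: split_indicator simp: ennreal_mult[symmetric])
  qed
  finally show ?thesis .
qed

lemma rho_deriv:
  assumes s: "0 < s"
  shows "DERIV rho s :> rho s / (n * s)"
  unfolding rho_def using s b_pos n2
  by (auto intro!: derivative_eq_intros simp: powr_diff)

lemma rho_increment:
  assumes t: "0 < t" "t \<le> u"
  shows "(\<integral>\<^sup>+s. indicator {t..<u} s * ennreal (rho s / (n * s)) \<partial>lborel) = ennreal (rho u - rho t)"
proof -
  have "(\<integral>\<^sup>+s. indicator {t..<u} s * ennreal (rho s / (n * s)) \<partial>lborel) = (\<integral>\<^sup>+s. ennreal (rho s / (n * s)) * indicator {t..u} s \<partial>lborel)"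
  proof (rule nn_integral_cong_AE)
    show "AE s in lborel. indicator {t..<u} s * ennreal (rho s / (n * s)) = ennreal (rho s / (n * s)) * indicator {t..u} s"
      using AE_lborel_singleton[of u] by eventually_elim (auto split: split_indicator)
  qed
  also have "\<dots> = ennreal (rho u - rho t)"
    by (rule nn_integral_FTC_Icc) (use t n2 rho_deriv rho_nonneg in auto)
  finally show ?thesis .
qed

text \<open>O'Neil's inequality: the kernel \<open>k\<close> is constant up to \<open>t\<close> and
  equals the derivative of \<open>rho\<close> afterwards, so its integral up to \<open>mu l\<close>
  dominates the minimum in \<open>Gam\<close>. Exchanging the integrals turns the length of the set
  of levels with s < mu l into \<open>fs s\<close>.\<close>

lemma Gam_le:
  assumes t: "0 < t" "t \<le> m"
  shows "Gam t \<le> (\<integral>\<^sup>+s. indicator {0<..<t} s * ennreal (rho t / t * fs s) \<partial>lborel)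
     + (\<integral>\<^sup>+s. indicator {t..<m} s * ennreal (rho s / (n * s) * fs s) \<partial>lborel)"
proof -
  define k where "k s = indicator {0<..<t} s * ennreal (rho t / t) + indicator {t..<m} s * ennreal (rho s / (n * s))" for s
  have [measurable]: "k \<in> borel_measurable borel" unfolding k_def[abs_def] by measurable
  have pt: "ennreal (min (rho (mu l)) (mu l * rho t / t)) \<le> (\<integral>\<^sup>+s. k s * indicator {s. s < mu l} s \<partial>lborel)" if l: "0 < l" for l
  \<comment> \<open>Each case works with one entry of the minimum: the constant part of
    \<open>k\<close> gives mu l * rho t / t, and beyond \<open>t\<close> the value rho (mu l) is rho
    t plus an increment of \<open>rho\<close>.\<close>
  proof (cases "mu l \<le> t")
    case True
    have "ennreal (min (rho (mu l)) (mu l * rho t / t)) \<le> ennreal (mu l * rho t / t)"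
      by (intro ennreal_leI) simp
    also have "\<dots> = ennreal (rho t / t) * ennreal (mu l)"
      using t rho_nonneg mu_nonneg by (simp add: ennreal_mult[symmetric] mult_ac)
    also have "\<dots> = (\<integral>\<^sup>+s. ennreal (rho t / t) * indicator {0<..<mu l} s \<partial>lborel)"
      using mu_nonneg by (subst nn_integral_cmult) auto
    also have "\<dots> \<le> (\<integral>\<^sup>+s. k s * indicator {s. s < mu l} s \<partial>lborel)"
      using True by (intro nn_integral_mono) (auto split: split_indicator simp: k_def)
    finally show ?thesis .
  next
    case False
    have "ennreal (min (rho (mu l)) (mu l * rho t / t)) \<le> ennreal (rho (mu l))"
      by (intro ennreal_leI) simp
    also have "\<dots> = ennreal (rho t) + ennreal (rho (mu l) - rho t)"
      using False t rho_nonneg b_pos n2 by (subst ennreal_plus[symmetric]) (auto simp: rho_def intro!: powr_mono2 divide_right_mono)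
    also have "ennreal (rho t) = (\<integral>\<^sup>+s. ennreal (rho t / t) * indicator {0<..<t} s \<partial>lborel)"
      using t rho_nonneg by (subst nn_integral_cmult) (auto simp: ennreal_mult[symmetric])
    also have "ennreal (rho (mu l) - rho t) = (\<integral>\<^sup>+s. indicator {t..<mu l} s * ennreal (rho s / (n * s)) \<partial>lborel)"
      using False t by (intro rho_increment[symmetric]) auto
    also have "(\<integral>\<^sup>+s. ennreal (rho t / t) * indicator {0<..<t} s \<partial>lborel) + (\<integral>\<^sup>+s. indicator {t..<mu l} s * ennreal (rho s / (n * s)) \<partial>lborel)
       = (\<integral>\<^sup>+s. ennreal (rho t / t) * indicator {0<..<t} s + indicator {t..<mu l} s * ennreal (rho s / (n * s)) \<partial>lborel)"
      by (rule nn_integral_add[symmetric]) auto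
    also have "\<dots> \<le> (\<integral>\<^sup>+s. k s * indicator {s. s < mu l} s \<partial>lborel)"
      using False mu_le_m[of l] l by (intro nn_integral_mono) (auto split: split_indicator simp: k_def)
    finally show ?thesis .
  qed
  have "Gam t \<le> (\<integral>\<^sup>+l. \<integral>\<^sup>+s. k s * (indicator {0<..} l * indicator {s. s < mu l} s) \<partial>lborel \<partial>lborel)"
    unfolding Gam_def
  proof (rule nn_integral_mono)
    fix l :: real
    show "indicator {0<..} l * ennreal (min (rho (mu l)) (mu l * rho t / t))
       \<le> (\<integral>\<^sup>+s. k s * (indicator {0<..} l * indicator {s. s < mu l} s) \<partial>lborel)"
      using pt[of l] by (auto split: split_indicator)
  qed
  also have "\<dots> = (\<integral>\<^sup>+s. \<integral>\<^sup>+l. k s * (indicator {0<..} l * indicator {s. s < mu l} s) \<partial>lborel \<partial>lborel)"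
    by (rule lborel_pair.Fubini') measurable
  also have "\<dots> = (\<integral>\<^sup>+s. k s * emeasure lborel {l. 0 < l \<and> s < mu l} \<partial>lborel)"
  proof (intro nn_integral_cong)
    fix s
    have "(\<integral>\<^sup>+l. k s * (indicator {0<..} l * indicator {s. s < mu l} s) \<partial>lborel) = (\<integral>\<^sup>+l. k s * indicator {l. 0 < l \<and> s < mu l} l \<partial>lborel)"
      by (intro nn_integral_cong) (auto split: split_indicator)
    then show "(\<integral>\<^sup>+l. k s * (indicator {0<..} l * indicator {s. s < mu l} s) \<partial>lborel) = k s * emeasure lborel {l. 0 < l \<and> s < mu l}"
      by (simp add: nn_integral_cmult)
  qed
  also have "\<dots> = (\<integral>\<^sup>+s. indicator {0<..<t} s * ennreal (rho t / t * fs s) + indicator {t..<m} s * ennreal (rho s / (n * s) * fs s) \<partial>lborel)"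
    using t n2 rho_nonneg fs_nonneg
    by (intro nn_integral_cong) (auto split: split_indicator simp: k_def emeasure_fs ennreal_mult[symmetric])
  also have "\<dots> = (\<integral>\<^sup>+s. indicator {0<..<t} s * ennreal (rho t / t * fs s) \<partial>lborel)
     + (\<integral>\<^sup>+s. indicator {t..<m} s * ennreal (rho s / (n * s) * fs s) \<partial>lborel)"
    by (rule nn_integral_add) auto
  finally show ?thesis .
qed

lemma low_part:
  assumes t: "0 < t"
  shows "(\<integral>\<^sup>+s. indicator {0<..<t} s * ennreal (rho t / t * fs s) \<partial>lborel) \<le> ennreal (n * L t powr (1/n) / (n * b powr (1/n)))"
proof -
  have "(\<integral>\<^sup>+s. indicator {0<..<t} s * ennreal (rho t / t * fs s) \<partial>lborel)
     = ennreal (rho t / t) * (\<integral>\<^sup>+s. indicator {0<..<t} s * ennreal (fs s) \<partial>lborel)"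
    using t rho_nonneg fs_nonneg by (subst nn_integral_cmult[symmetric]) (auto simp: ennreal_mult[symmetric] intro!: nn_integral_cong split: split_indicator)
  also have "\<dots> \<le> ennreal (rho t / t) * ennreal (t powr (1/p) * L t powr (1/n))"
    by (intro mult_left_mono fs_Holder_low t) auto
  also have "\<dots> = ennreal (rho t / t * (t powr (1/p) * L t powr (1/n)))"
    using t rho_nonneg by (intro ennreal_mult[symmetric]) auto
  also have "rho t / t * (t powr (1/p) * L t powr (1/n)) = n * L t powr (1/n) / (n * b powr (1/n))"
    unfolding rho_div[OF t] p_inv using t n2 by (simp add: powr_diff)
  finally show ?thesis .
qed

lemma Gam_bound1:
  assumes t: "0 < t" "t \<le> m"
  shows "Gam t \<le> ennreal ((ln (m / t) powr (1/p) * (1 - L t) powr (1/n) + n * L t powr (1/n)) / (n * b powr (1/n)))"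
proof -
  have "Gam t \<le> ennreal (n * L t powr (1/n) / (n * b powr (1/n))) + ennreal (ln (m / t) powr (1/p) * (1 - L t) powr (1/n) / (n * b powr (1/n)))"
    using t L_le_1[of t]
    by (intro order_trans[OF Gam_le] add_mono low_part fs_Holder_high L_rest) auto
  also have "\<dots> = ennreal (n * L t powr (1/n) / (n * b powr (1/n)) + ln (m / t) powr (1/p) * (1 - L t) powr (1/n) / (n * b powr (1/n)))"
    using t n2 by (intro ennreal_plus[symmetric]) auto
  finally show ?thesis by (simp add: add_divide_distrib add.commute)
qed

text \<open>The energy is divided at a point \<open>u\<close> farther out than \<open>t\<close>: on
  [u, m) all of it, at most 1, is allowed, on (0, u) only \<open>L u\<close>. For u = m exp(-s) this
  becomes \<open>Y2\<close>, just as \<open>Gam_bound1\<close> becomes \<open>Y1\<close>.\<close>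

lemma Gam_bound2:
  assumes t: "0 < t" "t < u" "u \<le> m"
  shows "Gam t \<le> ennreal ((ln (m / u) powr (1/p) + (ln (u / t) powr (1/p) + n) * L u powr (1/n)) / (n * b powr (1/n)))"
proof -
  let ?c = "n * b powr (1/n)"
  have "(\<integral>\<^sup>+s. indicator {t..<m} s * ennreal (rho s / (n * s) * fs s) \<partial>lborel)
    = (\<integral>\<^sup>+s. indicator {t..<u} s * ennreal (rho s / (n * s) * fs s) + indicator {u..<m} s * ennreal (rho s / (n * s) * fs s) \<partial>lborel)"
    using t by (intro nn_integral_cong) (auto split: split_indicator)
  also have "\<dots> = (\<integral>\<^sup>+s. indicator {t..<u} s * ennreal (rho s / (n * s) * fs s) \<partial>lborel) + (\<integral>\<^sup>+s. indicator {u..<m} s * ennreal (rho s / (n * s) * fs s) \<partial>lborel)"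
    by (rule nn_integral_add) auto
  also have "\<dots> \<le> ennreal (ln (u / t) powr (1/p) * L u powr (1/n) / ?c) + ennreal (ln (m / u) powr (1/p) * 1 powr (1/n) / ?c)"
  proof (intro add_mono fs_Holder_high L_rest')
    show "(\<integral>\<^sup>+s. indicator {u..<m} s * ennreal (fs s powr n) \<partial>lborel) \<le> ennreal 1"
      using t fs_part(2)[of "{u..<m}"] by (auto simp: subset_eq)
  qed (use t L_nonneg in auto)
  finally have 1: "(\<integral>\<^sup>+s. indicator {t..<m} s * ennreal (rho s / (n * s) * fs s) \<partial>lborel)
    \<le> ennreal (ln (u / t) powr (1/p) * L u powr (1/n) / ?c) + ennreal (ln (m / u) powr (1/p) * 1 powr (1/n) / ?c)" .
  have 2: "ennreal (n * L t powr (1/n) / ?c) \<le> ennreal (n * L u powr (1/n) / ?c)"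
    using t L_mono[of t u] L_nonneg n2 by (intro ennreal_leI divide_right_mono mult_left_mono powr_mono2) auto
  have "Gam t \<le> ennreal (n * L u powr (1/n) / ?c) + (ennreal (ln (u / t) powr (1/p) * L u powr (1/n) / ?c) + ennreal (ln (m / u) powr (1/p) * 1 powr (1/n) / ?c))"
    using t by (intro order_trans[OF Gam_le] add_mono 1 order_trans[OF low_part 2]) auto
  also have "\<dots> = ennreal (n * L u powr (1/n) / ?c + (ln (u / t) powr (1/p) * L u powr (1/n) / ?c + ln (m / u) powr (1/p) * 1 powr (1/n) / ?c))"
    using t n2 by (simp add: ennreal_plus[symmetric] del: ennreal_plus)
  also have "n * L u powr (1/n) / ?c + (ln (u / t) powr (1/p) * L u powr (1/n) / ?c + ln (m / u) powr (1/p) * 1 powr (1/n) / ?c)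
     = (ln (m / u) powr (1/p) + (ln (u / t) powr (1/p) + n) * L u powr (1/n)) / ?c"
    by (simp add: add_divide_distrib distrib_right)
  finally show ?thesis .
qed

definition "G t = enn2real (Gam t)"

lemma Gam_eq: "0 < t \<Longrightarrow> t \<le> m \<Longrightarrow> Gam t = ennreal (G t)"
  using le_less_trans[OF Gam_bound1] by (simp add: G_def)

text \<open>The substitution t = m exp(-s) makes ln (m / t) equal to \<open>s\<close>, and the
  factor n b^(1/n) removes the constant of the Hoelder bounds. Its p-th power is the critical
  exponent n (n b)^(1/(n-1)), so that no slack is lost in the normalisation.\<close>

sublocale adams "DIM('a)" "\<lambda>s. n * b powr (1/n) * G (m * exp (-s))" "\<lambda>s. L (m * exp (-s))" p
proof
  have c: "0 < n * b powr (1/n)" using n2 b_pos by (intro mult_pos_pos) auto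
  have *: "n * b powr (1/n) * G t \<le> X" if "0 < t" "t \<le> m" "Gam t \<le> ennreal (X / (n * b powr (1/n)))" "0 \<le> X" for t X
  proof -
    have "G t \<le> X / (n * b powr (1/n))" using that c by (simp add: Gam_eq)
    then show ?thesis using c by (simp add: le_divide_eq mult_ac)
  qed
  show "n * b powr (1/n) * G (m * exp (-s)) \<le> s powr (1/p) * (1 - L (m * exp (-s))) powr (1/real DIM('a)) + real DIM('a) * L (m * exp (-s)) powr (1/real DIM('a))"
    if s: "0 < s" for s
    unfolding n_eq[symmetric]
  proof (rule *)
    have "m / (m * exp (-s)) = exp s" using m_pos by (simp add: exp_minus field_simps)
    then have 0: "0 < m * exp (-s)" "m * exp (-s) \<le> m" "ln (m / (m * exp (-s))) = s"
      using s m_pos by auto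
    then show "0 < m * exp (-s)" "m * exp (-s) \<le> m" by auto
    show "Gam (m * exp (-s)) \<le> ennreal ((s powr (1/p) * (1 - L (m * exp (-s))) powr (1/n) + n * L (m * exp (-s)) powr (1/n)) / (n * b powr (1/n)))"
      using Gam_bound1[OF 0(1,2)] unfolding 0(3) .
  qed (use n2 in simp)
  show "n * b powr (1/n) * G (m * exp (-t)) \<le> s powr (1/p) + ((t - s) powr (1/p) + real DIM('a)) * L (m * exp (-s)) powr (1/real DIM('a))"
    if s: "0 < s" "s < t" for s t
    unfolding n_eq[symmetric]
  proof (rule *)
    have "m / (m * exp (-s)) = exp s" using m_pos by (simp add: exp_minus field_simps)
    then have 0: "0 < m * exp (-t)" "m * exp (-t) < m * exp (-s)" "m * exp (-s) \<le> m" "ln (m / (m * exp (-s))) = s"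
      using s m_pos by auto
    have "m * exp (-s) / (m * exp (-t)) = exp (t - s)" using m_pos by (simp add: exp_diff exp_minus field_simps)
    then have 1: "ln (m * exp (-s) / (m * exp (-t))) = t - s" by simp
    show "0 < m * exp (-t)" "m * exp (-t) \<le> m" using 0 by linarith+
    show "Gam (m * exp (-t)) \<le> ennreal ((s powr (1/p) + ((t - s) powr (1/p) + n) * L (m * exp (-s)) powr (1/n)) / (n * b powr (1/n)))"
      using Gam_bound2[OF 0(1,2,3)] unfolding 0(4) 1 .
  qed (use n2 in simp)
  show "p = real DIM('a) / (real DIM('a) - 1)" using p_eq by (simp add: n_eq)
  show "0 \<le> n * b powr (1/n) * G (m * exp (-s))" for s using n2 by (simp add: G_def)
qed (use dim2 L_nonneg L_le_1 in auto)

end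

section \<open>Exponential integrability at the critical exponent\<close>

lemma nn_integral_exp_atMost:
  "(\<integral>\<^sup>+r. ennreal (exp r) * indicator {..y} r \<partial>lborel) = ennreal (exp y)"
proof -
  have "(\<integral>\<^sup>+r. ennreal (exp r) * indicator {..y} r \<partial>lborel) = (\<integral>\<^sup>+r. ennreal (exp (0 - r)) * indicator {..y} (0 - r) \<partial>lborel)"
    by (rule nn_integral_lborel_reflect[symmetric]) measurable
  also have "\<dots> = (\<integral>\<^sup>+r. ennreal (exp (-r)) * indicator {-y..} r \<partial>lborel)"
    by (intro nn_integral_cong) (auto split: split_indicator)
  also have "\<dots> = ennreal (0 - (- exp (- (-y))))"
  proof (rule nn_integral_FTC_atLeast)
    have "((\<lambda>x::real. exp (-x)) \<longlongrightarrow> 0) at_top"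
      by (rule filterlim_compose[OF exp_at_bot filterlim_uminus_at_bot_at_top])
    then show "((\<lambda>x::real. - exp (- x)) \<longlongrightarrow> 0) at_top"
      using tendsto_minus by fastforce
  qed (auto intro!: derivative_eq_intros)
  finally show ?thesis by simp
qed

lemma summable_exp_linear:
  fixes q a c :: real
  assumes q: "0 < q"
  shows "summable (\<lambda>k. exp (- q * (real k - a)) * (c * real k))"
proof -
  have "norm (exp (-q)) < 1" using q by simp
  then have "summable (\<lambda>k. diffs (\<lambda>_. 1) k * exp (-q) ^ k)"
    by (intro termdiff_converges[where K=1]) (auto intro!: summable_geometric)
  then have "summable (\<lambda>k. of_nat (Suc k) * exp (-q) ^ k)" by (simp add: diffs_def)
  then have "summable (\<lambda>k. exp (-q) * (real (Suc k) * exp (-q) ^ k))" by (intro summable_mult) simp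
  then have "summable (\<lambda>k. real (Suc k) * exp (-q) ^ Suc k)" by (simp add: mult_ac)
  then have "summable (\<lambda>k. real k * exp (-q) ^ k)" by (subst (asm) summable_Suc_iff)
  then have "summable (\<lambda>k. (exp (q * a) * c) * (real k * exp (-q) ^ k))" by (rule summable_mult)
  also have "(\<lambda>k. (exp (q * a) * c) * (real k * exp (-q) ^ k)) = (\<lambda>k. exp (- q * (real k - a)) * (c * real k))"
  proof (rule ext)
    fix k
    have "exp (q * a) * exp (-q) ^ k = exp (- q * (real k - a))"
      by (simp only: exp_of_nat_mult[symmetric] exp_add[symmetric]) (simp add: algebra_simps)
    then show "(exp (q * a) * c) * (real k * exp (-q) ^ k) = exp (- q * (real k - a)) * (c * real k)"
      by (metis mult.assoc mult.commute)
  qed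
  finally show ?thesis .
qed

context rearrangement
begin

lemma G_nonneg: "0 \<le> G t" by (simp add: G_def)

lemma defect_meas[measurable]: "defect \<in> borel_measurable borel"
proof -
  have [measurable]: "Gam \<in> borel_measurable borel" unfolding Gam_def[abs_def] by measurable
  have [measurable]: "G \<in> borel_measurable borel" unfolding G_def[abs_def] by measurable
  show ?thesis unfolding defect_def[abs_def] by measurable
qed

definition "q_exp beta = 1 - beta / n"

text \<open>Built from the dimension, p, n, b and \<open>beta\<close> alone; neither
  \<open>F\<close> nor \<open>m\<close> enters. This independence makes the upper bound uniform over
  all admissible functions and all \<alpha>.\<close>

definition "exp_const beta = b powr (beta / n) * (exp (q_exp beta * (C0 + 2)) * cA / q_exp beta
    + (\<Sum>k. exp (- q_exp beta * (real k - C0 - 2)) * (2 * cA * real k)))"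

text \<open>As dt / t is ds, this is the integral of exp(-q * defect s) over s > 0. Where
  \<open>sublevel_localized\<close> gives linear growth the integrand decays exponentially;
  elsewhere level \<open>k\<close> weighs a multiple of exp(-q k) on an interval of length 2 cA k,
  and these contributions are summable.\<close>

lemma exp_minus_defect_integral:
  assumes q: "0 < q"
  shows "(\<integral>\<^sup>+t. indicator {0<..<m} t * (ennreal (1 / t) * ennreal (exp (- q * defect (ln (m / t))))) \<partial>lborel)
    \<le> ennreal (exp (q * (C0 + 2)) * cA / q + (\<Sum>k. exp (- q * (real k - C0 - 2)) * (2 * cA * real k)))"
proof -
  obtain z :: "nat \<Rightarrow> real" where z: "\<And>s. 0 < s \<Longrightarrow> s / cA - C0 - 2 \<le> defect s \<or>
      (\<exists>k. real k - C0 - 2 \<le> defect s \<and> \<bar>s - z k\<bar> \<le> cA * real k)"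
    using sublevel_localized by blast
  have cA: "0 < cA" using cA_pos by simp
  define d where "d = q / cA"
  have d: "0 < d" using q cA by (simp add: d_def)
  define w where "w k = exp (- q * (real k - C0 - 2))" for k :: nat
  \<comment> \<open>The interval |s - z k| \<le> cA * k carried back by t = m exp(-s); its length
    with respect to dt / t is 2 cA k.\<close>
  define J where "J k = {m * exp (- z k - cA * real k)..m * exp (- z k + cA * real k)}" for k
  have pt: "indicator {0<..<m} t * (ennreal (1 / t) * ennreal (exp (- q * defect (ln (m / t)))))
    \<le> ennreal (exp (q * (C0 + 2)) * m powr (-d)) * (ennreal (t powr (d - 1)) * indicator {0..m} t)
      + (\<Sum>k. ennreal (w k) * (ennreal (1 / t) * indicator (J k) t))" for t
  proof (cases "0 < t \<and> t < m")
    case t: True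
    define s where "s = ln (m / t)"
    have s: "0 < s" using t by (simp add: s_def)
    have ts: "t = m * exp (-s)" using t m_pos by (simp add: s_def exp_minus)
    from z[OF s] show ?thesis
    proof
      assume "s / cA - C0 - 2 \<le> defect s"
      then have "q * (s / cA - C0 - 2) \<le> q * defect s" using q by (intro mult_left_mono) auto
      then have "- q * defect s \<le> q * (C0 + 2) + d * (- s)" by (simp add: d_def algebra_simps)
      then have "exp (- q * defect s) \<le> exp (q * (C0 + 2)) * exp (d * (- s))"
        by (simp add: exp_add[symmetric])
      also have "- s = ln t - ln m" using t m_pos by (simp add: s_def ln_div)
      also have "exp (d * (ln t - ln m)) = t powr d * m powr (-d)"
        using t m_pos by (simp add: powr_def exp_add[symmetric] algebra_simps)
      finally have "1 / t * exp (- q * defect s) \<le> 1 / t * (exp (q * (C0 + 2)) * (t powr d * m powr (-d)))"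
        using t by (intro mult_left_mono) auto
      also have "\<dots> = exp (q * (C0 + 2)) * m powr (-d) * t powr (d - 1)" using t by (simp add: powr_diff)
      finally have "ennreal (1 / t) * ennreal (exp (- q * defect s)) \<le> ennreal (exp (q * (C0 + 2)) * m powr (-d)) * ennreal (t powr (d - 1))"
        using t by (simp add: ennreal_mult[symmetric] ennreal_leI)
      then show ?thesis using t by (simp add: s_def[symmetric] add_increasing2)
    next
      assume "\<exists>k. real k - C0 - 2 \<le> defect s \<and> \<bar>s - z k\<bar> \<le> cA * real k"
      then obtain k where k: "real k - C0 - 2 \<le> defect s" "\<bar>s - z k\<bar> \<le> cA * real k" by blast
      have "q * (real k - C0 - 2) \<le> q * defect s" using k q by (intro mult_left_mono) auto
      then have "exp (- q * defect s) \<le> w k" by (simp add: w_def)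
      moreover have "t \<in> J k" using k m_pos by (auto simp: J_def ts)
      ultimately have "ennreal (1 / t) * ennreal (exp (- q * defect s)) \<le> ennreal (w k) * (ennreal (1 / t) * indicator (J k) t)"
        using t by (simp add: ennreal_mult[symmetric] w_def mult.commute divide_right_mono ennreal_leI)
      also have "\<dots> \<le> (\<Sum>k. ennreal (w k) * (ennreal (1 / t) * indicator (J k) t))"
        using sum_le_suminf[of "\<lambda>k. ennreal (w k) * (ennreal (1 / t) * indicator (J k) t)" "{k}"] by simp
      finally show ?thesis using t by (simp add: s_def[symmetric] add_increasing)
    qed
  qed simp
  have i1: "(\<integral>\<^sup>+t. ennreal (exp (q * (C0 + 2)) * m powr (-d)) * (ennreal (t powr (d - 1)) * indicator {0..m} t) \<partial>lborel)
     = ennreal (exp (q * (C0 + 2)) * cA / q)"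
  proof -
    have "(\<integral>\<^sup>+t. ennreal (exp (q * (C0 + 2)) * m powr (-d)) * (ennreal (t powr (d - 1)) * indicator {0..m} t) \<partial>lborel)
      = ennreal (exp (q * (C0 + 2)) * m powr (-d)) * ennreal (m powr (d - 1 + 1) / (d - 1 + 1))"
      using d m_pos by (subst nn_integral_cmult, measurable) (subst nn_integral_powr_Icc, auto)
    also have "\<dots> = ennreal (exp (q * (C0 + 2)) * (m powr (-d) * m powr d) / d)"
      using d by (simp add: ennreal_mult[symmetric] mult_ac)
    also have "m powr (-d) * m powr d = 1" using m_pos by (simp add: powr_add[symmetric])
    finally show ?thesis using cA q by (simp add: d_def)
  qed
  have i2: "(\<integral>\<^sup>+t. ennreal (w k) * (ennreal (1 / t) * indicator (J k) t) \<partial>lborel) = ennreal (w k * (2 * cA * real k))" for k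
  proof -
    have "(\<integral>\<^sup>+t. ennreal (1 / t) * indicator (J k) t \<partial>lborel) = ennreal (ln (m * exp (- z k + cA * real k)) - ln (m * exp (- z k - cA * real k)))"
      unfolding J_def
    proof (rule nn_integral_FTC_Icc)
      fix x assume "x \<in> {m * exp (- z k - cA * real k)..m * exp (- z k + cA * real k)}"
      moreover have "0 < m * exp (- z k - cA * real k)" using m_pos by simp
      ultimately have x: "0 < x" by auto
      then show "DERIV ln x :> 1 / x" by (rule DERIV_ln_divide)
      show "0 \<le> 1 / x" using x by simp
    qed (use m_pos cA in auto)
    also have "\<dots> = ennreal (2 * cA * real k)" using m_pos by (simp add: ln_mult mult_ac)
    finally show ?thesis using cA by (subst nn_integral_cmult) (auto simp: ennreal_mult J_def w_def)
  qed
  have "(\<integral>\<^sup>+t. indicator {0<..<m} t * (ennreal (1 / t) * ennreal (exp (- q * defect (ln (m / t))))) \<partial>lborel)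
    \<le> (\<integral>\<^sup>+t. ennreal (exp (q * (C0 + 2)) * m powr (-d)) * (ennreal (t powr (d - 1)) * indicator {0..m} t)
      + (\<Sum>k. ennreal (w k) * (ennreal (1 / t) * indicator (J k) t)) \<partial>lborel)"
    by (intro nn_integral_mono pt)
  also have "\<dots> = (\<integral>\<^sup>+t. ennreal (exp (q * (C0 + 2)) * m powr (-d)) * (ennreal (t powr (d - 1)) * indicator {0..m} t) \<partial>lborel)
      + (\<Sum>k. (\<integral>\<^sup>+t. ennreal (w k) * (ennreal (1 / t) * indicator (J k) t) \<partial>lborel))"
    by (subst nn_integral_add) (auto simp: nn_integral_suminf J_def)
  also have "\<dots> = ennreal (exp (q * (C0 + 2)) * cA / q) + (\<Sum>k. ennreal (w k * (2 * cA * real k)))"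
    by (simp only: i1 i2)
  also have "(\<Sum>k. ennreal (w k * (2 * cA * real k))) = ennreal (\<Sum>k. w k * (2 * cA * real k))"
    using cA summable_exp_linear[OF q, of "C0 + 2" "2 * cA"]
    by (intro suminf_ennreal2) (auto simp: w_def algebra_simps)
  also have "ennreal (exp (q * (C0 + 2)) * cA / q) + ennreal (\<Sum>k. w k * (2 * cA * real k)) =
     ennreal (exp (q * (C0 + 2)) * cA / q + (\<Sum>k. w k * (2 * cA * real k)))"
    using cA q summable_exp_linear[OF q, of "C0 + 2" "2 * cA"]
    by (intro ennreal_plus[symmetric] suminf_nonneg) (auto simp: w_def algebra_simps)
  finally show ?thesis by (simp add: w_def)
qed

text \<open>Averaging over \<open>E\<close>: s * t is at most 1 / (n b) times the integral of the
  potential over \<open>E\<close>, which \<open>potential_average_le\<close> bounds by t * G t once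
  the constants cancel. Only averages over superlevel sets of \<open>v\<close> are needed later, so
  the potential itself is not rearranged.\<close>

lemma level_le_G:
  fixes v :: "'a \<Rightarrow> real"
  assumes [measurable]: "v \<in> borel_measurable borel"
    and v: "\<And>x. 0 < v x \<Longrightarrow> ennreal (v x) \<le> ennreal (1 / (n * b)) * (\<integral>\<^sup>+y. ennreal (F y * norm (x - y) powr (1 - n)) \<partial>lborel)"
    and [measurable]: "E \<in> sets borel" and E: "\<And>x. x \<in> E \<Longrightarrow> 0 < v x \<and> s \<le> v x"
    and t: "emeasure lborel E = ennreal t" "0 < t" "t \<le> m"
  shows "s \<le> G t"
proof -
  have nb: "0 < n * b" using n2 b_pos by (intro mult_pos_pos) auto
  have "ennreal s * ennreal t = (\<integral>\<^sup>+x. ennreal s * indicator E x \<partial>lborel)"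
    by (simp add: nn_integral_cmult t)
  also have "\<dots> \<le> (\<integral>\<^sup>+x. ennreal (1 / (n * b)) * (indicator E x * (\<integral>\<^sup>+y. ennreal (F y * norm (x - y) powr (1 - n)) \<partial>lborel)) \<partial>lborel)"
  proof (rule nn_integral_mono)
    fix x
    show "ennreal s * indicator E x \<le> ennreal (1 / (n * b)) * (indicator E x * (\<integral>\<^sup>+y. ennreal (F y * norm (x - y) powr (1 - n)) \<partial>lborel))"
      using E[of x] v[of x] by (auto split: split_indicator intro: order_trans[OF ennreal_leI])
  qed
  also have "\<dots> = ennreal (1 / (n * b)) * (\<integral>\<^sup>+x. indicator E x * (\<integral>\<^sup>+y. ennreal (F y * norm (x - y) powr (1 - n)) \<partial>lborel) \<partial>lborel)"
    by (rule nn_integral_cmult) measurable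
  also have "\<dots> \<le> ennreal (1 / (n * b)) * (ennreal (n * b * t) * Gam t)"
    using t by (intro mult_left_mono potential_average_le) auto
  also have "\<dots> = ennreal (G t) * ennreal t"
  proof -
    have "n \<noteq> 0" "b \<noteq> 0" using nb by auto
    then show ?thesis using nb t G_nonneg[of t] by (simp add: Gam_eq ennreal_mult[symmetric])
  qed
  finally have le: "ennreal s * ennreal t \<le> ennreal (G t) * ennreal t" .
  show ?thesis
  proof (cases "0 \<le> s")
    case True
    then show ?thesis using le t G_nonneg[of t] by (simp add: ennreal_mult[symmetric])
  next
    case False
    then show ?thesis using G_nonneg[of t] by linarith
  qed
qed

text \<open>The rearrangement \<open>W\<close> of the weight |x|^(-beta) is a multiple of t^(q-1)
  with q = 1 - beta/n, while exp(q A G(t)^p) equals (m/t)^q exp(-q * defect). The powers of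
  \<open>t\<close> combine to 1/t precisely because the exponent carries the factor q; what remains
  is m^q times the integral already bounded.\<close>

lemma exp_integral_le:
  fixes v :: "'a \<Rightarrow> real"
  assumes [measurable]: "v \<in> borel_measurable borel"
    and v: "\<And>x. 0 < v x \<Longrightarrow> ennreal (v x) \<le> ennreal (1 / (n * b)) * (\<integral>\<^sup>+y. ennreal (F y * norm (x - y) powr (1 - n)) \<partial>lborel)"
    and vm: "emeasure lborel {x. 0 < v x} \<le> ennreal m"
    and beta: "0 \<le> beta" "beta < n"
  shows "(\<integral>\<^sup>+x. indicator {x. 0 < v x} x * ennreal (exp ((1 - beta / n) * (n * (n * b) powr (1 / (n - 1))) * v x powr p) * norm x powr (-beta)) \<partial>lborel)
    \<le> ennreal (exp_const beta * m powr (1 - beta / n))"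
proof -
  define q where "q = 1 - beta / n"
  have q: "0 < q" "beta / n = 1 - q" using beta n2 by (auto simp: q_def)
  define A where "A = n * (n * b) powr (1 / (n - 1))"
  have A: "0 < A" using n2 b_pos by (simp add: A_def)
  have A_eq: "(n * b powr (1/n)) powr p = A"
  proof -
    have "(n * b powr (1/n)) powr p = n powr p * b powr (1 / (n - 1))"
      using n2 b_pos by (simp add: powr_mult powr_powr p_eq)
    also have "n powr p = n * n powr (1 / (n - 1))"
    proof -
      have "p = 1 + 1 / (n - 1)" using n2 by (simp add: p_eq field_simps)
      then show ?thesis using n2 by (simp add: powr_add)
    qed
    finally show ?thesis using n2 b_pos by (simp add: A_def powr_mult)
  qed
  define D where "D r = {x. 0 < v x \<and> r \<le> q * A * v x powr p}" for r
  have D_meas[measurable]: "D r \<in> sets borel" for r unfolding D_def by measurable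
  have Dp[measurable]: "Measurable.pred (borel \<Otimes>\<^sub>M borel) (\<lambda>z. snd z \<in> D (fst z))" unfolding D_def by measurable
  define tD where "tD r = measure lborel (D r)" for r
  have tD: "emeasure lborel (D r) = ennreal (tD r)" "tD r \<le> m" "0 \<le> tD r" for r
  proof -
    have le: "emeasure lborel (D r) \<le> ennreal m"
      by (rule order_trans[OF emeasure_mono vm]) (auto simp: D_def)
    then show 1: "emeasure lborel (D r) = ennreal (tD r)"
      unfolding tD_def by (intro emeasure_eq_ennreal_measure) (auto simp: top_unique)
    show "tD r \<le> m" using le unfolding 1 using m_pos by simp
    show "0 \<le> tD r" by (simp add: tD_def)
  qed
  have [measurable]: "tD \<in> borel_measurable borel" unfolding tD_def[abs_def] measure_def D_def by measurable
  define W where "W t = ennreal (b powr (beta / n) * t powr (- (beta / n)))" for t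
  have [measurable]: "W \<in> borel_measurable borel" unfolding W_def[abs_def] by measurable
  have W: "(\<integral>\<^sup>+x. ennreal (norm x powr (-beta)) * indicator (D r) x \<partial>lborel) \<le> (\<integral>\<^sup>+t. W t * indicator {t. 0 < t \<and> t < tD r} t \<partial>lborel)" for r
  proof -
    have "(\<integral>\<^sup>+x. ennreal (norm (x - 0) powr (-beta)) * indicator (D r) x \<partial>lborel)
      \<le> ennreal (n * b / (n - beta) * (tD r / b) powr ((n - beta) / n))"
      unfolding n_eq b_eq using beta tD[of r] by (intro nn_integral_norm_powr_le_ball) (auto simp: n_eq)
    also have "n * b / (n - beta) * (tD r / b) powr ((n - beta) / n) = b powr (beta / n) * (tD r powr (- (beta / n) + 1) / (- (beta / n) + 1))"
    proof -
      have "(n - beta) / n = q" using n2 by (simp add: q_def diff_divide_distrib)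
      moreover have "n / (n - beta) = 1 / q" using n2 beta by (simp add: q_def field_simps)
      then have "n * b / (n - beta) = b / q" by (metis times_divide_eq_left mult.commute mult.right_neutral)
      ultimately show ?thesis using b_pos tD(3)[of r] unfolding q(2)
        by (simp add: powr_divide powr_diff)
    qed
    also have "ennreal \<dots> = ennreal (b powr (beta / n)) * (\<integral>\<^sup>+t. ennreal (t powr (- (beta / n))) * indicator {0..tD r} t \<partial>lborel)"
      using q beta tD(3)[of r] by (subst nn_integral_powr_Icc) (auto simp: ennreal_mult[symmetric])
    also have "\<dots> = (\<integral>\<^sup>+t. ennreal (b powr (beta / n)) * (ennreal (t powr (- (beta / n))) * indicator {0..tD r} t) \<partial>lborel)"
      by (rule nn_integral_cmult[symmetric]) measurable
    also have "\<dots> = (\<integral>\<^sup>+t. W t * indicator {t. 0 < t \<and> t < tD r} t \<partial>lborel)"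
    proof (rule nn_integral_cong_AE)
      show "AE t in lborel. ennreal (b powr (beta / n)) * (ennreal (t powr (- (beta / n))) * indicator {0..tD r} t) = W t * indicator {t. 0 < t \<and> t < tD r} t"
        using AE_lborel_singleton[of 0] AE_lborel_singleton[of "tD r"]
        by eventually_elim (auto simp: W_def ennreal_mult split: split_indicator)
    qed
    finally show ?thesis by simp
  qed
  \<comment> \<open>On \<open>D r\<close> the function \<open>v\<close> is at least (r / (q
    A))^(1/p), so this number is at most G at the measure \<open>tD r\<close>; since
    \<open>Gam\<close> is decreasing, it is also at most G at any smaller \<open>t\<close>.
    Nonpositive levels are trivial.\<close>
  have lev: "r \<le> q * A * G t powr p" if "0 < t" "t < tD r" for t r
  proof (cases "r \<le> 0")
    case True
    then show ?thesis using q A by (intro order_trans[OF True]) auto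
  next
    case False
    define s where "s = (r / (q * A)) powr (1 / p)"
    have s0: "0 \<le> s" by (simp add: s_def)
    have sp: "s powr p = r / (q * A)" using False q A p_gt1 by (simp add: s_def powr_powr)
    have sG: "s \<le> G (tD r)"
    proof (rule level_le_G[where v=v and E="D r"])
      fix x assume x: "x \<in> D r"
      then have "s powr p \<le> v x powr p" using q A unfolding sp by (auto simp: D_def divide_le_eq mult_ac)
      then show "0 < v x \<and> s \<le> v x" using x p_gt1 s0
        using powr_less_mono2[of p "v x" s] by (force simp: D_def)
    qed (use v tD that in auto)
    have "ennreal (G (tD r)) \<le> ennreal (G t)"
      using Gam_antimono[of t "tD r"] that tD(2)[of r] by (simp add: Gam_eq)
    then have "G (tD r) \<le> G t" using G_nonneg by simp
    then have "s powr p \<le> G t powr p" using sG s0 p_gt1 by (intro powr_mono2) auto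
    then show ?thesis using q A unfolding sp by (simp add: divide_le_eq mult_ac)
  qed
  have "(\<integral>\<^sup>+x. indicator {x. 0 < v x} x * ennreal (exp (q * A * v x powr p) * norm x powr (-beta)) \<partial>lborel)
    = (\<integral>\<^sup>+x. \<integral>\<^sup>+r. ennreal (exp r) * (ennreal (norm x powr (-beta)) * indicator (D r) x) \<partial>lborel \<partial>lborel)"
  \<comment> \<open>The exponential is the integral of exp r over all real r below its argument,
    negative levels included.\<close>
  proof (rule nn_integral_cong)
    fix x
    have "(\<integral>\<^sup>+r. ennreal (exp r) * (ennreal (norm x powr (-beta)) * indicator (D r) x) \<partial>lborel)
      = (\<integral>\<^sup>+r. indicator {x. 0 < v x} x * ennreal (norm x powr (-beta)) * (ennreal (exp r) * indicator {..q * A * v x powr p} r) \<partial>lborel)"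
      by (intro nn_integral_cong) (auto simp: D_def mult_ac split: split_indicator)
    also have "\<dots> = indicator {x. 0 < v x} x * ennreal (norm x powr (-beta)) * ennreal (exp (q * A * v x powr p))"
      by (subst nn_integral_cmult, measurable) (simp only: nn_integral_exp_atMost)
    finally show "indicator {x. 0 < v x} x * ennreal (exp (q * A * v x powr p) * norm x powr (-beta))
      = (\<integral>\<^sup>+r. ennreal (exp r) * (ennreal (norm x powr (-beta)) * indicator (D r) x) \<partial>lborel)"
      by (simp add: ennreal_mult mult_ac)
  qed
  also have "\<dots> = (\<integral>\<^sup>+r. \<integral>\<^sup>+x. ennreal (exp r) * (ennreal (norm x powr (-beta)) * indicator (D r) x) \<partial>lborel \<partial>lborel)"
    by (rule lborel_pair.Fubini') measurable
  also have "\<dots> = (\<integral>\<^sup>+r. ennreal (exp r) * (\<integral>\<^sup>+x. ennreal (norm x powr (-beta)) * indicator (D r) x \<partial>lborel) \<partial>lborel)"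
    by (intro nn_integral_cong nn_integral_cmult) measurable
  also have "\<dots> \<le> (\<integral>\<^sup>+r. ennreal (exp r) * (\<integral>\<^sup>+t. W t * indicator {t. 0 < t \<and> t < tD r} t \<partial>lborel) \<partial>lborel)"
    by (intro nn_integral_mono mult_left_mono W) auto
  also have "\<dots> = (\<integral>\<^sup>+r. \<integral>\<^sup>+t. ennreal (exp r) * (W t * indicator {t. 0 < t \<and> t < tD r} t) \<partial>lborel \<partial>lborel)"
    by (intro nn_integral_cong nn_integral_cmult[symmetric]) measurable
  also have "\<dots> = (\<integral>\<^sup>+t. \<integral>\<^sup>+r. ennreal (exp r) * (W t * indicator {t. 0 < t \<and> t < tD r} t) \<partial>lborel \<partial>lborel)"
    by (rule lborel_pair.Fubini') measurable
  also have "\<dots> \<le> (\<integral>\<^sup>+t. \<integral>\<^sup>+r. (indicator {0<..<m} t * W t) * (ennreal (exp r) * indicator {..q * A * G t powr p} r) \<partial>lborel \<partial>lborel)"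
  proof (intro nn_integral_mono)
    fix t r
    show "ennreal (exp r) * (W t * indicator {t. 0 < t \<and> t < tD r} t) \<le> (indicator {0<..<m} t * W t) * (ennreal (exp r) * indicator {..q * A * G t powr p} r)"
      using lev[of t r] tD(2)[of r] by (auto simp: mult_ac split: split_indicator)
  qed
  also have "\<dots> = (\<integral>\<^sup>+t. (indicator {0<..<m} t * W t) * ennreal (exp (q * A * G t powr p)) \<partial>lborel)"
    by (intro nn_integral_cong, subst nn_integral_cmult, measurable) (simp only: nn_integral_exp_atMost)
  also have "\<dots> = (\<integral>\<^sup>+t. ennreal (b powr (beta / n) * m powr q) * (indicator {0<..<m} t * (ennreal (1 / t) * ennreal (exp (- q * defect (ln (m / t)))))) \<partial>lborel)"
  proof (rule nn_integral_cong)
    fix t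
    have "b powr (beta / n) * t powr (- (beta / n)) * exp (q * A * G t powr p) = b powr (beta / n) * m powr q * (1 / t * exp (- q * defect (ln (m / t))))"
      if t: "0 < t" "t < m"
    proof -
      have "m * exp (- ln (m / t)) = t" using t by (simp add: exp_minus)
      then have "defect (ln (m / t)) = ln (m / t) - A * G t powr p"
      proof -
        have "(n * b powr (1/n) * G t) powr p = A * G t powr p"
          unfolding A_eq[symmetric] by (rule powr_mult)
        then show ?thesis unfolding defect_def \<open>m * exp (- ln (m / t)) = t\<close> by simp
      qed
      then have "q * A * G t powr p = q * ln m - q * ln t + (- q * defect (ln (m / t)))"
      proof -
        define f where "f = defect (ln (m / t))"
        have "A * G t powr p = ln m - ln t - f"
          using \<open>defect (ln (m / t)) = ln (m / t) - A * G t powr p\<close> t m_pos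
          unfolding f_def[symmetric] by (simp add: ln_div)
        then have "q * (A * G t powr p) = q * (ln m - ln t - f)" by simp
        then show ?thesis unfolding f_def[symmetric] by (simp add: algebra_simps)
      qed
      then have "exp (q * A * G t powr p) = m powr q / t powr q * exp (- q * defect (ln (m / t)))"
        using t by (simp only: exp_add exp_diff) (simp add: powr_def)
      then show ?thesis using t unfolding q(2) by (simp add: powr_diff)
    qed
    then show "(indicator {0<..<m} t * W t) * ennreal (exp (q * A * G t powr p)) =
      ennreal (b powr (beta / n) * m powr q) * (indicator {0<..<m} t * (ennreal (1 / t) * ennreal (exp (- q * defect (ln (m / t))))))"
      by (auto simp: W_def ennreal_mult[symmetric] split: split_indicator)
  qed
  also have "\<dots> = ennreal (b powr (beta / n) * m powr q) * (\<integral>\<^sup>+t. indicator {0<..<m} t * (ennreal (1 / t) * ennreal (exp (- q * defect (ln (m / t))))) \<partial>lborel)"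
    by (rule nn_integral_cmult) measurable
  also have "\<dots> \<le> ennreal (b powr (beta / n) * m powr q) * ennreal (exp (q * (C0 + 2)) * cA / q + (\<Sum>k. exp (- q * (real k - C0 - 2)) * (2 * cA * real k)))"
    by (intro mult_left_mono exp_minus_defect_integral q) auto
  also have "\<dots> = ennreal (exp_const beta * m powr q)"
  proof -
    have "0 \<le> (\<Sum>k. exp (- q * (real k - C0 - 2)) * (2 * cA * real k))"
      using cA_pos summable_exp_linear[OF q(1), of "C0 + 2" "2 * cA"]
      by (intro suminf_nonneg) (auto simp: algebra_simps)
    then have "0 \<le> exp (q * (C0 + 2)) * cA / q + (\<Sum>k. exp (- q * (real k - C0 - 2)) * (2 * cA * real k))"
      using q cA_pos by (intro add_nonneg_nonneg divide_nonneg_nonneg mult_nonneg_nonneg) auto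
    then show ?thesis
      by (subst ennreal_mult[symmetric]) (auto simp: exp_const_def q_exp_def q_def mult_ac)
  qed
  finally show ?thesis by (simp add: q_def A_def)
qed

end

section \<open>Truncations and Riesz potentials\<close>

lemma nn_integral_powr_atLeast:
  assumes a: "0 < a" and s: "0 < s"
  shows "(\<integral>\<^sup>+r. ennreal (r powr (- s - 1)) * indicator {a..} r \<partial>lborel) = ennreal (a powr (- s) / s)"
proof -
  have "(\<integral>\<^sup>+r. ennreal (r powr (- s - 1)) * indicator {a..} r \<partial>lborel) = ennreal (0 - (- (a powr (-s) / s)))"
  proof (rule nn_integral_FTC_atLeast)
    fix x assume "a \<le> x"
    then have x: "0 < x" using a by simp
    show "DERIV (\<lambda>x. - (x powr (-s) / s)) x :> x powr (- s - 1)"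
      using x s by (auto intro!: derivative_eq_intros simp: powr_diff)
  next
    have "((\<lambda>x::real. x powr (-s)) \<longlongrightarrow> 0) at_top"
      using s by (intro tendsto_neg_powr filterlim_ident) auto
    from tendsto_minus[OF tendsto_divide[OF this tendsto_const[of s]]] s
    show "((\<lambda>x. - (x powr (-s) / s)) \<longlongrightarrow> 0) at_top" by simp
  qed auto
  then show ?thesis by simp
qed

text \<open>Averaging the one-dimensional integrals over all directions in the unit ball yields the Riesz
  kernel without polar coordinates: substitute \<open>y = r z\<close> and integrate in \<open>r\<close> first.\<close>

lemma nn_integral_rays_eq_riesz:
  fixes f :: "'a::euclidean_space \<Rightarrow> real"
  assumes [measurable]: "f \<in> borel_measurable borel" and f0: "\<And>y. 0 \<le> f y"
  shows "(\<integral>\<^sup>+z. indicator {z. norm z \<le> 1} z * (\<integral>\<^sup>+r. indicator {0<..} r * ennreal (f (x + r *\<^sub>R z) * norm z) \<partial>lborel) \<partial>lborel)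
    = ennreal (1 / real DIM('a)) * (\<integral>\<^sup>+y. ennreal (f y * norm (x - y) powr (1 - real DIM('a))) \<partial>lborel)"
proof -
  let ?n = "real DIM('a)"
  have n: "1 \<le> ?n" by (rule DIM_ge_1)
  have "(\<integral>\<^sup>+z. indicator {z. norm z \<le> 1} z * (\<integral>\<^sup>+r. indicator {0<..} r * ennreal (f (x + r *\<^sub>R z) * norm z) \<partial>lborel) \<partial>lborel)
    = (\<integral>\<^sup>+z. \<integral>\<^sup>+r. indicator {z. norm z \<le> 1} z * (indicator {0<..} r * ennreal (f (x + r *\<^sub>R z) * norm z)) \<partial>lborel \<partial>lborel)"
    by (intro nn_integral_cong nn_integral_cmult[symmetric]) measurable
  also have "\<dots> = (\<integral>\<^sup>+r. \<integral>\<^sup>+z. indicator {z. norm z \<le> 1} z * (indicator {0<..} r * ennreal (f (x + r *\<^sub>R z) * norm z)) \<partial>lborel \<partial>lborel)"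
    by (rule lborel_pair.Fubini') measurable
  also have "\<dots> = (\<integral>\<^sup>+r. \<integral>\<^sup>+y. ennreal (f (x + y) * norm y) * (indicator {r. 0 < r \<and> norm y \<le> r} r * ennreal (r powr (- ?n - 1))) \<partial>lborel \<partial>lborel)"
  proof (rule nn_integral_cong)
    fix r :: real
    show "(\<integral>\<^sup>+z. indicator {z. norm z \<le> 1} z * (indicator {0<..} r * ennreal (f (x + r *\<^sub>R z) * norm z)) \<partial>lborel)
      = (\<integral>\<^sup>+y. ennreal (f (x + y) * norm y) * (indicator {r. 0 < r \<and> norm y \<le> r} r * ennreal (r powr (- ?n - 1))) \<partial>lborel)"
    proof (cases "0 < r")
      case r: True
      define g where "g y = ennreal (f (x + y) * norm y) * (indicator {r. 0 < r \<and> norm y \<le> r} r * ennreal (r powr (- ?n - 1)))" for y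
      have [measurable]: "g \<in> borel_measurable borel" unfolding g_def[abs_def] by measurable
      have "(\<integral>\<^sup>+y. g y \<partial>lborel) = ennreal (\<bar>r\<bar> ^ DIM('a)) * (\<integral>\<^sup>+z. g (0 + r *\<^sub>R z) \<partial>lborel)"
        using r by (intro nn_integral_lborel_affine) auto
      also have "\<dots> = (\<integral>\<^sup>+z. ennreal (\<bar>r\<bar> ^ DIM('a)) * g (0 + r *\<^sub>R z) \<partial>lborel)"
        by (rule nn_integral_cmult[symmetric]) measurable
      also have "\<dots> = (\<integral>\<^sup>+z. indicator {z. norm z \<le> 1} z * (indicator {0<..} r * ennreal (f (x + r *\<^sub>R z) * norm z)) \<partial>lborel)"
      proof (rule nn_integral_cong)
        fix z :: 'a
        \<comment> \<open>The volume factor r^n, the r in |y| = r |z| and the weight r^(-n-1) cancel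
          exactly.\<close>
        have "r ^ DIM('a) * (f (x + r *\<^sub>R z) * (r * norm z) * r powr (- ?n - 1)) = f (x + r *\<^sub>R z) * norm z"
          using r by (simp add: powr_diff powr_minus powr_realpow field_simps)
        then show "ennreal (\<bar>r\<bar> ^ DIM('a)) * g (0 + r *\<^sub>R z) = indicator {z. norm z \<le> 1} z * (indicator {0<..} r * ennreal (f (x + r *\<^sub>R z) * norm z))"
          using r f0 by (auto simp: g_def ennreal_mult[symmetric] split: split_indicator)
      qed
      finally show ?thesis by (simp add: g_def)
    qed simp
  qed
  also have "\<dots> = (\<integral>\<^sup>+y. \<integral>\<^sup>+r. ennreal (f (x + y) * norm y) * (indicator {r. 0 < r \<and> norm y \<le> r} r * ennreal (r powr (- ?n - 1))) \<partial>lborel \<partial>lborel)"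
    by (rule lborel_pair.Fubini') measurable
  also have "\<dots> = (\<integral>\<^sup>+y. ennreal (1 / ?n) * ennreal (f (x + y) * norm y powr (1 - ?n)) \<partial>lborel)"
  proof (rule nn_integral_cong_AE)
    show "AE y in lborel. (\<integral>\<^sup>+r. ennreal (f (x + y) * norm y) * (indicator {r. 0 < r \<and> norm y \<le> r} r * ennreal (r powr (- ?n - 1))) \<partial>lborel)
      = ennreal (1 / ?n) * ennreal (f (x + y) * norm y powr (1 - ?n))"
      using AE_lborel_singleton[of "0::'a"]
    proof eventually_elim
      case (elim y)
      have "(\<integral>\<^sup>+r. ennreal (f (x + y) * norm y) * (indicator {r. 0 < r \<and> norm y \<le> r} r * ennreal (r powr (- ?n - 1))) \<partial>lborel)
        = (\<integral>\<^sup>+r. ennreal (f (x + y) * norm y) * (ennreal (r powr (- ?n - 1)) * indicator {norm y..} r) \<partial>lborel)"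
        using elim by (intro nn_integral_cong) (auto split: split_indicator simp: less_le_trans[of 0 "norm y"])
      also have "\<dots> = ennreal (f (x + y) * norm y) * ennreal (norm y powr (- ?n) / ?n)"
        using elim n by (subst nn_integral_cmult, measurable) (subst nn_integral_powr_atLeast, auto)
      also have "\<dots> = ennreal (f (x + y) * norm y * (norm y powr (- ?n) / ?n))"
        using f0 by (simp add: ennreal_mult[symmetric])
      also have "f (x + y) * norm y * (norm y powr (- ?n) / ?n) = 1 / ?n * (f (x + y) * norm y powr (1 - ?n))"
        using elim by (simp add: powr_diff powr_minus field_simps)
      finally show ?case using f0 n by (simp only: ennreal_mult divide_nonneg_nonneg mult_nonneg_nonneg powr_ge_zero zero_le_one of_nat_0_le_iff)
    qed
  qed
  also have "\<dots> = ennreal (1 / ?n) * (\<integral>\<^sup>+y. ennreal (f (x + y) * norm y powr (1 - ?n)) \<partial>lborel)"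
    by (rule nn_integral_cmult) measurable
  also have "(\<integral>\<^sup>+y. ennreal (f (x + y) * norm y powr (1 - ?n)) \<partial>lborel) = (\<integral>\<^sup>+y. ennreal (f (x + y) * norm (x - (x + y)) powr (1 - ?n)) \<partial>lborel)"
    by simp
  also have "\<dots> = (\<integral>\<^sup>+y. ennreal (f y * norm (x - y) powr (1 - ?n)) \<partial>lborel)"
    by (rule nn_integral_lborel_translate[of "\<lambda>y. ennreal (f y * norm (x - y) powr (1 - ?n))"]) measurable
  finally show ?thesis .
qed

text \<open>On each ray the segment before the first point with |w| \<le> \<theta> lies in the
  superlevel set, so the indicator is inserted without loss. Averaging over all directions, rather
  than picking one, yields the constant 1 / (n b) on which the sharp exponent depends.\<close>

lemma truncation_le_riesz:
  fixes w g :: "'a::euclidean_space \<Rightarrow> real"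
  assumes w: "continuous_on UNIV w"
    and [measurable]: "g \<in> borel_measurable borel" and g0: "\<And>y. 0 \<le> g y"
    and line: "\<And>x z R. 0 \<le> R \<Longrightarrow> ennreal \<bar>w (x + R *\<^sub>R z) - w x\<bar> \<le> (\<integral>\<^sup>+r. indicator {0..R} r * ennreal (g (x + r *\<^sub>R z) * norm z) \<partial>lborel)"
    and decay: "\<And>x z. z \<noteq> 0 \<Longrightarrow> \<exists>R\<ge>0. \<bar>w (x + R *\<^sub>R z)\<bar> \<le> \<theta>"
    and x: "\<theta> < \<bar>w x\<bar>"
  shows "ennreal (\<bar>w x\<bar> - \<theta>) \<le> ennreal (1 / (real DIM('a) * unit_ball_vol DIM('a)))
    * (\<integral>\<^sup>+y. ennreal (g y * indicator {y. \<theta> < \<bar>w y\<bar>} y * norm (x - y) powr (1 - real DIM('a))) \<partial>lborel)"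
proof -
  let ?n = "real DIM('a)" and ?b = "unit_ball_vol (real DIM('a))"
  have b: "0 < ?b" by simp
  have n: "1 \<le> ?n" by (rule DIM_ge_1)
  have [measurable]: "w \<in> borel_measurable borel" using w by (rule borel_measurable_continuous_onI)
  define f where "f y = g y * indicator {y. \<theta> < \<bar>w y\<bar>} y" for y
  have [measurable]: "f \<in> borel_measurable borel" unfolding f_def[abs_def] by measurable
  have f0: "0 \<le> f y" for y using g0 by (simp add: f_def)
  have ray: "ennreal (\<bar>w x\<bar> - \<theta>) \<le> (\<integral>\<^sup>+r. indicator {0<..} r * ennreal (f (x + r *\<^sub>R z) * norm z) \<partial>lborel)"
    if z: "z \<noteq> 0" for z
  proof -
    obtain R1 where R1: "0 \<le> R1" "\<bar>w (x + R1 *\<^sub>R z)\<bar> \<le> \<theta>" using decay[OF z] by blast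
    have cont: "continuous_on UNIV (\<lambda>r. \<bar>w (x + r *\<^sub>R z)\<bar>)"
      by (intro continuous_intros continuous_on_compose2[OF w]) auto
    have "closed {r. \<bar>w (x + r *\<^sub>R z)\<bar> \<le> \<theta>}"
      using closed_Collect_le[OF cont continuous_on_const] by simp
    \<comment> \<open>The first exit is a minimum over a compact set of parameters, nonempty by
      \<open>decay\<close>.\<close>
    then have "compact ({0..R1} \<inter> {r. \<bar>w (x + r *\<^sub>R z)\<bar> \<le> \<theta>})"
      by (rule compact_Int_closed[OF compact_Icc])
    moreover have "{0..R1} \<inter> {r. \<bar>w (x + r *\<^sub>R z)\<bar> \<le> \<theta>} \<noteq> {}" using R1 by auto
    ultimately obtain R where "R \<in> {0..R1} \<inter> {r. \<bar>w (x + r *\<^sub>R z)\<bar> \<le> \<theta>}"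
      and "\<And>r. r \<in> {0..R1} \<inter> {r. \<bar>w (x + r *\<^sub>R z)\<bar> \<le> \<theta>} \<Longrightarrow> R \<le> r"
      using compact_attains_inf[of "{0..R1} \<inter> {r. \<bar>w (x + r *\<^sub>R z)\<bar> \<le> \<theta>}"] by blast
    then have R: "0 \<le> R" "R \<le> R1" "\<bar>w (x + R *\<^sub>R z)\<bar> \<le> \<theta>"
      and min: "\<And>r. 0 \<le> r \<Longrightarrow> r \<le> R1 \<Longrightarrow> \<bar>w (x + r *\<^sub>R z)\<bar> \<le> \<theta> \<Longrightarrow> R \<le> r"
      by auto
    have "ennreal (\<bar>w x\<bar> - \<theta>) \<le> ennreal \<bar>w (x + R *\<^sub>R z) - w x\<bar>"
      using R by (intro ennreal_leI) linarith
    also have "\<dots> \<le> (\<integral>\<^sup>+r. indicator {0..R} r * ennreal (g (x + r *\<^sub>R z) * norm z) \<partial>lborel)"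
      by (rule line[OF R(1)])
    also have "\<dots> \<le> (\<integral>\<^sup>+r. indicator {0<..} r * ennreal (f (x + r *\<^sub>R z) * norm z) \<partial>lborel)"
    proof (rule nn_integral_mono_AE)
      show "AE r in lborel. indicator {0..R} r * ennreal (g (x + r *\<^sub>R z) * norm z) \<le> indicator {0<..} r * ennreal (f (x + r *\<^sub>R z) * norm z)"
        using AE_lborel_singleton[of 0] AE_lborel_singleton[of R]
      proof eventually_elim
        case (elim r)
        have "\<theta> < \<bar>w (x + r *\<^sub>R z)\<bar>" if "0 < r" "r < R"
          using min[of r] that R by force
        then show ?case using elim by (auto simp: f_def split: split_indicator)
      qed
    qed
    finally show ?thesis .
  qed
  \<comment> \<open>The left side does not depend on the direction, so integration over the unit
    ball multiplies it by the volume \<open>?b\<close>; the degenerate direction z = 0 is a null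
    set.\<close>
  have "ennreal ?b * ennreal (\<bar>w x\<bar> - \<theta>) = (\<integral>\<^sup>+z. indicator {z::'a. norm z \<le> 1} z * ennreal (\<bar>w x\<bar> - \<theta>) \<partial>lborel)"
  proof -
    have "{z::'a. norm z \<le> 1} = cball 0 1" by auto
    then show ?thesis by (subst nn_integral_multc) (auto simp: emeasure_cball)
  qed
  also have "\<dots> \<le> (\<integral>\<^sup>+z. indicator {z. norm z \<le> 1} z * (\<integral>\<^sup>+r. indicator {0<..} r * ennreal (f (x + r *\<^sub>R z) * norm z) \<partial>lborel) \<partial>lborel)"
  proof (rule nn_integral_mono_AE)
    show "AE z in lborel. indicator {z::'a. norm z \<le> 1} z * ennreal (\<bar>w x\<bar> - \<theta>)
      \<le> indicator {z. norm z \<le> 1} z * (\<integral>\<^sup>+r. indicator {0<..} r * ennreal (f (x + r *\<^sub>R z) * norm z) \<partial>lborel)"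
      using AE_lborel_singleton[of "0::'a"] by eventually_elim (intro mult_left_mono ray, auto)
  qed
  also have "\<dots> = ennreal (1 / ?n) * (\<integral>\<^sup>+y. ennreal (f y * norm (x - y) powr (1 - ?n)) \<partial>lborel)"
    by (rule nn_integral_rays_eq_riesz) (use f0 in auto)
  finally have "ennreal (1 / ?b) * (ennreal ?b * ennreal (\<bar>w x\<bar> - \<theta>))
    \<le> ennreal (1 / ?b) * (ennreal (1 / ?n) * (\<integral>\<^sup>+y. ennreal (f y * norm (x - y) powr (1 - ?n)) \<partial>lborel))"
    by (intro mult_left_mono) auto
  moreover have "ennreal (1 / ?b) * (ennreal ?b * ennreal (\<bar>w x\<bar> - \<theta>)) = ennreal (\<bar>w x\<bar> - \<theta>)"
    using x b by (simp add: ennreal_mult[symmetric] del: unit_ball_vol_pos)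
  moreover have "ennreal (1 / ?b) * (ennreal (1 / ?n) * X) = ennreal (1 / (?n * ?b)) * X" for X
  proof -
    have "1 / (?n * ?b) = 1 / ?b * (1 / ?n)" by simp
    then have "ennreal (1 / (?n * ?b)) = ennreal (1 / ?b) * ennreal (1 / ?n)"
      using b n by (simp only:) (intro ennreal_mult, auto)
    then show ?thesis by (simp add: mult.assoc)
  qed
  ultimately show ?thesis by (simp add: f_def)
qed

section \<open>Smooth bump functions\<close>

text \<open>The powers of 1/t make the family closed under differentiation up to linear
  combinations, so that smoothness of all members follows from one induction.\<close>

definition flat :: "nat \<Rightarrow> real \<Rightarrow> real" where
  "flat m t = (if 0 < t then (1 / t) ^ m * exp (- (1 / t)) else 0)"

lemma flat_nonneg: "0 \<le> flat m t" by (simp add: flat_def)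

lemma flat_pos: "0 < t \<Longrightarrow> 0 < flat m t" by (simp add: flat_def)

text \<open>A single term of the exponential series: x^(m+2) / (m+2)! \<le> exp x with x = 1/t. The
  order 2 makes the difference quotient at 0 tend to 0 in \<open>flat_deriv\<close>.\<close>

lemma flat_le_square: "flat m t \<le> fact (m + 2) * t\<^sup>2"
proof (cases "0 < t")
  case True
  define x where "x = 1 / t"
  have x: "0 < x" using True by (simp add: x_def)
  have "x ^ (m + 2) / fact (m + 2) \<le> exp x"
  proof -
    obtain s where "exp x = (\<Sum>j<m + 2. x ^ j / fact j) + exp s / fact (m + 2) * x ^ (m + 2)" "\<bar>s\<bar> \<le> \<bar>x\<bar>"
      using Maclaurin_exp_le[of x "m + 2"] by blast
    have "x ^ (m + 2) / fact (m + 2) = (\<Sum>j\<in>{m + 2}. x ^ j /\<^sub>R fact j)" by (simp add: divide_inverse mult.commute)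
    also have "\<dots> \<le> (\<Sum>j. x ^ j /\<^sub>R fact j)"
      using x summable_exp_generic[of x] by (intro sum_le_suminf) auto
    also have "\<dots> = exp x" by (simp add: exp_def)
    finally show ?thesis .
  qed
  then have "x ^ (m + 2) \<le> fact (m + 2) * exp x" by (simp add: divide_le_eq mult.commute)
  then have "x ^ m * exp (- x) \<le> fact (m + 2) * (1 / x\<^sup>2)"
    using x by (simp add: exp_minus field_simps power2_eq_square power_add)
  then show ?thesis using True by (simp add: flat_def x_def power_divide)
next
  case False
  then show ?thesis by (simp add: flat_def)
qed

lemma flat_deriv: "DERIV (flat m) t :> flat (m + 2) t - real m * flat (m + 1) t"
proof (cases t "0::real" rule: linorder_cases)
  case greater
  have 1: "DERIV (\<lambda>x::real. x ^ m * exp (- x)) (1 / t) :> real m * (1 / t) ^ (m - 1) * exp (- (1 / t)) - (1 / t) ^ m * exp (- (1 / t))"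
    by (auto intro!: derivative_eq_intros)
  have 2: "DERIV (\<lambda>t. 1 / t) t :> - ((1 / t)\<^sup>2)"
    using greater by (auto intro!: derivative_eq_intros simp: power2_eq_square)
  have "(real m * (1 / t) ^ (m - 1) * exp (- (1 / t)) - (1 / t) ^ m * exp (- (1 / t))) * - ((1 / t)\<^sup>2)
     = flat (m + 2) t - real m * flat (m + 1) t"
    using greater by (cases m) (simp_all add: flat_def power2_eq_square algebra_simps add_divide_distrib)
  with DERIV_chain2[OF 1 2]
  have "DERIV (\<lambda>t. (1 / t) ^ m * exp (- (1 / t))) t :> flat (m + 2) t - real m * flat (m + 1) t" by simp
  then show ?thesis
    by (rule has_field_derivative_transform_within_open[where S="{0<..}"]) (use greater in \<open>auto simp: flat_def\<close>)
next
  case less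
  have "DERIV (\<lambda>_. 0) t :> flat (m + 2) t - real m * flat (m + 1) t"
    using less by (simp add: flat_def)
  then show ?thesis
    by (rule has_field_derivative_transform_within_open[where S="{..<0}"]) (use less in \<open>auto simp: flat_def\<close>)
next
  case equal
  have "((\<lambda>h. flat m h / h) \<longlongrightarrow> 0) (at 0)"
  proof (rule Lim_null_comparison)
    show "\<forall>\<^sub>F h in at 0. norm (flat m h / h) \<le> fact (m + 2) * \<bar>h\<bar>"
    proof (rule eventually_at_filter[THEN iffD2], rule always_eventually, intro allI impI)
      fix h :: real assume h: "h \<noteq> 0"
      have "norm (flat m h / h) = flat m h / \<bar>h\<bar>" using flat_nonneg[of m h] by simp
      also have "\<dots> \<le> fact (m + 2) * h\<^sup>2 / \<bar>h\<bar>" using flat_le_square[of m h] by (intro divide_right_mono) auto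
      also have "\<dots> = fact (m + 2) * \<bar>h\<bar>" using h by (simp add: power2_eq_square field_simps abs_if)
      finally show "norm (flat m h / h) \<le> fact (m + 2) * \<bar>h\<bar>" .
    qed
    have "((\<lambda>h::real. fact (m + 2) * \<bar>h\<bar>) \<longlongrightarrow> fact (m + 2) * \<bar>0\<bar>) (at 0)" by (intro tendsto_intros)
    then show "((\<lambda>h::real. fact (m + 2) * \<bar>h\<bar>) \<longlongrightarrow> 0) (at 0)" by simp
  qed
  then show ?thesis using equal by (simp add: DERIV_def flat_def)
qed

section \<open>Calculus of the classes \<open>C_k\<close>\<close>

lemma partial_deriv_eq:
  assumes "(f has_derivative f') (at x)"
  shows "partial_deriv i f x = f' (axis i 1)"
  using frechet_derivative_at[OF assms] by (simp add: partial_deriv_def)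

lemma has_derivative_frechet:
  assumes "f differentiable_on UNIV"
  shows "(f has_derivative frechet_derivative f (at x)) (at x)"
  using assms by (simp add: differentiable_on_def frechet_derivative_works[symmetric])

lemma C_k_Suc_imp: "C_k (Suc k) f \<Longrightarrow> C_k k f"
  by (induction k arbitrary: f) (auto intro: differentiable_imp_continuous_on)

lemma C_k_add: "C_k k f \<Longrightarrow> C_k k g \<Longrightarrow> C_k k (\<lambda>x. f x + g x)"
proof (induction k arbitrary: f g)
  case 0 then show ?case by (auto intro: continuous_on_add)
next
  case (Suc k)
  have "partial_deriv i (\<lambda>x. f x + g x) = (\<lambda>x. partial_deriv i f x + partial_deriv i g x)" for i
  proof
    fix x
    have "((\<lambda>x. f x + g x) has_derivative (\<lambda>h. frechet_derivative f (at x) h + frechet_derivative g (at x) h)) (at x)"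
      using Suc.prems by (auto intro!: has_derivative_add has_derivative_frechet)
    from partial_deriv_eq[OF this] show "partial_deriv i (\<lambda>x. f x + g x) x = partial_deriv i f x + partial_deriv i g x"
      by (simp add: partial_deriv_def)
  qed
  then show ?case using Suc by (auto intro: differentiable_on_add)
qed

lemma C_k_mult: "C_k k f \<Longrightarrow> C_k k g \<Longrightarrow> C_k k (\<lambda>x. f x * g x)"
proof (induction k arbitrary: f g)
  case 0 then show ?case by (auto intro: continuous_on_mult)
next
  case (Suc k)
  have "partial_deriv i (\<lambda>x. f x * g x) = (\<lambda>x. f x * partial_deriv i g x + partial_deriv i f x * g x)" for i
  proof
    fix x
    have "((\<lambda>x. f x * g x) has_derivative (\<lambda>h. f x * frechet_derivative g (at x) h + frechet_derivative f (at x) h * g x)) (at x)"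
      using Suc.prems by (auto intro!: has_derivative_mult has_derivative_frechet)
    from partial_deriv_eq[OF this] show "partial_deriv i (\<lambda>x. f x * g x) x = f x * partial_deriv i g x + partial_deriv i f x * g x"
      by (simp add: partial_deriv_def)
  qed
  moreover have "C_k k f" "C_k k g" using Suc.prems C_k_Suc_imp by blast+
  ultimately show ?case using Suc by (auto intro: differentiable_on_mult C_k_add)
qed

lemma C_k_const: "C_k k (\<lambda>x. c)"
proof (induction k arbitrary: c)
  case (Suc k)
  have "partial_deriv i (\<lambda>x. c) = (\<lambda>x. 0)" for i :: 'a
    by (rule ext) (subst partial_deriv_eq[OF has_derivative_const], simp)
  then show ?case using Suc by simp
qed simp

lemma C_k_coord: "C_k k (\<lambda>x. x $ j)"
proof (cases k)
  case (Suc k')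
  have d: "((\<lambda>x. x $ j) has_derivative (\<lambda>x. x $ j)) (at x)" for x :: "real ^ 'a"
    by (rule bounded_linear_imp_has_derivative[OF bounded_linear_vec_nth])
  have "partial_deriv i (\<lambda>x. x $ j) = (\<lambda>x. axis i 1 $ j)" for i :: 'a
    by (rule ext) (rule partial_deriv_eq[OF d])
  moreover have "(\<lambda>x::real ^ 'a. x $ j) differentiable_on UNIV"
    using d unfolding differentiable_on_def differentiable_def by blast
  ultimately show ?thesis using Suc by (simp add: C_k_const)
qed (auto intro: continuous_intros)

text \<open>The squared distance is used because it is a polynomial: the function is then smooth at
  its centre too. For d \<ge> 0 it vanishes outside the ball of radius d about
  \<open>a\<close>.\<close>

definition bump :: "nat \<Rightarrow> real \<Rightarrow> real ^ 'n::finite \<Rightarrow> real ^ 'n \<Rightarrow> real" where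
  "bump m d a y = flat m (d\<^sup>2 - (y - a) \<bullet> (y - a))"

lemma bump_has_derivative:
  "(bump m d a has_derivative (\<lambda>h. (bump (m + 2) d a y - real m * bump (m + 1) d a y) * (-2 * ((y - a) \<bullet> h)))) (at y)"
proof -
  have "((\<lambda>y. d\<^sup>2 - (y - a) \<bullet> (y - a)) has_derivative (\<lambda>h. -2 * ((y - a) \<bullet> h))) (at y)"
    by (auto intro!: derivative_eq_intros simp: inner_commute)
  from DERIV_compose_FDERIV[OF flat_deriv this]
  show ?thesis unfolding bump_def[abs_def] by (simp add: mult_ac)
qed

lemma bump_partial_deriv:
  "partial_deriv i (bump m d a) y = (bump (m + 2) d a y - real m * bump (m + 1) d a y) * (-2 * (y - a) $ i)"
  using partial_deriv_eq[OF bump_has_derivative] by (simp add: inner_axis)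

text \<open>The induction runs over all \<open>m\<close> at once, since a partial derivative of a
  bump is a combination, with affine coefficients, of bumps of higher index.\<close>

lemma C_k_bump: "C_k k (bump m d a)"
proof (induction k arbitrary: m)
  case 0
  have "isCont (bump m d a) y" for y
    by (rule has_derivative_continuous[OF bump_has_derivative])
  then show ?case by (auto intro!: continuous_at_imp_continuous_on)
next
  case (Suc k)
  have "partial_deriv i (bump m d a) = (\<lambda>y. (bump (m + 2) d a y + (- real m) * bump (m + 1) d a y) * ((-2) * (y $ i + (- (a $ i)))))" for i
    by (rule ext) (simp add: bump_partial_deriv)
  moreover have "C_k k (\<lambda>y. (bump (m + 2) d a y + (- real m) * bump (m + 1) d a y) * ((-2) * (y $ i + (- (a $ i)))))" for i
    by (intro C_k_mult C_k_add C_k_const C_k_coord Suc)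
  moreover have "bump m d a differentiable_on UNIV"
    using bump_has_derivative unfolding differentiable_on_def differentiable_def by blast
  ultimately show ?case by simp
qed

lemma bump_nonneg: "0 \<le> bump m d a y" by (simp add: bump_def flat_nonneg)

lemma bump_outside: "0 \<le> d \<Longrightarrow> d \<le> norm (y - a) \<Longrightarrow> bump m d a y = 0"
proof -
  assume "0 \<le> d" "d \<le> norm (y - a)"
  then have "d\<^sup>2 \<le> (norm (y - a))\<^sup>2" by (rule power_mono[rotated])
  then show ?thesis by (simp add: bump_def flat_def power2_norm_eq_inner[symmetric])
qed

lemma test_function_bump:
  assumes "0 \<le> d" shows "test_function (bump m d a)"
  unfolding test_function_def
proof (intro conjI allI C_k_bump)
  have "{x. bump m d a x \<noteq> 0} \<subseteq> cball a d"
  proof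
    fix x assume "x \<in> {x. bump m d a x \<noteq> 0}"
    then have "\<not> d \<le> norm (x - a)" using bump_outside[OF assms] by force
    then show "x \<in> cball a d" by (simp add: dist_norm norm_minus_commute)
  qed
  then show "compact (closure {x. bump m d a x \<noteq> 0})"
    by (meson bounded_cball bounded_subset compact_closure)
qed

lemma bump_continuous: "continuous_on UNIV (bump m d a)"
  using C_k_bump[of 0 m d a] by simp

lemma bump_swap: "bump m d x y = bump m d 0 (x - y)"
proof -
  have "(y - x) \<bullet> (y - x) = (x - y) \<bullet> (x - y)" by (simp add: inner_diff algebra_simps)
  then show ?thesis by (simp add: bump_def)
qed


lemma continuous_zero_outside_bounded:
  fixes f :: "'a::euclidean_space \<Rightarrow> real"
  assumes f: "continuous_on UNIV f" and supp: "\<And>y. R \<le> norm (y - a) \<Longrightarrow> f y = 0"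
  shows "\<exists>K>0. \<forall>y. \<bar>f y\<bar> \<le> K"
proof -
  have "compact (f ` cball a R)" using f by (intro compact_continuous_image) (auto intro: continuous_on_subset)
  then obtain K where K: "\<And>y. y \<in> cball a R \<Longrightarrow> \<bar>f y\<bar> \<le> K"
    using compact_imp_bounded by (force simp: bounded_iff)
  have "\<bar>f y\<bar> \<le> max K 1" for y
    using K[of y] supp[of y] by (cases "y \<in> cball a R") (auto simp: dist_norm norm_minus_commute)
  then show ?thesis by (intro exI[of _ "max K 1"]) auto
qed

section \<open>Mollification\<close>

definition transl_dist :: "('a::euclidean_space \<Rightarrow> real) \<Rightarrow> 'a \<Rightarrow> ennreal" where
  "transl_dist h t = (\<integral>\<^sup>+x. ennreal \<bar>h (x - t) - h x\<bar> \<partial>lborel)"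

lemma nn_integral_lborel_shift:
  fixes t :: "'a::euclidean_space"
  assumes "f \<in> borel_measurable borel"
  shows "(\<integral>\<^sup>+x. f (x - t) \<partial>lborel) = (\<integral>\<^sup>+x. f x \<partial>lborel)"
  using nn_integral_lborel_translate[OF assms, of "-t"] by simp

text \<open>Inner regularity is applied to Lebesgue measure restricted to \<open>A\<close>, because
  it is stated for measures of finite total mass.\<close>

lemma compact_subset_emeasure_approx:
  fixes A :: "'a::euclidean_space set"
  assumes A[measurable]: "A \<in> sets borel" and fin: "emeasure lborel A < \<infinity>" and e: "0 < (e::real)"
  obtains K where "compact K" "K \<subseteq> A" "emeasure lborel (A - K) < ennreal e"
proof -
  let ?M = "density lborel (indicator A)"
  have eM: "emeasure ?M B = emeasure lborel B" if "B \<in> sets borel" "B \<subseteq> A" for B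
  proof -
    have "emeasure ?M B = (\<integral>\<^sup>+x. indicator A x * indicator B x \<partial>lborel)" using that by (subst emeasure_density) auto
    also have "\<dots> = (\<integral>\<^sup>+x. indicator B x \<partial>lborel)" using that by (intro nn_integral_cong) (auto split: split_indicator)
    finally show ?thesis using that by simp
  qed
  have "emeasure ?M (space ?M) = (\<integral>\<^sup>+x. indicator A x \<partial>lborel)"
    by (subst emeasure_density) (auto intro!: nn_integral_cong)
  then have fM: "emeasure ?M (space ?M) \<noteq> \<infinity>" using fin by simp
  have sup: "emeasure ?M A = (SUP K\<in>{K. K \<subseteq> A \<and> compact K}. emeasure ?M K)"
    by (rule inner_regular[OF _ fM]) auto
  show thesis
  proof (cases "emeasure lborel A = 0")
    case True
    then show ?thesis using e by (intro that[of "{}"]) auto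
  next
    case False
    have "emeasure lborel A - ennreal e < emeasure lborel A"
      using False fin e by (intro ennreal_between) (auto simp: zero_less_iff_neq_zero)
    then have "emeasure lborel A - ennreal e < (SUP K\<in>{K. K \<subseteq> A \<and> compact K}. emeasure ?M K)"
      using sup eM[of A] by simp
    then obtain K where K: "K \<subseteq> A" "compact K" "emeasure lborel A - ennreal e < emeasure ?M K"
      unfolding less_SUP_iff by auto
    have [measurable]: "K \<in> sets borel" using K by (simp add: borel_compact)
    have "emeasure lborel A - ennreal e < emeasure lborel K" using K eM[of K] by simp
    have finK: "emeasure lborel K \<noteq> \<infinity>" using emeasure_mono[OF K(1), of lborel] fin by (auto simp: top_unique)
    have "emeasure lborel (A - K) = emeasure lborel A - emeasure lborel K"
      using K finK by (intro emeasure_Diff) auto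
    also have "\<dots> < ennreal e"
    proof -
      obtain a where a: "emeasure lborel A = ennreal a" "0 \<le> a" using fin by (cases "emeasure lborel A") auto
      obtain k where k: "emeasure lborel K = ennreal k" "0 \<le> k" using finK by (cases "emeasure lborel K") auto
      have "\<not> k \<le> a - e"
        using \<open>emeasure lborel A - ennreal e < emeasure lborel K\<close> e ennreal_leI[of k "a - e"]
        unfolding a k by (auto simp: ennreal_minus)
      then show ?thesis unfolding a k using e k by (auto simp: ennreal_minus intro!: ennreal_lessI)
    qed
    finally show ?thesis using K by (intro that[of K]) auto
  qed
qed

lemma transl_dist_add:
  assumes [measurable]: "f \<in> borel_measurable borel" "g \<in> borel_measurable borel"
  shows "transl_dist (\<lambda>x. f x + g x) t \<le> transl_dist f t + transl_dist g t"
proof -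
  have "transl_dist (\<lambda>x. f x + g x) t \<le> (\<integral>\<^sup>+x. ennreal \<bar>f (x - t) - f x\<bar> + ennreal \<bar>g (x - t) - g x\<bar> \<partial>lborel)"
    unfolding transl_dist_def by (intro nn_integral_mono) (auto simp: ennreal_plus[symmetric] simp del: ennreal_plus intro!: ennreal_leI)
  also have "\<dots> = transl_dist f t + transl_dist g t"
    unfolding transl_dist_def by (rule nn_integral_add) auto
  finally show ?thesis .
qed

lemma transl_dist_triangle:
  assumes [measurable]: "f \<in> borel_measurable borel" "g \<in> borel_measurable borel"
  shows "transl_dist f t \<le> transl_dist g t + 2 * (\<integral>\<^sup>+x. ennreal \<bar>f x - g x\<bar> \<partial>lborel)"
proof -
  have "transl_dist f t = transl_dist (\<lambda>x. g x + (f x - g x)) t" by simp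
  also have "\<dots> \<le> transl_dist g t + transl_dist (\<lambda>x. f x - g x) t"
    by (rule transl_dist_add) auto
  also have "transl_dist (\<lambda>x. f x - g x) t \<le> (\<integral>\<^sup>+x. ennreal \<bar>f (x - t) - g (x - t)\<bar> + ennreal \<bar>f x - g x\<bar> \<partial>lborel)"
    unfolding transl_dist_def by (intro nn_integral_mono) (auto simp: ennreal_plus[symmetric] simp del: ennreal_plus intro!: ennreal_leI)
  also have "\<dots> = (\<integral>\<^sup>+x. ennreal \<bar>f (x - t) - g (x - t)\<bar> \<partial>lborel) + (\<integral>\<^sup>+x. ennreal \<bar>f x - g x\<bar> \<partial>lborel)"
    by (rule nn_integral_add) auto
  also have "(\<integral>\<^sup>+x. ennreal \<bar>f (x - t) - g (x - t)\<bar> \<partial>lborel) = (\<integral>\<^sup>+x. ennreal \<bar>f x - g x\<bar> \<partial>lborel)"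
    by (rule nn_integral_lborel_shift[of "\<lambda>x. ennreal \<bar>f x - g x\<bar>"]) auto
  finally show ?thesis by (simp add: add_left_mono mult_2)
qed

text \<open>\<open>A\<close> is squeezed between a compact \<open>K\<close> and an open
  \<open>U\<close>. A shift so short that it keeps \<open>K\<close> inside \<open>U\<close> changes
  the indicator only at points of U - K or of its translate.\<close>

lemma transl_dist_indicator:
  fixes A :: "'a::euclidean_space set"
  assumes A[measurable]: "A \<in> sets borel" and fin: "emeasure lborel A < \<infinity>" and e: "0 < (e::real)"
  shows "\<exists>d>0. \<forall>t. norm t < d \<longrightarrow> transl_dist (\<lambda>x. indicator A x *\<^sub>R c) t \<le> ennreal e"
proof -
  \<comment> \<open>Each of the two copies of U - K has measure at most 2 e', whence the 4; adding 1
    avoids division by 0 when c = 0.\<close>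
  define e' where "e' = e / (4 * (\<bar>c\<bar> + 1))"
  have e': "0 < e'" using e by (simp add: e'_def)
  obtain K where K: "compact K" "K \<subseteq> A" "emeasure lborel (A - K) < ennreal e'"
    using compact_subset_emeasure_approx[OF A fin e'] by blast
  obtain U where U: "open U" "A \<subseteq> U" "emeasure lborel (U - A) < ennreal e'"
    using outer_regular_lborel[OF A e'] by blast
  have [measurable]: "K \<in> sets borel" "U \<in> sets borel" using K U by (auto simp: borel_compact)
  obtain d where d: "0 < d" "(\<Union>x\<in>K. ball x d) \<subseteq> U"
    using compact_subset_open_imp_ball_epsilon_subset[OF K(1) U(1)] K U by blast
  have UK: "emeasure lborel (U - K) \<le> ennreal (2 * e')"
  proof -
    have "emeasure lborel (U - K) \<le> emeasure lborel ((U - A) \<union> (A - K))" by (intro emeasure_mono) auto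
    also have "\<dots> \<le> emeasure lborel (U - A) + emeasure lborel (A - K)" by (intro emeasure_subadditive) auto
    also have "\<dots> \<le> ennreal e' + ennreal e'" using K U by (intro add_mono) auto
    finally show ?thesis using e' by (simp add: ennreal_plus[symmetric] del: ennreal_plus)
  qed
  have "transl_dist (\<lambda>x. indicator A x *\<^sub>R c) t \<le> ennreal e" if t: "norm t < d" for t
  proof -
    have pt: "ennreal \<bar>indicator A (x - t) *\<^sub>R c - indicator A x *\<^sub>R c\<bar> \<le> ennreal \<bar>c\<bar> * (indicator (U - K) (x - t) + indicator (U - K) x)" for x
    proof -
      have 1: "x \<in> U" if "x - t \<in> K"
      proof -
        have "x \<in> ball (x - t) d" using t by (simp add: dist_norm)
        then show ?thesis using d that by blast
      qed
      have 2: "x - t \<in> U" if "x \<in> K"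
      proof -
        have "x - t \<in> ball x d" using t by (simp add: dist_norm)
        then show ?thesis using d that by blast
      qed
      show ?thesis
      proof (cases "x - t \<in> A \<longleftrightarrow> x \<in> A")
        case False
        then have "x - t \<in> U - K \<or> x \<in> U - K" using 1 2 K U by blast
        then show ?thesis using False by (auto split: split_indicator simp: mult_2_right)
      qed (auto split: split_indicator)
    qed
    have "transl_dist (\<lambda>x. indicator A x *\<^sub>R c) t \<le> (\<integral>\<^sup>+x. ennreal \<bar>c\<bar> * (indicator (U - K) (x - t) + indicator (U - K) x) \<partial>lborel)"
      unfolding transl_dist_def by (intro nn_integral_mono pt)
    also have "\<dots> = ennreal \<bar>c\<bar> * ((\<integral>\<^sup>+x. indicator (U - K) (x - t) \<partial>lborel) + (\<integral>\<^sup>+x. indicator (U - K) x \<partial>lborel))"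
      by (subst nn_integral_cmult, measurable) (subst nn_integral_add, auto)
    also have "(\<integral>\<^sup>+x. indicator (U - K) (x - t) \<partial>lborel) = (\<integral>\<^sup>+x. indicator (U - K) x \<partial>lborel)"
      by (rule nn_integral_lborel_shift[of "indicator (U - K)"]) auto
    also have "(\<integral>\<^sup>+x. indicator (U - K) x \<partial>lborel) = emeasure lborel (U - K)" by simp
    also have "ennreal \<bar>c\<bar> * (emeasure lborel (U - K) + emeasure lborel (U - K)) \<le> ennreal \<bar>c\<bar> * (ennreal (2 * e') + ennreal (2 * e'))"
      by (intro mult_left_mono add_mono UK) auto
    also have "\<dots> = ennreal (\<bar>c\<bar> * (4 * e'))" using e' by (simp add: ennreal_plus[symmetric] ennreal_mult[symmetric] del: ennreal_plus)
    also have "\<dots> \<le> ennreal e" using e by (intro ennreal_leI) (simp add: e'_def divide_le_eq algebra_simps)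
    finally show ?thesis .
  qed
  then show ?thesis using d by blast
qed

lemma transl_dist_tendsto_0:
  fixes h :: "'a::euclidean_space \<Rightarrow> real"
  assumes h: "integrable lborel h" and e: "0 < (e::real)"
  shows "\<exists>d>0. \<forall>t. norm t < d \<longrightarrow> transl_dist h t \<le> ennreal e"
  using h e
proof (induction h arbitrary: e rule: integrable_induct)
  case (base A c)
  then show ?case by (intro transl_dist_indicator) auto
next
  case (add f g)
  obtain d1 where d1: "0 < d1" "\<And>t. norm t < d1 \<Longrightarrow> transl_dist f t \<le> ennreal (e / 2)"
    using add.IH(1)[of "e / 2"] add.prems by auto
  obtain d2 where d2: "0 < d2" "\<And>t. norm t < d2 \<Longrightarrow> transl_dist g t \<le> ennreal (e / 2)"
    using add.IH(2)[of "e / 2"] add.prems by auto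
  show ?case
  proof (intro exI[of _ "min d1 d2"] conjI allI impI)
    fix t :: 'a assume "norm t < min d1 d2"
    then have "transl_dist f t + transl_dist g t \<le> ennreal (e / 2) + ennreal (e / 2)"
      using d1 d2 by (intro add_mono) auto
    also have "\<dots> = ennreal e" using add.prems by (subst ennreal_plus[symmetric]) auto
    finally show "transl_dist (\<lambda>x. f x + g x) t \<le> ennreal e"
      using transl_dist_add[of f g t] add.hyps by (auto intro: order_trans)
  qed (use d1 d2 in auto)
next
  case (lim f s)
  have [measurable]: "f \<in> borel_measurable borel" "s i \<in> borel_measurable borel" for i using lim.hyps by auto
  have "(\<lambda>i. \<integral>\<^sup>+x. norm (f x - s i x) \<partial>lborel) \<longlonglongrightarrow> 0"
    by (rule nn_integral_dominated_convergence_norm[where w="\<lambda>x. 2 * norm (f x)"])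
      (use lim.hyps in \<open>auto simp: integrable_iff_bounded ennreal_mult'' ennreal_mult_less_top nn_integral_cmult\<close>)
  then have "\<forall>\<^sub>F i in sequentially. (\<integral>\<^sup>+x. norm (f x - s i x) \<partial>lborel) < ennreal (e / 4)"
    using lim.prems by (intro order_tendstoD) auto
  then obtain i where i: "(\<integral>\<^sup>+x. norm (f x - s i x) \<partial>lborel) < ennreal (e / 4)"
    by (auto simp: eventually_sequentially)
  obtain d where d: "0 < d" "\<And>t. norm t < d \<Longrightarrow> transl_dist (s i) t \<le> ennreal (e / 2)"
    using lim.IH[of "e / 2" i] lim.prems by auto
  show ?case
  proof (intro exI[of _ d] conjI allI impI)
    fix t :: 'a assume t: "norm t < d"
    have "transl_dist f t \<le> transl_dist (s i) t + 2 * (\<integral>\<^sup>+x. ennreal \<bar>f x - s i x\<bar> \<partial>lborel)"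
      by (rule transl_dist_triangle) auto
    also have "\<dots> \<le> ennreal (e / 2) + 2 * ennreal (e / 4)"
      using d(2)[OF t] i by (intro add_mono mult_left_mono) auto
    also have "2 * ennreal (e / 4) = ennreal (e / 2)"
      using lim.prems by (simp add: mult_2 ennreal_plus[symmetric] del: ennreal_plus)
    also have "ennreal (e / 2) + ennreal (e / 2) = ennreal e" using lim.prems by (subst ennreal_plus[symmetric]) auto
    finally show "transl_dist f t \<le> ennreal e" .
  qed (use d in auto)
qed

section \<open>Convolution with a smooth probability kernel\<close>

lemma integrable_kernel:
  fixes h :: "'a::euclidean_space \<Rightarrow> 'b::euclidean_space" and k :: "'a \<Rightarrow> real"
  assumes h: "locally_integrable h" and [measurable]: "h \<in> borel_measurable borel" "k \<in> borel_measurable borel"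
    and K: "\<And>y. \<bar>k y\<bar> \<le> K" and supp: "\<And>y. R \<le> norm (y - a) \<Longrightarrow> k y = 0"
  shows "integrable lborel (\<lambda>y. k y *\<^sub>R h y)"
proof -
  have "set_integrable lborel (cball a R) h" using h by (auto simp: locally_integrable_def)
  then have "integrable lborel (\<lambda>y. K *\<^sub>R (indicator (cball a R) y *\<^sub>R h y))"
    unfolding set_integrable_def by (rule integrable_scaleR_right)
  then show ?thesis
  proof (rule Bochner_Integration.integrable_bound)
    show "AE y in lborel. norm (k y *\<^sub>R h y) \<le> norm (K *\<^sub>R (indicator (cball a R) y *\<^sub>R h y))"
    proof (rule AE_I2)
      fix y
      have "\<bar>k y\<bar> \<le> \<bar>K\<bar>" using K[of y] by linarith
      moreover have "k y = 0" if "y \<notin> cball a R" using that supp[of y] by (auto simp: dist_norm norm_minus_commute)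
      ultimately show "norm (k y *\<^sub>R h y) \<le> norm (K *\<^sub>R (indicator (cball a R) y *\<^sub>R h y))"
        by (cases "y \<in> cball a R") (auto simp: mult_right_mono)
    qed
  qed measurable
qed

lemma locally_integrable_bounded:
  fixes h :: "'a::euclidean_space \<Rightarrow> 'b::euclidean_space"
  assumes [measurable]: "h \<in> borel_measurable borel" and B: "\<And>x. norm (h x) \<le> B"
  shows "locally_integrable h"
  unfolding locally_integrable_def set_integrable_def
proof (intro allI impI)
  fix S :: "'a set" assume S: "compact S"
  have [measurable]: "S \<in> sets borel" using S by (simp add: borel_compact)
  have B0: "0 \<le> B" using order_trans[OF norm_ge_zero B] .
  show "integrable lborel (\<lambda>x. indicator S x *\<^sub>R h x)"
  proof (rule Bochner_Integration.integrable_bound)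
    show "integrable lborel (\<lambda>x. B * indicator S x)"
      using emeasure_bounded_finite[OF compact_imp_bounded[OF S]] by (intro integrable_mult_right integrable_real_indicator) auto
    show "AE x in lborel. norm (indicator S x *\<^sub>R h x) \<le> norm (B * indicator S x)"
      using B B0 by (intro AE_I2) (auto split: split_indicator)
  qed measurable
qed

locale mollifier =
  fixes d :: real and dummy :: "'n::finite itself"
  assumes d: "0 < d"
begin

definition "mass = integral\<^sup>L lborel (bump 0 d (0 :: real ^ 'n))"

definition eta :: "real ^ 'n \<Rightarrow> real" where "eta z = bump 0 d 0 z / mass"

lemma bump_meas[measurable]: "bump m d a \<in> borel_measurable borel"
  by (rule borel_measurable_continuous_onI[OF bump_continuous])

lemma bump_zero: "d \<le> norm (y - a) \<Longrightarrow> bump m d a y = 0"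
  using d by (intro bump_outside) auto

lemma bump_bounded: "\<exists>K>0. \<forall>y. \<bar>bump m d a y\<bar> \<le> K"
  by (rule continuous_zero_outside_bounded[OF bump_continuous bump_zero])

lemma bump_integrable: "integrable lborel (bump m d (a :: real ^ 'n))"
proof -
  obtain K where K: "\<And>y. \<bar>bump m d a y\<bar> \<le> K" using bump_bounded by blast
  have "locally_integrable (\<lambda>_::real ^ 'n. 1::real)" by (rule locally_integrable_bounded[where B=1]) auto
  then have "integrable lborel (\<lambda>y. bump m d a y *\<^sub>R (1::real))"
    by (rule integrable_kernel[where K=K and R=d and a=a]) (use K bump_zero in auto)
  then show ?thesis by simp
qed

lemma mass_pos: "0 < mass"
proof -
  have "mass \<noteq> 0"
  proof
    assume "mass = 0"
    then have "AE y in lborel. bump 0 d (0 :: real ^ 'n) y = 0"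
      unfolding mass_def by (subst (asm) integral_nonneg_eq_0_iff_AE) (auto intro: bump_integrable bump_nonneg)
    then have "AE y in lborel. y \<notin> ball (0 :: real ^ 'n) d"
    proof eventually_elim
      case (elim y)
      show ?case
      proof
        assume "y \<in> ball 0 d"
        then have "(norm y)\<^sup>2 < d\<^sup>2" by (intro power_strict_mono) auto
        then have "0 < bump 0 d 0 y" unfolding bump_def by (intro flat_pos) (simp add: power2_norm_eq_inner)
        with elim show False by simp
      qed
    qed
    then have "emeasure lborel (ball (0 :: real ^ 'n) d) = 0"
      by (subst (asm) AE_iff_null_sets[symmetric]) (auto simp: null_sets_def)
    moreover have "0 < unit_ball_vol (real CARD('n)) * d ^ CARD('n)" using d by simp
    ultimately show False using d by (simp add: emeasure_ball ennreal_eq_0_iff)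
  qed
  moreover have "0 \<le> mass" unfolding mass_def by (intro integral_nonneg_AE) (auto simp: bump_nonneg)
  ultimately show ?thesis by simp
qed

lemma eta_nonneg: "0 \<le> eta z" using mass_pos by (simp add: eta_def bump_nonneg)

lemma eta_cont: "continuous_on UNIV eta"
  unfolding eta_def[abs_def] using mass_pos by (intro continuous_intros bump_continuous) auto

lemma eta_meas[measurable]: "eta \<in> borel_measurable borel"
  by (rule borel_measurable_continuous_onI[OF eta_cont])

lemma eta_zero: "d \<le> norm z \<Longrightarrow> eta z = 0"
  using bump_zero[of z 0] by (simp add: eta_def)

lemma eta_bounded: "\<exists>K>0. \<forall>y. eta y \<le> K"
proof -
  have "\<exists>K>0. \<forall>y. \<bar>eta y\<bar> \<le> K"
    by (rule continuous_zero_outside_bounded[OF eta_cont, where R=d and a=0]) (simp add: eta_zero)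
  then show ?thesis by (meson abs_le_D1)
qed

lemma eta_prob: "(\<integral>\<^sup>+z. ennreal (eta z) \<partial>lborel) = 1"
proof -
  have "(\<integral>\<^sup>+z. ennreal (eta z) \<partial>lborel) = ennreal (integral\<^sup>L lborel eta)"
    unfolding eta_def[abs_def] using mass_pos
    by (intro nn_integral_eq_integral) (auto intro!: bump_integrable integrable_divide simp: bump_nonneg)
  also have "integral\<^sup>L lborel eta = 1"
    unfolding eta_def[abs_def] using mass_pos by (simp add: mass_def)
  finally show ?thesis by simp
qed

lemma eta_prob_shift: "(\<integral>\<^sup>+y. ennreal (eta (x - y)) \<partial>lborel) = 1"
  using nn_integral_lborel_reflect[of "\<lambda>z. ennreal (eta z)" x] by (simp add: eta_prob)

lemma eta_prob_shift_left: "(\<integral>\<^sup>+x. ennreal (eta (x - y)) \<partial>lborel) = 1"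
  using nn_integral_lborel_shift[of "\<lambda>z. ennreal (eta z)" y] by (simp add: eta_prob)

definition conv :: "(real ^ 'n \<Rightarrow> 'b::euclidean_space) \<Rightarrow> real ^ 'n \<Rightarrow> 'b" where
  "conv h x = (\<integral>y. eta (x - y) *\<^sub>R h y \<partial>lborel)"

lemma conv_meas[measurable]:
  assumes [measurable]: "h \<in> borel_measurable borel"
  shows "conv h \<in> borel_measurable borel"
  unfolding conv_def[abs_def] by measurable

lemma conv_integrable:
  fixes h :: "real ^ 'n \<Rightarrow> 'b::euclidean_space"
  assumes "locally_integrable h" "h \<in> borel_measurable borel"
  shows "integrable lborel (\<lambda>y. eta (x - y) *\<^sub>R h y)"
proof -
  obtain K where K: "\<And>y. eta y \<le> K" using eta_bounded by blast
  show ?thesis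
    by (rule integrable_kernel[where K=K and R=d and a=x, OF assms])
      (use K eta_nonneg eta_zero in \<open>auto simp: norm_minus_commute\<close>)
qed

lemma conv_continuous:
  fixes h :: "real ^ 'n \<Rightarrow> real"
  assumes h: "locally_integrable h" and [measurable]: "h \<in> borel_measurable borel"
  shows "continuous_on UNIV (conv h)"
  unfolding continuous_on_sequentially
proof (intro ballI allI impI, elim conjE)
  fix X :: "nat \<Rightarrow> real ^ 'n" and a assume X: "X \<longlonglongrightarrow> a"
  obtain K where K: "0 < K" "\<And>y. eta y \<le> K" using eta_bounded by blast
  have "bounded (range X)" using X by (intro convergent_imp_bounded) (auto simp: convergent_def)
  then obtain R where R: "\<And>n. norm (X n) \<le> R" by (auto simp: bounded_iff)
  have int: "integrable lborel (\<lambda>y. K *\<^sub>R (indicator (cball 0 (R + d)) y *\<^sub>R norm (h y)))"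
  proof -
    have "set_integrable lborel (cball 0 (R + d)) h" using h by (auto simp: locally_integrable_def)
    then have "integrable lborel (\<lambda>y. norm (indicator (cball 0 (R + d)) y *\<^sub>R h y))"
      unfolding set_integrable_def by (rule integrable_norm)
    then have "integrable lborel (\<lambda>y. indicator (cball 0 (R + d)) y *\<^sub>R norm (h y))"
      by (simp add: abs_mult)
    then show ?thesis by (rule integrable_scaleR_right)
  qed
  have "(\<lambda>n. \<integral>y. eta (X n - y) *\<^sub>R h y \<partial>lborel) \<longlonglongrightarrow> (\<integral>y. eta (a - y) *\<^sub>R h y \<partial>lborel)"
  proof (rule integral_dominated_convergence[OF _ _ int])
    show "AE y in lborel. (\<lambda>n. eta (X n - y) *\<^sub>R h y) \<longlonglongrightarrow> eta (a - y) *\<^sub>R h y"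
    proof (rule AE_I2)
      fix y
      have "isCont eta (a - y)" using eta_cont by (simp add: continuous_on_eq_continuous_at)
      then have "(\<lambda>n. eta (X n - y)) \<longlonglongrightarrow> eta (a - y)"
        by (rule isCont_tendsto_compose) (intro tendsto_intros X)
      then show "(\<lambda>n. eta (X n - y) *\<^sub>R h y) \<longlonglongrightarrow> eta (a - y) *\<^sub>R h y" by (intro tendsto_intros)
    qed
    show "AE y in lborel. norm (eta (X n - y) *\<^sub>R h y) \<le> K *\<^sub>R (indicator (cball 0 (R + d)) y *\<^sub>R norm (h y))" for n
    proof (rule AE_I2)
      fix y
      show "norm (eta (X n - y) *\<^sub>R h y) \<le> K *\<^sub>R (indicator (cball 0 (R + d)) y *\<^sub>R norm (h y))"
      proof (cases "y \<in> cball 0 (R + d)")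
        case True
        then show ?thesis using K(2)[of "X n - y"] eta_nonneg[of "X n - y"] by (simp add: abs_mult mult_right_mono)
      next
        case False
        have "norm y \<le> norm (X n - y) + norm (X n)" by (metis norm_minus_commute norm_triangle_sub add.commute)
        then have "d \<le> norm (X n - y)" using False R[of n] by simp
        then show ?thesis using K by (simp add: eta_zero)
      qed
    qed
  qed measurable
  then show "(conv h \<circ> X) \<longlonglongrightarrow> conv h a" by (simp add: conv_def o_def)
qed

text \<open>Jensen's inequality for the probability density eta (x - y). It is kept pointwise
  because integration in \<open>x\<close> turns it into the contraction \<open>conv_norm_le\<close>,
  and its limit along a ray gives \<open>conv_decay\<close>.\<close>

lemma norm_conv_powr_le:
  fixes h :: "real ^ 'n \<Rightarrow> 'b::euclidean_space"
  assumes [measurable]: "h \<in> borel_measurable borel" and li: "locally_integrable h"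
    and P: "1 < P" and hP: "integrable lborel (\<lambda>y. norm (h y) powr P)"
  shows "ennreal (norm (conv h x) powr P) \<le> (\<integral>\<^sup>+y. ennreal (eta (x - y) * norm (h y) powr P) \<partial>lborel)"
proof -
  obtain K where K: "0 < K" "\<And>y. eta y \<le> K" using eta_bounded by blast
  let ?J = "\<integral>\<^sup>+y. ennreal (eta (x - y) * norm (h y) powr P) \<partial>lborel"
  have "?J \<le> (\<integral>\<^sup>+y. ennreal (K * norm (h y) powr P) \<partial>lborel)"
    using K by (intro nn_integral_mono ennreal_leI mult_right_mono) auto
  also have "\<dots> < \<infinity>" using hP K by (simp add: integrable_iff_bounded ennreal_mult nn_integral_cmult ennreal_mult_less_top)
  finally obtain J where J: "?J = ennreal J" "0 \<le> J" by (cases ?J) auto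
  let ?M = "density lborel (\<lambda>y. ennreal (eta (x - y)))"
  have "ennreal (norm (conv h x)) \<le> (\<integral>\<^sup>+y. ennreal (norm (eta (x - y) *\<^sub>R h y)) \<partial>lborel)"
    unfolding conv_def by (intro integral_norm_bound_ennreal conv_integrable li) simp
  also have "\<dots> = (\<integral>\<^sup>+y. ennreal (norm (h y)) \<partial>?M)"
    by (subst nn_integral_density) (auto simp: ennreal_mult eta_nonneg intro!: nn_integral_cong)
  also have "\<dots> \<le> ennreal (J powr (1 / P))"
  proof (rule nn_integral_prob_powr_le[OF _ _ P _ _ J(2)])
    show "emeasure ?M (space ?M) = 1" by (simp add: emeasure_density eta_prob_shift)
    show "(\<integral>\<^sup>+y. ennreal (norm (h y) powr P) \<partial>?M) \<le> ennreal J"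
      unfolding J(1)[symmetric] by (subst nn_integral_density) (auto simp: ennreal_mult eta_nonneg)
  qed auto
  finally have "norm (conv h x) \<le> J powr (1 / P)" by simp
  then have "norm (conv h x) powr P \<le> (J powr (1 / P)) powr P" using P by (intro powr_mono2) auto
  then show ?thesis using P J by (simp add: powr_powr ennreal_leI)
qed

text \<open>Fubini, as the kernel has mass 1 in either variable. With the constant 1 the mollified
  gradient still has norm at most 1, so the critical exponent is not disturbed.\<close>

lemma conv_norm_le:
  fixes h :: "real ^ 'n \<Rightarrow> 'b::euclidean_space"
  assumes [measurable]: "h \<in> borel_measurable borel" and li: "locally_integrable h"
    and P: "1 < P" and hP: "integrable lborel (\<lambda>y. norm (h y) powr P)"
  shows "(\<integral>\<^sup>+x. ennreal (norm (conv h x) powr P) \<partial>lborel) \<le> (\<integral>\<^sup>+x. ennreal (norm (h x) powr P) \<partial>lborel)"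
proof -
  have "(\<integral>\<^sup>+x. ennreal (norm (conv h x) powr P) \<partial>lborel) \<le> (\<integral>\<^sup>+x. \<integral>\<^sup>+y. ennreal (eta (x - y) * norm (h y) powr P) \<partial>lborel \<partial>lborel)"
    by (intro nn_integral_mono norm_conv_powr_le li P hP) auto
  also have "\<dots> = (\<integral>\<^sup>+y. \<integral>\<^sup>+x. ennreal (eta (x - y) * norm (h y) powr P) \<partial>lborel \<partial>lborel)"
    by (rule lborel_pair.Fubini') measurable
  also have "\<dots> = (\<integral>\<^sup>+y. ennreal (norm (h y) powr P) * (\<integral>\<^sup>+x. ennreal (eta (x - y)) \<partial>lborel) \<partial>lborel)"
    by (intro nn_integral_cong, subst nn_integral_cmult[symmetric]) (auto simp: ennreal_mult eta_nonneg mult.commute)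
  finally show ?thesis by (simp add: eta_prob_shift_left)
qed

text \<open>Supplies the exit point on every ray: the support of the kernel travels to infinity
  along the ray, and dominated convergence with the bound K |h|^P makes the average of |h|^P
  vanish.\<close>

lemma conv_decay:
  fixes h :: "real ^ 'n \<Rightarrow> real"
  assumes [measurable]: "h \<in> borel_measurable borel" and li: "locally_integrable h"
    and P: "1 < P" and hP: "integrable lborel (\<lambda>y. norm (h y) powr P)" and z: "z \<noteq> 0" and th: "0 < th"
  shows "\<exists>R\<ge>0. \<bar>conv h (x + R *\<^sub>R z)\<bar> \<le> th"
proof -
  obtain K where K: "0 < K" "\<And>y. eta y \<le> K" using eta_bounded by blast
  have "(\<lambda>i. \<integral>\<^sup>+y. ennreal (eta (x + real i *\<^sub>R z - y) * norm (h y) powr P) \<partial>lborel) \<longlonglongrightarrow> (\<integral>\<^sup>+y. 0 \<partial>(lborel :: (real ^ 'n) measure))"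
  proof (rule nn_integral_dominated_convergence[where w="\<lambda>y. ennreal (K * norm (h y) powr P)"])
    show "AE y in lborel. ennreal (eta (x + real i *\<^sub>R z - y) * norm (h y) powr P) \<le> ennreal (K * norm (h y) powr P)" for i
      using K by (intro AE_I2 ennreal_leI mult_right_mono) auto
    show "(\<integral>\<^sup>+y. ennreal (K * norm (h y) powr P) \<partial>lborel) < \<infinity>"
      using hP K by (simp add: integrable_iff_bounded ennreal_mult nn_integral_cmult ennreal_mult_less_top)
    show "AE y in lborel. (\<lambda>i. ennreal (eta (x + real i *\<^sub>R z - y) * norm (h y) powr P)) \<longlonglongrightarrow> 0"
    proof (rule AE_I2)
      fix y
      have "\<forall>\<^sub>F i in sequentially. (norm (x - y) + d) / norm z \<le> real i"
        by (rule eventually_sequentiallyI[of "nat \<lceil>(norm (x - y) + d) / norm z\<rceil>"]) linarith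
      then have "\<forall>\<^sub>F i in sequentially. ennreal (eta (x + real i *\<^sub>R z - y) * norm (h y) powr P) = 0"
      proof eventually_elim
        case (elim i)
        then have "norm (x - y) + d \<le> norm (real i *\<^sub>R z)" using z by (simp add: divide_le_eq)
        also have "\<dots> \<le> norm (x + real i *\<^sub>R z - y) + norm (x - y)"
          using norm_triangle_ineq4[of "x + real i *\<^sub>R z - y" "x - y"] by (simp add: algebra_simps)
        finally have "d \<le> norm (x + real i *\<^sub>R z - y)" by simp
        then show ?case by (simp add: eta_zero)
      qed
      then show "(\<lambda>i. ennreal (eta (x + real i *\<^sub>R z - y) * norm (h y) powr P)) \<longlonglongrightarrow> 0"
        by (rule tendsto_eventually)
    qed
  qed auto
  then have "\<forall>\<^sub>F i in sequentially. (\<integral>\<^sup>+y. ennreal (eta (x + real i *\<^sub>R z - y) * norm (h y) powr P) \<partial>lborel) < ennreal (th powr P)"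
    using th by (intro order_tendstoD) auto
  then obtain i where "(\<integral>\<^sup>+y. ennreal (eta (x + real i *\<^sub>R z - y) * norm (h y) powr P) \<partial>lborel) < ennreal (th powr P)"
    by (auto simp: eventually_sequentially)
  with norm_conv_powr_le[OF assms(1,2,3,4), of "x + real i *\<^sub>R z"]
  have "ennreal (norm (conv h (x + real i *\<^sub>R z)) powr P) < ennreal (th powr P)" by simp
  then have "norm (conv h (x + real i *\<^sub>R z)) powr P < th powr P" by (simp add: ennreal_less_iff)
  then have "norm (conv h (x + real i *\<^sub>R z)) < th"
    using P th powr_mono2[of P th "norm (conv h (x + real i *\<^sub>R z))"] by force
  then show ?thesis by (intro exI[of _ "real i"]) auto
qed

text \<open>The error is an average of translation distances over shifts shorter than
  \<open>d\<close>.\<close>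

lemma conv_dist_le:
  fixes h :: "real ^ 'n \<Rightarrow> real"
  assumes h: "integrable lborel h" and T: "\<And>t. norm t < d \<Longrightarrow> transl_dist h t \<le> ennreal e"
  shows "(\<integral>\<^sup>+x. ennreal \<bar>conv h x - h x\<bar> \<partial>lborel) \<le> ennreal e"
proof -
  have [measurable]: "h \<in> borel_measurable borel" using h by auto
  have li: "locally_integrable h"
    unfolding locally_integrable_def set_integrable_def
    by (intro allI impI integrable_mult_indicator h) (simp add: borel_compact)
  have pt: "ennreal \<bar>conv h x - h x\<bar> \<le> (\<integral>\<^sup>+z. ennreal (eta z) * ennreal \<bar>h (x - z) - h x\<bar> \<partial>lborel)" for x
  proof -
    have ie: "integrable lborel (\<lambda>y. eta (x - y))"
      by (rule integrableI_nonneg) (auto simp: eta_nonneg eta_prob_shift)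
    have "(\<integral>y. eta (x - y) \<partial>lborel) = 1"
      using nn_integral_eq_integral[OF ie] by (simp add: eta_nonneg eta_prob_shift)
    then have "conv h x - h x = (\<integral>y. eta (x - y) *\<^sub>R h y \<partial>lborel) - (\<integral>y. eta (x - y) *\<^sub>R h x \<partial>lborel)"
      by (simp add: conv_def)
    also have "\<dots> = (\<integral>y. eta (x - y) *\<^sub>R h y - eta (x - y) *\<^sub>R h x \<partial>lborel)"
      by (rule Bochner_Integration.integral_diff[symmetric]) (use conv_integrable[OF li] ie in auto)
    finally have "ennreal \<bar>conv h x - h x\<bar> \<le> (\<integral>\<^sup>+y. ennreal (norm (eta (x - y) *\<^sub>R h y - eta (x - y) *\<^sub>R h x)) \<partial>lborel)"
      using integral_norm_bound_ennreal[of lborel "\<lambda>y. eta (x - y) *\<^sub>R h y - eta (x - y) *\<^sub>R h x"] conv_integrable[OF li] ie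
      by auto
    also have "\<dots> = (\<integral>\<^sup>+y. (\<lambda>z. ennreal (eta z) * ennreal \<bar>h (x - z) - h x\<bar>) (x - y) \<partial>lborel)"
    proof (rule nn_integral_cong)
      fix y
      have "norm (eta (x - y) *\<^sub>R h y - eta (x - y) *\<^sub>R h x) = eta (x - y) * \<bar>h y - h x\<bar>"
        using eta_nonneg[of "x - y"] by (simp add: right_diff_distrib[symmetric] abs_mult)
      then show "ennreal (norm (eta (x - y) *\<^sub>R h y - eta (x - y) *\<^sub>R h x)) = (\<lambda>z. ennreal (eta z) * ennreal \<bar>h (x - z) - h x\<bar>) (x - y)"
        by (simp add: ennreal_mult eta_nonneg)
    qed
    also have "\<dots> = (\<integral>\<^sup>+z. ennreal (eta z) * ennreal \<bar>h (x - z) - h x\<bar> \<partial>lborel)"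
      by (rule nn_integral_lborel_reflect) measurable
    finally show ?thesis .
  qed
  have "(\<integral>\<^sup>+x. ennreal \<bar>conv h x - h x\<bar> \<partial>lborel) \<le> (\<integral>\<^sup>+x. \<integral>\<^sup>+z. ennreal (eta z) * ennreal \<bar>h (x - z) - h x\<bar> \<partial>lborel \<partial>lborel)"
    by (intro nn_integral_mono pt)
  also have "\<dots> = (\<integral>\<^sup>+z. \<integral>\<^sup>+x. ennreal (eta z) * ennreal \<bar>h (x - z) - h x\<bar> \<partial>lborel \<partial>lborel)"
    by (rule lborel_pair.Fubini') measurable
  also have "\<dots> = (\<integral>\<^sup>+z. ennreal (eta z) * transl_dist h z \<partial>lborel)"
    unfolding transl_dist_def by (intro nn_integral_cong nn_integral_cmult) measurable
  also have "\<dots> \<le> (\<integral>\<^sup>+z. ennreal (eta z) * ennreal e \<partial>lborel)"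
  proof (rule nn_integral_mono)
    fix z
    show "ennreal (eta z) * transl_dist h z \<le> ennreal (eta z) * ennreal e"
      using T[of z] eta_zero[of z] by (cases "norm z < d") (auto intro: mult_left_mono)
  qed
  also have "\<dots> = ennreal e" by (subst nn_integral_multc) (auto simp: eta_prob)
  finally show ?thesis .
qed

text \<open>The kernel, not the convolution, is differentiated along the segment: Fubini exchanges
  the integrals over \<open>r\<close> and \<open>y\<close>, and for each fixed \<open>r\<close> the
  weak gradient identity is tested with a bump centred at the point x + r z.\<close>

lemma conv_line:
  fixes u :: "real ^ 'n \<Rightarrow> real"
  assumes [measurable]: "u \<in> borel_measurable borel" "g \<in> borel_measurable borel"
    and grad: "has_weak_gradient u g" and R: "0 \<le> R"
  shows "ennreal \<bar>conv u (x + R *\<^sub>R z) - conv u x\<bar> \<le> (\<integral>\<^sup>+r. indicator {0..R} r * ennreal (norm (conv g (x + r *\<^sub>R z)) * norm z) \<partial>lborel)"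
proof -
  have li: "locally_integrable u" "locally_integrable g" using grad by (auto simp: has_weak_gradient_def)
  \<comment> \<open>The derivative of eta (x + r z - y) in \<open>r\<close>. The index is 2 because
    for m = 0 the second term in the derivative of a bump vanishes.\<close>
  define D where "D r y = bump 2 d 0 (x + r *\<^sub>R z - y) * (-2 * ((x + r *\<^sub>R z - y) \<bullet> z)) / mass" for r y
  have [measurable]: "(\<lambda>(r, y). D r y) \<in> borel_measurable (borel \<Otimes>\<^sub>M borel)"
    unfolding D_def by measurable
  have deriv: "DERIV (\<lambda>r. eta (x + r *\<^sub>R z - y)) r :> D r y" for r y
  proof -
    have "((\<lambda>r. x + r *\<^sub>R z - y) has_derivative (\<lambda>h. h *\<^sub>R z)) (at r)"
      by (auto intro!: derivative_eq_intros)
    from diff_chain_at[OF this bump_has_derivative[of 0 d 0]]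
    have "((\<lambda>r. bump 0 d 0 (x + r *\<^sub>R z - y)) has_derivative (\<lambda>h. bump 2 d 0 (x + r *\<^sub>R z - y) * (-2 * ((x + r *\<^sub>R z - y) \<bullet> (h *\<^sub>R z))))) (at r)"
      by (simp add: o_def numeral_2_eq_2)
    then have "DERIV (\<lambda>r. bump 0 d 0 (x + r *\<^sub>R z - y)) r :> bump 2 d 0 (x + r *\<^sub>R z - y) * (-2 * ((x + r *\<^sub>R z - y) \<bullet> z))"
      unfolding has_field_derivative_def by (rule has_derivative_eq_rhs) (auto simp: mult_ac)
    then show ?thesis unfolding eta_def D_def by (rule DERIV_cdivide)
  qed
  have D_cont: "continuous_on UNIV (\<lambda>r. D r y)" for y
    unfolding D_def using mass_pos
    by (intro continuous_intros continuous_on_compose2[OF bump_continuous]) auto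
  have ftc: "(\<integral>r. D r y * indicator {0..R} r \<partial>lborel) = eta (x + R *\<^sub>R z - y) - eta (x - y)" for y
    using integral_FTC_Icc_real[OF R deriv] D_cont by (simp add: continuous_on_eq_continuous_at)
  have D_bound: "\<exists>K>0. \<forall>r y. \<bar>D r y\<bar> \<le> K"
  proof -
    have "\<exists>K>0. \<forall>v. \<bar>bump 2 d 0 v * (-2 * (v \<bullet> z)) / mass\<bar> \<le> K"
      using mass_pos by (intro continuous_zero_outside_bounded[where R=d and a=0] continuous_intros bump_continuous) (auto simp: bump_zero)
    then show ?thesis unfolding D_def by blast
  qed
  then obtain K where K: "0 < K" "\<And>r y. \<bar>D r y\<bar> \<le> K" by blast
  define S where "S = norm x + R * norm z + d"
  have D_zero: "D r y = 0" if "0 \<le> r" "r \<le> R" "S \<le> norm y" for r y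
  proof -
    have "norm y \<le> norm (x + r *\<^sub>R z - y) + norm (x + r *\<^sub>R z)" by (metis norm_minus_commute norm_triangle_sub add.commute)
    moreover have "norm (x + r *\<^sub>R z) \<le> norm x + R * norm z"
      using that by (intro order_trans[OF norm_triangle_ineq] add_left_mono) (simp add: mult_right_mono)
    ultimately have "d \<le> norm (x + r *\<^sub>R z - y)" using that by (simp add: S_def)
    then show ?thesis unfolding D_def by (simp add: bump_zero)
  qed
  have int: "integrable (lborel \<Otimes>\<^sub>M lborel) (case_prod (\<lambda>r y. indicator {0..R} r * D r y * u y))"
  proof (rule integrableI_bounded)
    show "case_prod (\<lambda>r y. indicator {0..R} r * D r y * u y) \<in> borel_measurable (lborel \<Otimes>\<^sub>M lborel)" by measurable
    have [measurable]: "cball (0 :: real ^ 'n) S \<in> sets borel" by (simp add: borel_closed)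
    have iu: "(\<integral>\<^sup>+y. ennreal (indicator (cball 0 S) y * \<bar>u y\<bar>) \<partial>lborel) < \<infinity>"
    proof -
      have "set_integrable lborel (cball 0 S) u" using li by (auto simp: locally_integrable_def)
      then show ?thesis unfolding set_integrable_def integrable_iff_bounded by (simp add: abs_mult)
    qed
    have "(\<integral>\<^sup>+p. ennreal (norm (case_prod (\<lambda>r y. indicator {0..R} r * D r y * u y) p)) \<partial>(lborel \<Otimes>\<^sub>M lborel))
      = (\<integral>\<^sup>+r. \<integral>\<^sup>+y. ennreal (norm (indicator {0..R} r * D r y * u y)) \<partial>lborel \<partial>lborel)"
      by (subst lborel.nn_integral_fst[symmetric]) auto
    also have "\<dots> \<le> (\<integral>\<^sup>+r. \<integral>\<^sup>+y. (ennreal K * indicator {0..R} r) * ennreal (indicator (cball 0 S) y * \<bar>u y\<bar>) \<partial>lborel \<partial>lborel)"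
    proof (intro nn_integral_mono)
      fix r y
      show "ennreal (norm (indicator {0..R} r * D r y * u y)) \<le> (ennreal K * indicator {0..R} r) * ennreal (indicator (cball 0 S) y * \<bar>u y\<bar>)"
        using K(2)[of r y] D_zero[of r y] K(1)
        by (cases "0 \<le> r \<and> r \<le> R"; cases "norm y \<le> S")
          (auto simp: abs_mult ennreal_mult[symmetric] mult_right_mono intro!: ennreal_leI)
    qed
    also have "\<dots> = (\<integral>\<^sup>+r. (ennreal K * indicator {0..R} r) * (\<integral>\<^sup>+y. ennreal (indicator (cball 0 S) y * \<bar>u y\<bar>) \<partial>lborel) \<partial>lborel)"
      by (intro nn_integral_cong, subst nn_integral_cmult) auto
    also have "\<dots> = (ennreal K * ennreal R) * (\<integral>\<^sup>+y. ennreal (indicator (cball 0 S) y * \<bar>u y\<bar>) \<partial>lborel)"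
      using R by (subst nn_integral_multc) (auto simp: nn_integral_cmult)
    also have "\<dots> < \<infinity>" using iu by (auto simp: ennreal_mult_less_top)
    finally show "(\<integral>\<^sup>+p. ennreal (norm (case_prod (\<lambda>r y. indicator {0..R} r * D r y * u y) p)) \<partial>(lborel \<Otimes>\<^sub>M lborel)) < \<infinity>" .
  qed
  have inner: "(\<integral>y. D r y * u y \<partial>lborel) = conv g (x + r *\<^sub>R z) \<bullet> z" for r
  proof -
    define a where "a = x + r *\<^sub>R z"
    have tf: "test_function (bump 0 d a)" using d by (intro test_function_bump) auto
    have ig: "integrable lborel (\<lambda>y. eta (a - y) *\<^sub>R g y)" by (rule conv_integrable[OF li(2)]) simp
    have pd_cont: "continuous_on UNIV (partial_deriv i (bump 0 d a))" for i
      using C_k_bump[of "Suc 0" 0 d a] by simp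
    have pd_zero: "partial_deriv i (bump 0 d a) y = 0" if "d \<le> norm (y - a)" for i y
      using that by (simp add: bump_partial_deriv bump_zero)
    have iu: "integrable lborel (\<lambda>y. partial_deriv i (bump 0 d a) y *\<^sub>R u y)" for i
    proof -
      obtain K where "\<And>y. \<bar>partial_deriv i (bump 0 d a) y\<bar> \<le> K"
        using continuous_zero_outside_bounded[OF pd_cont pd_zero] by blast
      then show ?thesis
        by (intro integrable_kernel[where K=K and R=d and a=a] li) (auto intro: pd_zero borel_measurable_continuous_onI[OF pd_cont])
    qed
    \<comment> \<open>Differentiating in \<open>y\<close> instead of along the segment reverses the
      sign; this cancels the minus sign in the definition of the weak gradient.\<close>
    have D_eq: "D r y = (\<Sum>i\<in>UNIV. - (z $ i / mass) * partial_deriv i (bump 0 d a) y)" for y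
    proof -
      have "(\<Sum>i\<in>UNIV. - (z $ i / mass) * partial_deriv i (bump 0 d a) y)
        = (\<Sum>i\<in>UNIV. bump 2 d a y * (-2) / mass * ((a - y) $ i * z $ i))"
        by (intro sum.cong) (auto simp: bump_partial_deriv numeral_2_eq_2[symmetric] field_simps)
      also have "\<dots> = bump 2 d a y * (-2) / mass * ((a - y) \<bullet> z)"
        by (subst inner_vec_def) (simp only: sum_distrib_left inner_real_def)
      finally show ?thesis unfolding D_def a_def[symmetric] bump_swap[of 2 d a y] by simp
    qed
    have "(\<integral>y. D r y * u y \<partial>lborel) = (\<integral>y. (\<Sum>i\<in>UNIV. - (z $ i / mass) * (partial_deriv i (bump 0 d a) y *\<^sub>R u y)) \<partial>lborel)"
      unfolding D_eq by (simp only: sum_distrib_right mult.assoc real_scaleR_def)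
    also have "\<dots> = (\<Sum>i\<in>UNIV. - (z $ i / mass) * (\<integral>y. partial_deriv i (bump 0 d a) y *\<^sub>R u y \<partial>lborel))"
      using iu by (subst Bochner_Integration.integral_sum) auto
    also have "\<dots> = (\<Sum>i\<in>UNIV. (z $ i / mass) * (\<integral>y. g y $ i * bump 0 d a y \<partial>lborel))"
    proof (intro sum.cong refl)
      fix i
      have "(\<integral>y. u y * partial_deriv i (bump 0 d a) y \<partial>lborel) = - (\<integral>y. g y $ i * bump 0 d a y \<partial>lborel)"
        using grad tf by (auto simp: has_weak_gradient_def)
      then show "- (z $ i / mass) * (\<integral>y. partial_deriv i (bump 0 d a) y *\<^sub>R u y \<partial>lborel) = (z $ i / mass) * (\<integral>y. g y $ i * bump 0 d a y \<partial>lborel)"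
        by (simp add: mult.commute)
    qed
    also have "\<dots> = (\<Sum>i\<in>UNIV. conv g a $ i * z $ i)"
    proof (intro sum.cong refl)
      fix i
      have "conv g a $ i = (\<integral>y. (eta (a - y) *\<^sub>R g y) $ i \<partial>lborel)"
        unfolding conv_def using integral_bounded_linear[OF bounded_linear_vec_nth ig] by simp
      also have "\<dots> = (\<integral>y. g y $ i * bump 0 d a y / mass \<partial>lborel)"
        unfolding eta_def bump_swap[of 0 d a] by (simp add: mult_ac)
      finally show "(z $ i / mass) * (\<integral>y. g y $ i * bump 0 d a y \<partial>lborel) = conv g a $ i * z $ i" by simp
    qed
    finally show ?thesis by (simp add: inner_vec_def a_def)
  qed
  have "conv u (x + R *\<^sub>R z) - conv u x = (\<integral>y. eta (x + R *\<^sub>R z - y) *\<^sub>R u y - eta (x - y) *\<^sub>R u y \<partial>lborel)"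
    unfolding conv_def by (rule Bochner_Integration.integral_diff[symmetric]) (rule conv_integrable[OF li(1)], simp)+
  also have "\<dots> = (\<integral>y. (\<integral>r. indicator {0..R} r * D r y * u y \<partial>lborel) \<partial>lborel)"
  proof (rule Bochner_Integration.integral_cong[OF refl])
    fix y
    have "(\<integral>r. indicator {0..R} r * D r y * u y \<partial>lborel) = (\<integral>r. D r y * indicator {0..R} r \<partial>lborel) * u y"
      by (simp add: mult.commute)
    then show "eta (x + R *\<^sub>R z - y) *\<^sub>R u y - eta (x - y) *\<^sub>R u y = (\<integral>r. indicator {0..R} r * D r y * u y \<partial>lborel)"
      by (simp add: ftc left_diff_distrib)
  qed
  also have "\<dots> = (\<integral>r. (\<integral>y. indicator {0..R} r * D r y * u y \<partial>lborel) \<partial>lborel)"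
    by (rule lborel_pair.Fubini_integral[OF int])
  also have "\<dots> = (\<integral>r. indicator {0..R} r * (conv g (x + r *\<^sub>R z) \<bullet> z) \<partial>lborel)"
    unfolding inner[symmetric] by (simp add: mult.assoc)
  finally have eq: "conv u (x + R *\<^sub>R z) - conv u x = (\<integral>r. indicator {0..R} r * (conv g (x + r *\<^sub>R z) \<bullet> z) \<partial>lborel)" .
  \<comment> \<open>If the integrand is not integrable, its integral is 0 by convention and the
    bound is trivial.\<close>
  have "ennreal (norm (\<integral>r. indicator {0..R} r * (conv g (x + r *\<^sub>R z) \<bullet> z) \<partial>lborel)) \<le> (\<integral>\<^sup>+r. ennreal (norm (indicator {0..R} r * (conv g (x + r *\<^sub>R z) \<bullet> z))) \<partial>lborel)"
    by (cases "integrable lborel (\<lambda>r. indicator {0..R} r * (conv g (x + r *\<^sub>R z) \<bullet> z))")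
      (rule integral_norm_bound_ennreal, assumption, simp add: not_integrable_integral_eq)
  also have "\<dots> \<le> (\<integral>\<^sup>+r. indicator {0..R} r * ennreal (norm (conv g (x + r *\<^sub>R z)) * norm z) \<partial>lborel)"
    by (intro nn_integral_mono) (auto split: split_indicator intro!: ennreal_leI Cauchy_Schwarz_ineq2)
  finally show ?thesis by (simp add: eq)
qed

end

section \<open>The upper bound\<close>

text \<open>Lagrange's form of the remainder: phi N t = exp s * t^(N-1) / (N-1)! for some |s| \<le>
  |t|. With t a multiple of |u|^(N/(N-1)) the power N - 1 yields |u|^N, which is integrable.\<close>

lemma phi_bounds:
  assumes N: "2 \<le> N" and t: "0 \<le> t"
  shows "0 \<le> phi N t" "phi N t \<le> exp t" "phi N t \<le> exp t * t ^ (N - 1)"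
proof -
  have set: "{0..N - 2} = {..<N - 1}" using N by auto
  obtain s where s: "\<bar>s\<bar> \<le> \<bar>t\<bar>" "exp t = (\<Sum>m<N - 1. t ^ m / fact m) + exp s / fact (N - 1) * t ^ (N - 1)"
    using Maclaurin_exp_le[of t "N - 1"] by blast
  have eq: "phi N t = exp s / fact (N - 1) * t ^ (N - 1)" using s unfolding phi_def set by simp
  then show "0 \<le> phi N t" using t by simp
  have "0 \<le> (\<Sum>j=0..N - 2. t ^ j / fact j)" using t by (intro sum_nonneg) auto
  then show "phi N t \<le> exp t" by (simp add: phi_def)
  have "exp s / fact (N - 1) \<le> exp s / 1" by (intro divide_left_mono) (auto simp: fact_ge_1)
  also have "\<dots> \<le> exp t" using s(1) t by simp
  finally show "phi N t \<le> exp t * t ^ (N - 1)" unfolding eq using t by (intro mult_right_mono) auto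
qed

lemma phi_continuous: "isCont (phi N) t"
  unfolding phi_def[abs_def] by (intro continuous_intros) auto

lemma phi_meas[measurable]: "phi N \<in> borel_measurable borel"
  unfolding phi_def[abs_def] by measurable

lemma phi_ge_half_exp: "\<exists>t0>0. \<forall>t\<ge>t0. exp t / 2 \<le> phi N t"
proof -
  have "((\<lambda>t::real. \<Sum>j=0..N - 2. t ^ j / exp t / fact j) \<longlongrightarrow> (\<Sum>j=0..N - 2. 0 / fact j)) at_top"
    by (intro tendsto_sum tendsto_divide tendsto_power_div_exp_0 tendsto_const) auto
  then have "\<forall>\<^sub>F t::real in at_top. (\<Sum>j=0..N - 2. t ^ j / exp t / fact j) < 1 / 2"
    by (intro order_tendstoD) auto
  then obtain t0 where t0: "\<And>t::real. t0 \<le> t \<Longrightarrow> (\<Sum>j=0..N - 2. t ^ j / exp t / fact j) < 1 / 2"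
    by (auto simp: eventually_at_top_linorder)
  have "exp t / 2 \<le> phi N t" if "t0 \<le> t" for t
  proof -
    have "(\<Sum>j=0..N - 2. t ^ j / exp t / fact j) = (\<Sum>j=0..N - 2. t ^ j / fact j) / exp t"
      by (simp add: sum_divide_distrib divide_divide_eq_left mult.commute)
    with t0[OF that] have "(\<Sum>j=0..N - 2. t ^ j / fact j) / exp t < 1 / 2" by simp
    then have "(\<Sum>j=0..N - 2. t ^ j / fact j) < exp t / 2" by (simp add: divide_less_eq)
    then show ?thesis by (simp add: phi_def)
  qed
  then show ?thesis by (intro exI[of _ "max t0 1"]) auto
qed

text \<open>In this form the base of the power is the area of the unit sphere, the reciprocal of the
  constant in \<open>truncation_le_riesz\<close>.\<close>

lemma alpha_crit_eq: "alpha_crit N = real N * (real N * unit_ball_vol (real N)) powr (1 / (real N - 1))"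
  by (simp add: alpha_crit_def unit_ball_vol_def)

text \<open>Here \<open>w\<close> will be a mollified function and \<open>g\<close> the length of
  its mollified gradient; besides continuity, \<open>line\<close> and \<open>decay\<close> are all
  that is kept of smoothness. The factor in front of M^(n - \<beta>) involves neither w nor g, and
  \<alpha> only through the rate, so the bound passes to limits and suprema.\<close>

lemma subcritical_bound_regular:
  fixes w g :: "'a::euclidean_space \<Rightarrow> real" and \<alpha> \<beta> n b p A M :: real and N :: nat
  assumes N: "N = DIM('a)" "2 \<le> N" and n: "n = real N" and b: "b = unit_ball_vol n" and p: "p = n / (n - 1)"
    and A: "A = n * (n * b) powr (1 / (n - 1))"
    and w: "continuous_on UNIV w"
    and g[measurable]: "g \<in> borel_measurable borel" and g0: "\<And>y. 0 \<le> g y"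
    and line: "\<And>x z R. 0 \<le> R \<Longrightarrow> ennreal \<bar>w (x + R *\<^sub>R z) - w x\<bar> \<le> (\<integral>\<^sup>+r. indicator {0..R} r * ennreal (g (x + r *\<^sub>R z) * norm z) \<partial>lborel)"
    and decay: "\<And>x z th. z \<noteq> 0 \<Longrightarrow> 0 < th \<Longrightarrow> \<exists>R\<ge>0. \<bar>w (x + R *\<^sub>R z)\<bar> \<le> th"
    and gn: "(\<integral>\<^sup>+y. ennreal (g y powr n) \<partial>lborel) \<le> 1"
    and wn: "(\<integral>\<^sup>+y. ennreal (\<bar>w y\<bar> powr n) \<partial>lborel) \<le> ennreal (M powr n)" and M: "0 < M"
    and \<beta>: "0 \<le> \<beta>" "\<beta> < n" and \<alpha>: "0 < \<alpha>" "\<alpha> < A"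
  shows "(\<integral>\<^sup>+x. ennreal (phi N (\<alpha> * (1 - \<beta> / n) * \<bar>w x\<bar> powr p) * norm x powr (-\<beta>)) \<partial>lborel)
    \<le> ennreal ((exp A * A ^ (N - 1) * (n * b / (n - \<beta>) + 1) + exp A * \<bar>rearrangement.exp_const TYPE('a) p n b \<beta>\<bar>)
        * M powr (n - \<beta>) / (1 - (\<alpha> / A) ^ (N - 1)) powr ((n - \<beta>) / n))"
proof -
  have [measurable]: "w \<in> borel_measurable borel" using w by (rule borel_measurable_continuous_onI)
  have n2: "2 \<le> n" using N n by simp
  have b0: "0 < b" using n2 by (simp add: b n)
  have p1: "1 < p" and pm1: "p - 1 = 1 / (n - 1)" and pn: "p / n = 1 / (n - 1)" using n2 by (auto simp: p field_simps)
  have A0: "0 < A" using n2 b0 by (simp add: A)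
  define q where "q = 1 - \<beta> / n"
  have q: "0 < q" "q \<le> 1" and nq: "n * q = n - \<beta>" using \<beta> n2 by (auto simp: q_def field_simps)
  define D where "D = 1 - (\<alpha> / A) ^ (N - 1)"
  have r1: "(\<alpha> / A) ^ (N - 1) < 1" using \<alpha> A0 N by (intro power_less_one_iff[THEN iffD2]) auto
  have r0: "0 < (\<alpha> / A) ^ (N - 1)" using \<alpha> A0 by simp
  have D: "0 < D" "D < 1" using r1 r0 by (auto simp: D_def)
  \<comment> \<open>Splitting at this height and using the weighted convexity inequality with weight \<open>h\<close> raises
    the exponent \<open>\<alpha>\<close> exactly to \<open>A\<close> at the cost of a bounded additive term.\<close>
  define th where "th = D powr (1 / n)"
  have th: "0 < th" "th \<le> 1" using D n2 by (auto simp: th_def intro!: powr_le1)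
  have thn: "th powr n = D" using D n2 by (simp add: th_def powr_powr)
  define h where "h = (A / \<alpha>) ^ (N - 1) - 1"
  have h1: "1 + h = 1 / (\<alpha> / A) ^ (N - 1)" using \<alpha> A0 by (simp add: h_def power_divide)
  have "1 < 1 + h" unfolding h1 using r0 r1 by simp
  then have h: "0 < h" by simp
  have Dh: "D = h / (1 + h)"
  proof -
    have "1 - D = 1 / (1 + h)" unfolding h1 by (simp add: D_def)
    then show ?thesis using h by (simp add: field_simps)
  qed
  have root: "(x ^ (N - 1)) powr (1 / (n - 1)) = x" if "0 < x" for x :: real
  proof -
    have "x ^ (N - 1) = x powr (n - 1)" using that N n by (simp add: powr_realpow[symmetric] of_nat_diff)
    then show ?thesis using that n2 by (simp add: powr_powr)
  qed
  have hp: "(1 + h) powr (p - 1) = A / \<alpha>"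
    unfolding pm1 h_def using root[of "A / \<alpha>"] \<alpha> A0 by simp
  \<comment> \<open>Since D = h / (1 + h), the powers of \<open>h\<close> cancel. This identity is
    what fixes the height.\<close>
  have thp: "th powr p * h powr (1 - p) = \<alpha> / A"
  proof -
    have "th powr p = D powr (1 / (n - 1))" using pn by (simp add: th_def powr_powr)
    moreover have "1 - p = - (1 / (n - 1))" using pm1 by simp
    then have "h powr (1 - p) = 1 / h powr (1 / (n - 1))" by (simp only: powr_minus_divide)
    moreover have "D powr (1 / (n - 1)) = h powr (1 / (n - 1)) / (1 + h) powr (1 / (n - 1))"
      unfolding Dh using h by (simp add: powr_divide)
    ultimately show ?thesis using hp h \<alpha> A0 unfolding pm1 by simp
  qed
  define v where "v x = \<bar>w x\<bar> - th" for x
  have [measurable]: "v \<in> borel_measurable borel" unfolding v_def[abs_def] by measurable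
  have high: "phi N (\<alpha> * q * \<bar>w x\<bar> powr p) \<le> exp A * exp (q * A * v x powr p)" if x: "0 < v x" for x
  proof -
    have "\<bar>w x\<bar> powr p = (v x + th) powr p" by (simp add: v_def)
    also have "\<dots> \<le> (1 + h) powr (p - 1) * (v x powr p + th powr p * h powr (1 - p))"
      by (rule powr_add_le_weighted) (use x th h p1 in auto)
    finally have "\<bar>w x\<bar> powr p \<le> A / \<alpha> * (v x powr p + \<alpha> / A)" unfolding hp thp .
    then have "\<alpha> * q * \<bar>w x\<bar> powr p \<le> \<alpha> * q * (A / \<alpha> * (v x powr p + \<alpha> / A))"
      using \<alpha> q by (intro mult_left_mono) auto
    also have "\<dots> = q * A * v x powr p + q * \<alpha>" using \<alpha> A0 by (simp add: field_simps)
    also have "q * \<alpha> \<le> 1 * A" using q \<alpha> by (intro mult_mono) auto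
    finally have "exp (\<alpha> * q * \<bar>w x\<bar> powr p) \<le> exp (A + q * A * v x powr p)" by simp
    moreover have "phi N (\<alpha> * q * \<bar>w x\<bar> powr p) \<le> exp (\<alpha> * q * \<bar>w x\<bar> powr p)"
      using \<alpha> q by (intro phi_bounds N) auto
    ultimately show ?thesis by (simp add: exp_add)
  qed
  \<comment> \<open>Below the height |w| \<le> 1, so the argument of \<open>phi\<close> is at most
    \<open>A\<close> and the Taylor bound gives a multiple of the integrable power |w|^n.\<close>
  have low: "phi N (\<alpha> * q * \<bar>w x\<bar> powr p) \<le> exp A * A ^ (N - 1) * \<bar>w x\<bar> powr n" if x: "\<not> 0 < v x" for x
  proof -
    define T where "T = \<alpha> * q * \<bar>w x\<bar> powr p"
    have wx: "\<bar>w x\<bar> \<le> 1" using x th by (simp add: v_def)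
    have T0: "0 \<le> T" using \<alpha> q by (simp add: T_def)
    have aq: "\<alpha> * q \<le> A * 1" using \<alpha> q A0 by (intro mult_mono) auto
    have TA: "T \<le> A * \<bar>w x\<bar> powr p" unfolding T_def using aq by (intro mult_right_mono) auto
    also have "\<dots> \<le> A * 1" using A0 wx p1 by (intro mult_left_mono powr_le1) auto
    finally have T1: "T \<le> A" by simp
    have "T ^ (N - 1) \<le> (A * \<bar>w x\<bar> powr p) ^ (N - 1)" using TA T0 by (intro power_mono)
    also have "\<dots> = A ^ (N - 1) * \<bar>w x\<bar> powr n"
    proof (cases "w x = 0")
      case True
      then show ?thesis using N by (simp add: power_0_left)
    next
      case False
      have "(\<bar>w x\<bar> powr p) ^ (N - 1) = \<bar>w x\<bar> powr (p * (n - 1))"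
        using False N n by (simp add: powr_powr[symmetric] powr_realpow[symmetric] of_nat_diff)
      also have "p * (n - 1) = n" using n2 by (simp add: p)
      finally show ?thesis by (simp add: power_mult_distrib)
    qed
    finally have TN: "T ^ (N - 1) \<le> A ^ (N - 1) * \<bar>w x\<bar> powr n" .
    have "phi N T \<le> exp T * T ^ (N - 1)" using T0 by (intro phi_bounds N)
    also have "\<dots> \<le> exp A * (A ^ (N - 1) * \<bar>w x\<bar> powr n)"
      using T1 TN T0 by (intro mult_mono) auto
    finally show ?thesis by (simp add: T_def)
  qed
  define m where "m = M powr n / th powr n"
  have m: "0 < m" using M th by (simp add: m_def)
  have om: "emeasure lborel {x. 0 < v x} \<le> ennreal m"
  proof -
    have "ennreal (th powr n) * emeasure lborel {x. 0 < v x} = (\<integral>\<^sup>+x. ennreal (th powr n) * indicator {x. 0 < v x} x \<partial>lborel)"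
      by (simp add: nn_integral_cmult)
    also have "\<dots> \<le> (\<integral>\<^sup>+x. ennreal (\<bar>w x\<bar> powr n) \<partial>lborel)"
      using th n2 by (intro nn_integral_mono) (auto simp: v_def split: split_indicator intro!: ennreal_leI powr_mono2)
    finally have "ennreal (th powr n) * emeasure lborel {x. 0 < v x} \<le> ennreal (M powr n)" using wn by simp
    then have "ennreal (1 / th powr n) * (ennreal (th powr n) * emeasure lborel {x. 0 < v x}) \<le> ennreal (1 / th powr n) * ennreal (M powr n)"
      by (intro mult_left_mono) auto
    moreover have "ennreal (1 / th powr n) * ennreal (th powr n) = 1" using th by (simp add: ennreal_mult[symmetric])
    ultimately show ?thesis by (simp add: mult.assoc[symmetric] ennreal_mult[symmetric] m_def)
  qed
  define F where "F y = g y * indicator {y. th < \<bar>w y\<bar>} y" for y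
  have [measurable]: "F \<in> borel_measurable borel" unfolding F_def[abs_def] by measurable
  interpret R: rearrangement F m p n b
  proof
    have "(\<integral>\<^sup>+x. ennreal (F x powr n) \<partial>lborel) \<le> (\<integral>\<^sup>+x. ennreal (g x powr n) \<partial>lborel)"
      using g0 n2 by (intro nn_integral_mono ennreal_leI powr_mono2) (auto simp: F_def split: split_indicator)
    then show "(\<integral>\<^sup>+x. ennreal (F x powr n) \<partial>lborel) \<le> 1" using gn by (rule order_trans)
    have "emeasure lborel {x. 0 < F x} \<le> emeasure lborel {x. 0 < v x}"
      by (intro emeasure_mono) (auto simp: F_def v_def split: split_indicator_asm)
    then show "emeasure lborel {x. 0 < F x} \<le> ennreal m" using om by (rule order_trans)
  qed (use N n b p m g0 in \<open>auto simp: F_def\<close>)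
  define X where "X = R.exp_const \<beta>"
  have hi: "(\<integral>\<^sup>+x. indicator {x. 0 < v x} x * ennreal (exp (q * A * v x powr p) * norm x powr (-\<beta>)) \<partial>lborel)
    \<le> ennreal (X * m powr q)"
    unfolding q_def A X_def
  proof (rule R.exp_integral_le[OF _ _ om \<beta>])
    fix x assume "0 < v x"
    then show "ennreal (v x) \<le> ennreal (1 / (n * b)) * (\<integral>\<^sup>+y. ennreal (F y * norm (x - y) powr (1 - n)) \<partial>lborel)"
      unfolding v_def F_def using truncation_le_riesz[OF w g g0 line decay, of th x] th
      by (simp add: b n N)
  qed auto
  \<comment> \<open>The source of the rate: Chebyshev's bound m = M^n / D raised to the power
    q.\<close>
  have mq: "m powr q = M powr (n - \<beta>) / D powr ((n - \<beta>) / n)"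
  proof -
    have "D powr ((n - \<beta>) / n) = th powr (n - \<beta>)" using D by (simp add: th_def powr_powr)
    then show ?thesis using M th by (simp add: m_def powr_divide powr_powr nq)
  qed
  \<comment> \<open>The split at |x| = M is the one for which both parts scale like M^(n - \<beta>):
    inside, |w|^n \<le> 1 and the weight is integrable; outside, the weight is at most
    M^(-\<beta>).\<close>
  have lowint: "(\<integral>\<^sup>+x. indicator {x. norm x \<le> M} x * ennreal (norm x powr (-\<beta>)) + ennreal (M powr (-\<beta>)) * ennreal (\<bar>w x\<bar> powr n) \<partial>lborel)
    \<le> ennreal ((n * b / (n - \<beta>) + 1) * M powr (n - \<beta>))"
  proof -
    have "(\<integral>\<^sup>+x. indicator {x. norm x \<le> M} x * ennreal (norm x powr (-\<beta>)) + ennreal (M powr (-\<beta>)) * ennreal (\<bar>w x\<bar> powr n) \<partial>lborel)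
       = (\<integral>\<^sup>+x. ennreal (norm x powr (-\<beta>)) * indicator {x::'a. norm x \<le> M} x \<partial>lborel) + ennreal (M powr (-\<beta>)) * (\<integral>\<^sup>+x. ennreal (\<bar>w x\<bar> powr n) \<partial>lborel)"
      by (subst nn_integral_add) (auto simp: nn_integral_cmult mult.commute)
    also have "\<dots> \<le> ennreal (n * b / (n - \<beta>) * M powr (n - \<beta>)) + ennreal (M powr (-\<beta>)) * ennreal (M powr n)"
      using nn_integral_norm_powr_ball[where 'a='a, of \<beta> M] \<beta> M wn N n b by (intro add_mono mult_left_mono) auto
    also have "\<dots> = ennreal (n * b / (n - \<beta>) * M powr (n - \<beta>) + M powr (-\<beta>) * M powr n)"
      using \<beta> n2 b0 by (simp add: ennreal_mult[symmetric] ennreal_plus[symmetric] del: ennreal_plus)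
    also have "M powr (-\<beta>) * M powr n = M powr (n - \<beta>)" using M by (simp add: powr_add[symmetric])
    finally show ?thesis by (simp add: algebra_simps)
  qed
  let ?E = "exp A * A ^ (N - 1)"
  have E0: "0 \<le> ?E" using A0 by simp
  have "(\<integral>\<^sup>+x. ennreal (phi N (\<alpha> * (1 - \<beta> / n) * \<bar>w x\<bar> powr p) * norm x powr (-\<beta>)) \<partial>lborel)
    \<le> (\<integral>\<^sup>+x. ennreal ?E * (indicator {x. norm x \<le> M} x * ennreal (norm x powr (-\<beta>)) + ennreal (M powr (-\<beta>)) * ennreal (\<bar>w x\<bar> powr n))
      + ennreal (exp A) * (indicator {x. 0 < v x} x * ennreal (exp (q * A * v x powr p) * norm x powr (-\<beta>))) \<partial>lborel)"
  proof (rule nn_integral_mono)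
    fix x
    have ph0: "0 \<le> phi N (\<alpha> * q * \<bar>w x\<bar> powr p)" using \<alpha> q by (intro phi_bounds N) auto
    show "ennreal (phi N (\<alpha> * (1 - \<beta> / n) * \<bar>w x\<bar> powr p) * norm x powr (-\<beta>))
      \<le> ennreal ?E * (indicator {x. norm x \<le> M} x * ennreal (norm x powr (-\<beta>)) + ennreal (M powr (-\<beta>)) * ennreal (\<bar>w x\<bar> powr n))
      + ennreal (exp A) * (indicator {x. 0 < v x} x * ennreal (exp (q * A * v x powr p) * norm x powr (-\<beta>)))"
    proof (cases "0 < v x")
      case True
      have "ennreal (phi N (\<alpha> * q * \<bar>w x\<bar> powr p) * norm x powr (-\<beta>)) \<le> ennreal (exp A * exp (q * A * v x powr p) * norm x powr (-\<beta>))"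
        by (intro ennreal_leI mult_right_mono high True) auto
      then show ?thesis using True by (simp add: q_def[symmetric] ennreal_mult mult.assoc add_increasing)
    next
      case False
      have "\<bar>w x\<bar> powr n * norm x powr (-\<beta>) \<le> indicator {x. norm x \<le> M} x * norm x powr (-\<beta>) + M powr (-\<beta>) * \<bar>w x\<bar> powr n"
      proof (cases "norm x \<le> M")
        case True
        have "\<bar>w x\<bar> powr n \<le> 1" using False th n2 by (intro powr_le1) (auto simp: v_def)
        then have "\<bar>w x\<bar> powr n * norm x powr (-\<beta>) \<le> 1 * norm x powr (-\<beta>)" by (intro mult_right_mono) auto
        then show ?thesis using True by (simp add: add_increasing2)
      next
        case False
        then have "norm x powr (-\<beta>) \<le> M powr (-\<beta>)" using M \<beta> by (intro powr_mono2') auto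
        then have "\<bar>w x\<bar> powr n * norm x powr (-\<beta>) \<le> \<bar>w x\<bar> powr n * M powr (-\<beta>)" by (intro mult_left_mono) auto
        then show ?thesis using False by (simp add: mult.commute)
      qed
      then have "?E * (\<bar>w x\<bar> powr n * norm x powr (-\<beta>)) \<le> ?E * (indicator {x. norm x \<le> M} x * norm x powr (-\<beta>) + M powr (-\<beta>) * \<bar>w x\<bar> powr n)"
        using E0 by (intro mult_left_mono)
      moreover have "phi N (\<alpha> * q * \<bar>w x\<bar> powr p) * norm x powr (-\<beta>) \<le> ?E * \<bar>w x\<bar> powr n * norm x powr (-\<beta>)"
        by (intro mult_right_mono low False) auto
      ultimately have "phi N (\<alpha> * q * \<bar>w x\<bar> powr p) * norm x powr (-\<beta>) \<le> ?E * (indicator {x. norm x \<le> M} x * norm x powr (-\<beta>) + M powr (-\<beta>) * \<bar>w x\<bar> powr n)"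
        unfolding mult.assoc by linarith
      from ennreal_leI[OF this]
      show ?thesis using False E0 A0 by (simp add: q_def[symmetric] ennreal_mult ennreal_plus ennreal_indicator)
    qed
  qed
  also have "\<dots> = ennreal ?E * (\<integral>\<^sup>+x. indicator {x. norm x \<le> M} x * ennreal (norm x powr (-\<beta>)) + ennreal (M powr (-\<beta>)) * ennreal (\<bar>w x\<bar> powr n) \<partial>lborel)
      + ennreal (exp A) * (\<integral>\<^sup>+x. indicator {x. 0 < v x} x * ennreal (exp (q * A * v x powr p) * norm x powr (-\<beta>)) \<partial>lborel)"
    by (subst nn_integral_add) (auto simp: nn_integral_cmult)
  also have "\<dots> \<le> ennreal ?E * ennreal ((n * b / (n - \<beta>) + 1) * M powr (n - \<beta>)) + ennreal (exp A) * ennreal (\<bar>X\<bar> * m powr q)"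
    by (intro add_mono mult_left_mono lowint order_trans[OF hi] ennreal_leI mult_right_mono) auto
  also have "\<dots> = ennreal (?E * ((n * b / (n - \<beta>) + 1) * M powr (n - \<beta>)) + exp A * (\<bar>X\<bar> * m powr q))"
    using E0 \<beta> b0 n2 by (subst (1 2) ennreal_mult[symmetric], auto intro!: mult_nonneg_nonneg add_nonneg_nonneg)
  also have "\<dots> \<le> ennreal ((?E * (n * b / (n - \<beta>) + 1) + exp A * \<bar>X\<bar>) * M powr (n - \<beta>) / D powr ((n - \<beta>) / n))"
  \<comment> \<open>As D < 1, the low part, which carries no negative power of D, is absorbed into
    the rate of the high part.\<close>
  proof (rule ennreal_leI)
    have "D powr ((n - \<beta>) / n) \<le> 1" "0 < D powr ((n - \<beta>) / n)" using D \<beta> n2 by (auto intro!: powr_le1)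
    then have "M powr (n - \<beta>) \<le> m powr q" unfolding mq
      using mult_left_le[of "D powr ((n - \<beta>) / n)" "M powr (n - \<beta>)"] by (simp add: le_divide_eq)
    then have "?E * ((n * b / (n - \<beta>) + 1) * M powr (n - \<beta>)) \<le> ?E * ((n * b / (n - \<beta>) + 1) * m powr q)"
      using \<beta> b0 n2 E0 by (intro mult_left_mono) auto
    then have "?E * ((n * b / (n - \<beta>) + 1) * M powr (n - \<beta>)) + exp A * (\<bar>X\<bar> * m powr q) \<le> (?E * (n * b / (n - \<beta>) + 1) + exp A * \<bar>X\<bar>) * m powr q"
      by (simp add: algebra_simps)
    then show "?E * ((n * b / (n - \<beta>) + 1) * M powr (n - \<beta>)) + exp A * (\<bar>X\<bar> * m powr q) \<le> (?E * (n * b / (n - \<beta>) + 1) + exp A * \<bar>X\<bar>) * M powr (n - \<beta>) / D powr ((n - \<beta>) / n)"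
      unfolding mq by simp
  qed
  finally show ?thesis by (simp add: D_def X_def)
qed

section \<open>Removing the mollification\<close>

lemma nn_integral_le_of_AE_tendsto:
  fixes f :: "nat \<Rightarrow> 'a \<Rightarrow> ennreal"
  assumes [measurable]: "\<And>j. f j \<in> borel_measurable M"
    and lim: "AE x in M. (\<lambda>j. f j x) \<longlonglongrightarrow> h x" and le: "\<And>j. (\<integral>\<^sup>+x. f j x \<partial>M) \<le> B"
  shows "(\<integral>\<^sup>+x. h x \<partial>M) \<le> B"
proof -
  have "(\<integral>\<^sup>+x. h x \<partial>M) = (\<integral>\<^sup>+x. liminf (\<lambda>j. f j x) \<partial>M)"
    using lim by (intro nn_integral_cong_AE) (auto elim!: eventually_mono simp: lim_imp_Liminf)
  also have "\<dots> \<le> liminf (\<lambda>j. \<integral>\<^sup>+x. f j x \<partial>M)" by (rule nn_integral_liminf) auto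
  also have "\<dots> \<le> liminf (\<lambda>j. B)" by (intro Liminf_mono always_eventually allI le)
  finally show ?thesis by (simp add: Liminf_const)
qed

text \<open>Convergence in the mean gives almost everywhere convergence only along a subsequence,
  and \<open>u\<close> itself need not be integrable. It is therefore cut off at radius k + 1;
  kernels of radius at most 1 do not see the cut at points of norm below \<open>k\<close>.\<close>

lemma mollify_tendsto_AE:
  fixes u :: "real ^ 'n::finite \<Rightarrow> real" and k :: real
  assumes [measurable]: "u \<in> borel_measurable borel" and li: "locally_integrable u"
  shows "\<exists>d :: nat \<Rightarrow> real. (\<forall>j. 0 < d j) \<and> (AE x in lborel. norm x < k \<longrightarrow> (\<lambda>j. mollifier.conv (d j) u x) \<longlonglongrightarrow> u x)"
proof -
  define h where "h x = indicator (cball 0 (k + 1)) x *\<^sub>R u x" for x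
  have hi: "integrable lborel h"
    using li unfolding h_def[abs_def] locally_integrable_def set_integrable_def by auto
  then have [measurable]: "h \<in> borel_measurable borel" by auto
  define d where "d j = 1 / (real j + 1)" for j :: nat
  have dj: "0 < d j" "d j \<le> 1" for j by (auto simp: d_def)
  interpret mollifier "d j" "TYPE('n)" for j by standard (rule dj)
  define W where "W j x = mollifier.conv (d j) h x - h x" for j x
  have [measurable]: "mollifier.conv (d j) h \<in> borel_measurable borel" for j by (rule conv_meas) simp
  have [measurable]: "W j \<in> borel_measurable borel" for j unfolding W_def[abs_def] by measurable
  have small: "\<exists>J. \<forall>j\<ge>J. (\<integral>\<^sup>+x. ennreal \<bar>W j x\<bar> \<partial>lborel) \<le> ennreal e" if e: "0 < e" for e
  proof -
    obtain s where s: "0 < s" "\<And>t. norm t < s \<Longrightarrow> transl_dist h t \<le> ennreal e"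
      using transl_dist_tendsto_0[OF hi e] by blast
    have "(\<integral>\<^sup>+x. ennreal \<bar>W j x\<bar> \<partial>lborel) \<le> ennreal e" if j: "nat \<lceil>1 / s\<rceil> \<le> j" for j
    proof -
      have "1 / s \<le> real j" using j by linarith
      then have "d j < s" using s by (simp add: d_def field_simps)
      then show ?thesis unfolding W_def by (intro conv_dist_le hi s(2)) simp
    qed
    then show ?thesis by blast
  qed
  have conv_int: "integrable lborel (mollifier.conv (d j) h)" for j
  proof -
    have lih: "locally_integrable h"
      unfolding locally_integrable_def set_integrable_def
      by (intro allI impI integrable_mult_indicator hi) (simp add: borel_compact)
    have "(\<integral>\<^sup>+x. ennreal (norm (mollifier.conv (d j) h x)) \<partial>lborel) < \<infinity>"
    proof -
      have "(\<integral>\<^sup>+x. ennreal (norm (mollifier.conv (d j) h x)) \<partial>lborel) \<le> (\<integral>\<^sup>+x. \<integral>\<^sup>+y. ennreal (mollifier.eta (d j) (x - y)) * ennreal \<bar>h y\<bar> \<partial>lborel \<partial>lborel)"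
      proof (rule nn_integral_mono)
        fix x
        have "ennreal (norm (mollifier.conv (d j) h x)) \<le> (\<integral>\<^sup>+y. ennreal (norm (mollifier.eta (d j) (x - y) *\<^sub>R h y)) \<partial>lborel)"
          unfolding conv_def by (intro integral_norm_bound_ennreal conv_integrable lih) simp
        then show "ennreal (norm (mollifier.conv (d j) h x)) \<le> (\<integral>\<^sup>+y. ennreal (mollifier.eta (d j) (x - y)) * ennreal \<bar>h y\<bar> \<partial>lborel)"
          by (simp add: ennreal_mult eta_nonneg abs_mult)
      qed
      also have "\<dots> = (\<integral>\<^sup>+y. \<integral>\<^sup>+x. ennreal (mollifier.eta (d j) (x - y)) * ennreal \<bar>h y\<bar> \<partial>lborel \<partial>lborel)"
        by (rule lborel_pair.Fubini') measurable
      also have "\<dots> = (\<integral>\<^sup>+y. (\<integral>\<^sup>+x. ennreal (mollifier.eta (d j) (x - y)) \<partial>lborel) * ennreal \<bar>h y\<bar> \<partial>lborel)"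
        by (intro nn_integral_cong, subst nn_integral_multc) auto
      also have "\<dots> = (\<integral>\<^sup>+y. ennreal \<bar>h y\<bar> \<partial>lborel)"
        by (simp add: eta_prob_shift_left)
      also have "\<dots> < \<infinity>" using hi by (simp add: integrable_iff_bounded)
      finally show ?thesis .
    qed
    then show ?thesis by (intro integrableI_bounded) auto
  qed
  have Wint: "integrable lborel (W j)" for j
    unfolding W_def[abs_def] by (intro Bochner_Integration.integrable_diff conv_int hi)
  have "(\<lambda>j. \<integral>x. norm (W j x) \<partial>lborel) \<longlonglongrightarrow> 0"
  proof (rule LIMSEQ_I)
    fix e :: real assume e: "0 < e"
    obtain J where J: "\<And>j. J \<le> j \<Longrightarrow> (\<integral>\<^sup>+x. ennreal \<bar>W j x\<bar> \<partial>lborel) \<le> ennreal (e / 2)"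
      using small[of "e / 2"] e by auto
    have "norm ((\<integral>x. norm (W j x) \<partial>lborel) - 0) < e" if "J \<le> j" for j
    proof -
      have "ennreal (\<integral>x. norm (W j x) \<partial>lborel) = (\<integral>\<^sup>+x. ennreal (norm (W j x)) \<partial>lborel)"
        by (rule nn_integral_eq_integral[symmetric]) (auto intro: integrable_norm Wint)
      also have "\<dots> \<le> ennreal (e / 2)" using J[OF that] by simp
      finally have "(\<integral>x. norm (W j x) \<partial>lborel) \<le> e / 2" using e by simp
      then show ?thesis using e by simp
    qed
    then show "\<exists>no. \<forall>n\<ge>no. norm ((\<integral>x. norm (W n x) \<partial>lborel) - 0) < e" by blast
  qed
  from tendsto_L1_AE_subseq[OF Wint this]
  obtain r :: "nat \<Rightarrow> nat" where r: "AE x in lborel. (\<lambda>j. W (r j) x) \<longlonglongrightarrow> 0" by blast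
  have same: "mollifier.conv (d j) h x = mollifier.conv (d j) u x" if x: "norm x < k" for j x
    unfolding conv_def
  proof (rule Bochner_Integration.integral_cong[OF refl])
    fix y
    show "mollifier.eta (d j) (x - y) *\<^sub>R h y = mollifier.eta (d j) (x - y) *\<^sub>R u y"
    proof (cases "norm (x - y) < d j")
      case True
      have "norm y \<le> norm (x - y) + norm x" by (metis norm_minus_commute norm_triangle_sub add.commute)
      then show ?thesis using True x dj(2)[of j] by (simp add: h_def)
    next
      case False
      then show ?thesis by (simp add: eta_zero)
    qed
  qed
  have "AE x in lborel. norm x < k \<longrightarrow> (\<lambda>j. mollifier.conv (d (r j)) u x) \<longlonglongrightarrow> u x"
    using r
  proof eventually_elim
    case (elim x)
    show ?case
    proof
      assume x: "norm x < k"
      have "h x = u x" using x by (simp add: h_def)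
      then have "(\<lambda>j. mollifier.conv (d (r j)) u x - u x) \<longlonglongrightarrow> 0"
        using elim by (simp add: W_def same[OF x])
      then show "(\<lambda>j. mollifier.conv (d (r j)) u x) \<longlonglongrightarrow> u x" by (simp add: LIM_zero_iff)
    qed
  qed
  then show ?thesis using dj by (intro exI[of _ "\<lambda>j. d (r j)"]) auto
qed

lemma AT_upper:
  fixes \<beta> :: real and N :: nat
  assumes N: "N = CARD('n::finite)" "2 \<le> N" and \<beta>: "0 \<le> \<beta>" "\<beta> < real N"
  shows "\<exists>C>0. \<forall>\<alpha>. 0 < \<alpha> \<and> \<alpha> < alpha_crit N \<longrightarrow>
    AT TYPE('n) \<alpha> \<beta> \<le> ennreal (C / (1 - (\<alpha> / alpha_crit N) ^ (N - 1)) powr ((real N - \<beta>) / real N))"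
proof -
  define n where "n = real N"
  define b where "b = unit_ball_vol n"
  define p where "p = n / (n - 1)"
  define A where "A = n * (n * b) powr (1 / (n - 1))"
  define C where "C = exp A * A ^ (N - 1) * (n * b / (n - \<beta>) + 1) + exp A * \<bar>rearrangement.exp_const TYPE(real ^ 'n) p n b \<beta>\<bar>"
  have n2: "2 \<le> n" using N by (simp add: n_def)
  have b0: "0 < b" using n2 by (simp add: b_def n_def)
  have A0: "0 < A" using n2 b0 by (simp add: A_def)
  have A_eq: "alpha_crit N = A" by (simp add: alpha_crit_eq A_def b_def n_def)
  have p1: "1 < p" using n2 by (simp add: p_def)
  have C0: "0 < C"
    unfolding C_def using A0 n2 b0 \<beta> by (intro add_pos_nonneg mult_pos_pos add_nonneg_pos) (auto simp: n_def)
  have quot: "AT_quotient \<alpha> \<beta> u \<le> ennreal (C / (1 - (\<alpha> / A) ^ (N - 1)) powr ((n - \<beta>) / n))"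
    if \<alpha>: "0 < \<alpha>" "\<alpha> < A" and u: "u \<in> (admissible :: (real ^ 'n \<Rightarrow> real) set)" for \<alpha> u
  proof -
    obtain g where g: "g \<in> Lp_space n" "has_weak_gradient u g" "Lp_norm n g \<le> 1"
      using u N by (auto simp: admissible_def n_def)
    have uL: "u \<in> Lp_space n" and unz: "\<not> (AE x in lborel. u x = 0)"
      using u N by (auto simp: admissible_def sobolev_W1_def n_def)
    have [measurable]: "u \<in> borel_measurable borel" "g \<in> borel_measurable borel"
      using uL g by (auto simp: Lp_space_def)
    have li: "locally_integrable u" "locally_integrable g" using g by (auto simp: has_weak_gradient_def)
    have ui: "integrable lborel (\<lambda>x. norm (u x) powr n)" and gi: "integrable lborel (\<lambda>x. norm (g x) powr n)"
      using uL g by (auto simp: Lp_space_def)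
    define M where "M = Lp_norm n u"
    define Iu where "Iu = (\<integral>x. norm (u x) powr n \<partial>lborel)"
    have "Iu \<noteq> 0"
    proof
      assume "Iu = 0"
      then have "AE x in lborel. norm (u x) powr n = 0"
        unfolding Iu_def by (subst (asm) integral_nonneg_eq_0_iff_AE[OF ui]) auto
      then have "AE x in lborel. u x = 0" by eventually_elim auto
      with unz show False by simp
    qed
    moreover have "0 \<le> Iu" unfolding Iu_def by (intro integral_nonneg_AE) auto
    ultimately have Iu: "0 < Iu" by simp
    have MIu: "M = Iu powr (1 / n)" by (simp only: M_def Lp_norm_def Iu_def)
    have M: "0 < M" using Iu by (simp add: MIu)
    have MN: "M powr n = Iu" using Iu n2 by (simp add: MIu powr_powr)
    have uM: "(\<integral>\<^sup>+x. ennreal (norm (u x) powr n) \<partial>lborel) \<le> ennreal (M powr n)"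
      unfolding MN Iu_def by (subst nn_integral_eq_integral[OF ui]) auto
    have g1: "(\<integral>\<^sup>+x. ennreal (norm (g x) powr n) \<partial>lborel) \<le> 1"
    proof -
      define Ig where "Ig = (\<integral>x. norm (g x) powr n \<partial>lborel)"
      have Ig0: "0 \<le> Ig" unfolding Ig_def by (intro integral_nonneg_AE) auto
      have "Ig powr (1 / n) \<le> 1" using g(3) by (simp add: Lp_norm_def Ig_def)
      then have "(Ig powr (1 / n)) powr n \<le> 1 powr n" using n2 by (intro powr_mono2) auto
      then have "Ig \<le> 1" using Ig0 n2 by (simp add: powr_powr)
      then show ?thesis by (subst nn_integral_eq_integral[OF gi]) (auto simp: Ig_def)
    qed
    define B where "B = C * M powr (n - \<beta>) / (1 - (\<alpha> / A) ^ (N - 1)) powr ((n - \<beta>) / n)"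
    define f where "f w x = ennreal (phi N (\<alpha> * (1 - \<beta> / n) * \<bar>w x\<bar> powr p) * norm x powr (-\<beta>))"
      for w :: "real ^ 'n \<Rightarrow> real" and x
    have fm[measurable]: "f w \<in> borel_measurable borel" if [measurable]: "w \<in> borel_measurable borel" for w
      unfolding f_def[abs_def] by measurable
    have moll: "(\<integral>\<^sup>+x. f (mollifier.conv d u) x \<partial>lborel) \<le> ennreal B" if d: "0 < d" for d
    proof -
      interpret mollifier d "TYPE('n)" by standard (rule d)
      show ?thesis
        unfolding f_def B_def C_def
      proof (rule subcritical_bound_regular[where g="\<lambda>x. norm (conv g x)"])
        show "(\<integral>\<^sup>+y. ennreal (norm (conv g y) powr n) \<partial>lborel) \<le> 1"
          by (rule order_trans[OF conv_norm_le g1]) (use li gi n2 in auto)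
        show "(\<integral>\<^sup>+y. ennreal (\<bar>conv u y\<bar> powr n) \<partial>lborel) \<le> ennreal (M powr n)"
          using order_trans[OF conv_norm_le uM] li ui n2 by auto
        show "\<exists>R\<ge>0. \<bar>conv u (x + R *\<^sub>R z)\<bar> \<le> th" if "z \<noteq> 0" "0 < th" for x z th
          by (rule conv_decay[OF _ li(1) _ ui that]) (use n2 in auto)
        show "ennreal \<bar>conv u (x + R *\<^sub>R z) - conv u x\<bar> \<le> (\<integral>\<^sup>+r. indicator {0..R} r * ennreal (norm (conv g (x + r *\<^sub>R z)) * norm z) \<partial>lborel)"
          if "0 \<le> R" for x z R
          by (rule conv_line[OF _ _ g(2) that]) auto
      qed (use N M \<alpha> \<beta> in \<open>auto simp: n_def b_def p_def A_def intro!: conv_continuous li\<close>)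
    qed
    \<comment> \<open>The convergent sequence of radii depends on the ball, so the limit is taken on
      each ball first and the balls then exhaust the space.\<close>
    have ball: "(\<integral>\<^sup>+x. indicator {x. norm x < k} x * f u x \<partial>lborel) \<le> ennreal B" for k :: real
    proof -
      obtain d :: "nat \<Rightarrow> real" where d: "\<And>j. 0 < d j"
        and lim: "AE x in lborel. norm x < k \<longrightarrow> (\<lambda>j. mollifier.conv (d j) u x) \<longlonglongrightarrow> u x"
        using mollify_tendsto_AE[OF _ li(1), of k] by auto
      have [measurable]: "mollifier.conv (d j) u \<in> borel_measurable borel" for j
        by (rule mollifier.conv_meas) (auto simp: mollifier_def d)
      show ?thesis
      proof (rule nn_integral_le_of_AE_tendsto)
        show "(\<integral>\<^sup>+x. indicator {x. norm x < k} x * f (mollifier.conv (d j) u) x \<partial>lborel) \<le> ennreal B" for j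
          by (rule order_trans[OF nn_integral_mono moll[OF d]]) (auto split: split_indicator)
        show "AE x in lborel. (\<lambda>j. indicator {x. norm x < k} x * f (mollifier.conv (d j) u) x) \<longlonglongrightarrow> indicator {x. norm x < k} x * f u x"
          using lim
        proof eventually_elim
          case (elim x)
          show ?case
          proof (cases "norm x < k")
            case True
            then have l: "(\<lambda>j. mollifier.conv (d j) u x) \<longlonglongrightarrow> u x" using elim by simp
            have "(\<lambda>j. \<bar>mollifier.conv (d j) u x\<bar> powr p) \<longlonglongrightarrow> \<bar>u x\<bar> powr p"
              by (rule tendsto_powr') (use p1 l in \<open>auto intro!: tendsto_intros\<close>)
            then have "(\<lambda>j. phi N (\<alpha> * (1 - \<beta> / n) * \<bar>mollifier.conv (d j) u x\<bar> powr p)) \<longlonglongrightarrow> phi N (\<alpha> * (1 - \<beta> / n) * \<bar>u x\<bar> powr p)"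
              by (intro isCont_tendsto_compose[OF phi_continuous] tendsto_mult tendsto_const)
            then show ?thesis using True unfolding f_def by (auto intro!: tendsto_intros)
          qed simp
        qed
      qed measurable
    qed
    have "(\<integral>\<^sup>+x. f u x \<partial>lborel) \<le> ennreal B"
    proof (rule nn_integral_le_of_AE_tendsto)
      show "(\<integral>\<^sup>+x. indicator {x. norm x < real j} x * f u x \<partial>lborel) \<le> ennreal B" for j by (rule ball)
      show "AE x in lborel. (\<lambda>j. indicator {x. norm x < real j} x * f u x) \<longlonglongrightarrow> f u x"
      proof (rule AE_I2)
        fix x
        have "\<forall>\<^sub>F j in sequentially. indicator {x. norm x < real j} x * f u x = f u x"
          by (rule eventually_sequentiallyI[of "nat \<lceil>norm x\<rceil> + 1"]) (auto split: split_indicator, linarith)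
        then show "(\<lambda>j. indicator {x. norm x < real j} x * f u x) \<longlonglongrightarrow> f u x" by (rule tendsto_eventually)
      qed
    qed measurable
    then have "ennreal (1 / M powr (n - \<beta>)) * (\<integral>\<^sup>+x. f u x \<partial>lborel) \<le> ennreal (1 / M powr (n - \<beta>)) * ennreal B"
      by (intro mult_left_mono) auto
    also have "\<dots> = ennreal (C / (1 - (\<alpha> / A) ^ (N - 1)) powr ((n - \<beta>) / n))"
      using M C0 by (simp add: B_def ennreal_mult[symmetric])
    finally show ?thesis
      using N by (simp add: AT_quotient_def Let_def f_def M_def n_def p_def powr_minus divide_inverse)
  qed
  have "AT TYPE('n) \<alpha> \<beta> \<le> ennreal (C / (1 - (\<alpha> / alpha_crit N) ^ (N - 1)) powr ((real N - \<beta>) / real N))"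
    if "0 < \<alpha>" "\<alpha> < alpha_crit N" for \<alpha>
    unfolding AT_def using quot that by (intro SUP_least) (auto simp: A_eq n_def)
  then show ?thesis using C0 by blast
qed

section \<open>Moser functions and the lower bound\<close>

lemma integral_lborel_translate:
  fixes f :: "'a::euclidean_space \<Rightarrow> real"
  assumes [measurable]: "f \<in> borel_measurable borel"
  shows "(\<integral>x. f (x + t) \<partial>lborel) = (\<integral>x. f x \<partial>lborel)"
proof -
  have "(\<integral>x. f x \<partial>lborel) = (\<integral>x. f x \<partial>distr lborel borel ((+) t))" by (simp add: lborel_distr_plus)
  also have "\<dots> = (\<integral>x. f (t + x) \<partial>lborel)" by (subst integral_distr) auto
  finally show ?thesis by (simp add: add.commute)
qed

lemma AE_norm_neq: "AE x in lborel. norm (x :: 'a::euclidean_space) \<noteq> r"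
proof -
  from negligible_sphere[of "0::'a" r] have "sphere (0::'a) r \<in> null_sets lborel"
    by (auto simp: null_sets_completion_iff negligible_iff_null_sets negligible_convex_frontier)
  then have "AE x in lborel. x \<notin> sphere (0::'a) r" by (rule AE_not_in)
  then show ?thesis by eventually_elim auto
qed

lemma test_function_props:
  fixes f :: "real ^ 'n::finite \<Rightarrow> real"
  assumes f: "test_function f"
  shows "continuous_on UNIV f" "continuous_on UNIV (partial_deriv i f)"
    "f differentiable (at x)"
    "\<exists>R>0. \<forall>x. R \<le> norm x \<longrightarrow> f x = 0 \<and> partial_deriv i f x = 0"
proof -
  have C: "C_k 0 f" "C_k (Suc 0) f" using f by (auto simp: test_function_def)
  then show c: "continuous_on UNIV f" "continuous_on UNIV (partial_deriv i f)" by auto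
  show d: "f differentiable (at x)" for x using C by (auto simp: differentiable_on_def)
  have "bounded (closure {x. f x \<noteq> 0})" using f by (auto simp: test_function_def intro: compact_imp_bounded)
  then obtain R where R: "0 < R" "\<And>x. x \<in> closure {x. f x \<noteq> 0} \<Longrightarrow> norm x \<le> R"
    by (auto simp: bounded_pos)
  have z: "f x = 0" if "R < norm x" for x
    using R(2)[of x] closure_subset[of "{x. f x \<noteq> 0}"] that by fastforce
  have "partial_deriv i f x = 0" if x: "R < norm x" for x
  proof -
    have op: "open {x::real ^ 'n. R < norm x}" by (intro open_Collect_less continuous_intros)
    have "(f has_derivative (\<lambda>_. 0)) (at x)"
      by (rule has_derivative_transform_within_open[OF has_derivative_const[of 0] op]) (use x z in auto)
    then show ?thesis by (simp add: partial_deriv_eq)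
  qed
  then show "\<exists>R>0. \<forall>x. R \<le> norm x \<longrightarrow> f x = 0 \<and> partial_deriv i f x = 0"
    using R z by (intro exI[of _ "R + 1"]) auto
qed

lemma integrable_bounded_support:
  fixes f :: "'a::euclidean_space \<Rightarrow> real"
  assumes [measurable]: "f \<in> borel_measurable borel" and K: "\<And>x. \<bar>f x\<bar> \<le> K" and R: "\<And>x. R \<le> norm x \<Longrightarrow> f x = 0"
  shows "integrable lborel f"
proof (rule Bochner_Integration.integrable_bound)
  show "integrable lborel (\<lambda>x::'a. K * indicator (cball 0 R) x)"
    using emeasure_bounded_finite[of "cball (0::'a) R"] by (intro integrable_mult_right integrable_real_indicator) auto
  show "AE x in lborel. norm (f x) \<le> norm (K * indicator (cball 0 R) x)"
  proof (rule AE_I2)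
    fix x
    show "norm (f x) \<le> norm (K * indicator (cball 0 R) x)"
      using K[of x] R[of x] by (cases "x \<in> cball 0 R") auto
  qed
qed measurable

text \<open>The difference quotients of a compactly supported function have integral zero by translation
  invariance, so integration by parts follows from dominated convergence alone.\<close>

lemma lipschitz_imp_weak_partial:
  fixes u :: "real ^ 'n::finite \<Rightarrow> real" and g :: "real ^ 'n \<Rightarrow> real ^ 'n"
  assumes lip: "\<And>x y. \<bar>u x - u y\<bar> \<le> l * norm (x - y)"
    and ub: "\<And>x. \<bar>u x\<bar> \<le> B"
    and [measurable]: "g \<in> borel_measurable borel" and gb: "\<And>x. norm (g x) \<le> B'"
    and deriv: "AE x in lborel. (u has_derivative (\<lambda>h. g x \<bullet> h)) (at x)"
    and f: "test_function f"
  shows "(\<integral>x. u x * partial_deriv i f x \<partial>lborel) = - (\<integral>x. g x $ i * f x \<partial>lborel)"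
proof -
  let ?e = "axis i (1::real)"
  have l0: "0 \<le> l" using lip[of ?e 0] by (simp add: order_trans[OF abs_ge_zero])
  have B0: "0 \<le> B" using ub[of 0] by linarith
  have ucont: "continuous_on UNIV u"
  proof -
    have "l-lipschitz_on UNIV u" using lip l0 by (auto intro!: lipschitz_onI simp: dist_norm)
    then show ?thesis by (rule lipschitz_on_continuous_on)
  qed
  have [measurable]: "u \<in> borel_measurable borel" by (rule borel_measurable_continuous_onI[OF ucont])
  note tf = test_function_props[OF f]
  have [measurable]: "f \<in> borel_measurable borel" "partial_deriv i f \<in> borel_measurable borel"
    by (rule borel_measurable_continuous_onI[OF tf(1)], rule borel_measurable_continuous_onI[OF tf(2)])
  obtain R where R: "0 < R" "\<And>x. R \<le> norm x \<Longrightarrow> f x = 0" "\<And>x. R \<le> norm x \<Longrightarrow> partial_deriv i f x = 0"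
    using tf(4)[of i] by blast
  obtain Kf where Kf: "0 < Kf" "\<And>x. \<bar>f x\<bar> \<le> Kf" using continuous_zero_outside_bounded[OF tf(1), of R 0] R(2) by auto
  obtain Kp where Kp: "0 < Kp" "\<And>x. \<bar>partial_deriv i f x\<bar> \<le> Kp" using continuous_zero_outside_bounded[OF tf(2)[of i], of R 0] R(3) by auto
  have fdiff: "\<bar>f (x + t *\<^sub>R ?e) - f x\<bar> \<le> Kp * t" if t: "0 < t" for x t
  proof -
    have "DERIV (\<lambda>t. f (x + t *\<^sub>R ?e)) s :> partial_deriv i f (x + s *\<^sub>R ?e)" for s
    proof -
      have 1: "((\<lambda>t. x + t *\<^sub>R ?e) has_derivative (\<lambda>h. h *\<^sub>R ?e)) (at s)" by (auto intro!: derivative_eq_intros)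
      have 2: "(f has_derivative frechet_derivative f (at (x + s *\<^sub>R ?e))) (at (x + s *\<^sub>R ?e))"
        using tf(3) frechet_derivative_works by blast
      have lin: "linear (frechet_derivative f (at (x + s *\<^sub>R ?e)))" by (rule linear_frechet_derivative[OF tf(3)])
      have "((\<lambda>t. f (x + t *\<^sub>R ?e)) has_derivative (\<lambda>h. frechet_derivative f (at (x + s *\<^sub>R ?e)) (h *\<^sub>R ?e))) (at s)"
        using diff_chain_at[OF 1 2] by (simp add: o_def)
      then show ?thesis unfolding has_field_derivative_def partial_deriv_def
        by (rule has_derivative_eq_rhs) (auto simp: linear_scale[OF lin] mult.commute)
    qed
    then obtain s where "f (x + t *\<^sub>R ?e) - f (x + 0 *\<^sub>R ?e) = (t - 0) * partial_deriv i f (x + s *\<^sub>R ?e)"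
      using MVT2[OF t, of "\<lambda>t. f (x + t *\<^sub>R ?e)" "\<lambda>s. partial_deriv i f (x + s *\<^sub>R ?e)"] by blast
    then show ?thesis using Kp(2)[of "x + s *\<^sub>R ?e"] t by (simp add: abs_mult mult.commute mult_left_mono)
  qed
  have [measurable]: "(\<lambda>x. g x $ i) \<in> borel_measurable borel" unfolding cart_eq_inner_axis by measurable
  define h where "h x = u x * f x" for x
  have [measurable]: "h \<in> borel_measurable borel" unfolding h_def[abs_def] by measurable
  have hb: "\<bar>h x\<bar> \<le> B * Kf" for x unfolding h_def abs_mult using ub Kf B0 by (intro mult_mono) auto
  have h0: "h x = 0" if "R \<le> norm x" for x using R(2)[OF that] by (simp add: h_def)
  have hint: "integrable lborel h" by (rule integrable_bounded_support[OF _ hb h0]) simp_all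
  have hint': "integrable lborel (\<lambda>x. h (x + t))" for t
  proof (rule integrable_bounded_support[where K="B * Kf"])
    show "h (x + t) = 0" if "R + norm t \<le> norm x" for x
      using that norm_triangle_ineq4[of "x + t" t] by (intro h0) simp
  qed (auto simp: hb)
  \<comment> \<open>Steps of length at most 1 keep the supports of all difference quotients in one
    ball of radius R + 1, which gives a common integrable majorant.\<close>
  define t where "t j = 1 / (real j + 1)" for j :: nat
  have t: "0 < t j" "t j \<le> 1" for j by (auto simp: t_def)
  have t_lim: "t \<longlonglongrightarrow> 0" unfolding t_def[abs_def]
    using LIMSEQ_inverse_real_of_nat by (simp add: inverse_eq_divide add.commute)
  define q where "q j x = (h (x + t j *\<^sub>R ?e) - h x) / t j" for j x
  define P where "P x = u x * partial_deriv i f x + g x $ i * f x" for x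
  have q0: "(\<integral>x. q j x \<partial>lborel) = 0" for j
    unfolding q_def using hint hint' by (simp add: integral_lborel_translate)
  have qb: "\<bar>q j x\<bar> \<le> (B * Kp + l * Kf) * indicator (cball 0 (R + 1)) x" for j x
  proof (cases "x \<in> cball 0 (R + 1)")
    case True
    have "\<bar>h (x + t j *\<^sub>R ?e) - h x\<bar> = \<bar>u (x + t j *\<^sub>R ?e) * (f (x + t j *\<^sub>R ?e) - f x) + (u (x + t j *\<^sub>R ?e) - u x) * f x\<bar>"
      by (simp add: h_def algebra_simps)
    also have "\<dots> \<le> \<bar>u (x + t j *\<^sub>R ?e)\<bar> * \<bar>f (x + t j *\<^sub>R ?e) - f x\<bar> + \<bar>u (x + t j *\<^sub>R ?e) - u x\<bar> * \<bar>f x\<bar>"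
      by (rule order_trans[OF abs_triangle_ineq]) (simp add: abs_mult)
    also have "\<dots> \<le> B * (Kp * t j) + (l * t j) * Kf"
    proof (intro add_mono mult_mono)
      show "\<bar>u (x + t j *\<^sub>R ?e) - u x\<bar> \<le> l * t j" using lip[of "x + t j *\<^sub>R ?e" x] t[of j] by simp
    qed (use ub fdiff[OF t(1)] Kf B0 l0 t[of j] in auto)
    also have "\<dots> = (B * Kp + l * Kf) * t j" by (simp add: algebra_simps)
    finally show ?thesis using True t[of j] by (simp add: q_def divide_le_eq)
  next
    case False
    have "norm x \<le> norm (x + t j *\<^sub>R ?e) + 1"
      using norm_triangle_ineq4[of "x + t j *\<^sub>R ?e" "t j *\<^sub>R ?e"] t[of j] by simp
    then have "h (x + t j *\<^sub>R ?e) = 0" "h x = 0" using False by (auto intro!: h0)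
    then show ?thesis using False by (simp add: q_def)
  qed
  have Pm: "P \<in> borel_measurable borel" unfolding P_def[abs_def] by measurable
  have "(\<lambda>j. \<integral>x. q j x \<partial>lborel) \<longlonglongrightarrow> (\<integral>x. P x \<partial>lborel)"
  proof (rule integral_dominated_convergence[where w="\<lambda>x. (B * Kp + l * Kf) * indicator (cball 0 (R + 1)) x"])
    show "integrable lborel (\<lambda>x::real ^ 'n. (B * Kp + l * Kf) * indicator (cball 0 (R + 1)) x)"
      using emeasure_bounded_finite[of "cball (0::real ^ 'n) (R + 1)"] by (intro integrable_mult_right integrable_real_indicator) auto
    show "AE x in lborel. (\<lambda>j. q j x) \<longlonglongrightarrow> P x"
      using deriv
    proof eventually_elim
      case (elim x)
      have "(f has_derivative frechet_derivative f (at x)) (at x)" using tf(3) frechet_derivative_works by blast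
      from has_derivative_mult[OF elim this]
      have hd: "(h has_derivative (\<lambda>k. u x * frechet_derivative f (at x) k + (g x \<bullet> k) * f x)) (at x)"
        unfolding h_def[abs_def] by simp
      have 1: "((\<lambda>t. x + t *\<^sub>R ?e) has_derivative (\<lambda>k. k *\<^sub>R ?e)) (at 0)" by (auto intro!: derivative_eq_intros)
      have lin: "linear (frechet_derivative f (at x))" by (rule linear_frechet_derivative[OF tf(3)])
      have "((\<lambda>t. h (x + t *\<^sub>R ?e)) has_derivative (\<lambda>k. u x * frechet_derivative f (at x) (k *\<^sub>R ?e) + (g x \<bullet> (k *\<^sub>R ?e)) * f x)) (at 0)"
      proof -
        have "(h has_derivative (\<lambda>k. u x * frechet_derivative f (at x) k + (g x \<bullet> k) * f x)) (at (x + 0 *\<^sub>R ?e))"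
          using hd by simp
        from diff_chain_at[OF 1 this] show ?thesis by (simp add: o_def)
      qed
      then have "DERIV (\<lambda>t. h (x + t *\<^sub>R ?e)) 0 :> P x"
        unfolding has_field_derivative_def
        by (rule has_derivative_eq_rhs) (auto simp: linear_scale[OF lin] P_def partial_deriv_def inner_axis algebra_simps)
      then have "((\<lambda>t. (h (x + t *\<^sub>R ?e) - h x) / t) \<longlongrightarrow> P x) (at 0)" by (simp add: DERIV_def)
      moreover have "filterlim t (at 0) sequentially"
        using t_lim t(1) by (auto simp: filterlim_at intro!: always_eventually) (metis less_irrefl)
      ultimately show "(\<lambda>j. q j x) \<longlonglongrightarrow> P x" unfolding q_def by (rule filterlim_compose)
    qed
    show "AE x in lborel. norm (q j x) \<le> (B * Kp + l * Kf) * indicator (cball 0 (R + 1)) x" for j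
      using qb by (intro AE_I2) auto
  qed (auto simp: Pm q_def)
  then have "(\<integral>x. P x \<partial>lborel) = 0" unfolding q0 by (simp add: LIMSEQ_const_iff)
  moreover have "integrable lborel (\<lambda>x. u x * partial_deriv i f x)"
    by (rule integrable_bounded_support[where K="B * Kp" and R=R]) (use R Kp ub B0 in \<open>auto simp: abs_mult intro!: mult_mono\<close>)
  moreover have "integrable lborel (\<lambda>x. g x $ i * f x)"
  proof (rule integrable_bounded_support[where K="B' * Kf" and R=R])
    show "\<bar>g x $ i * f x\<bar> \<le> B' * Kf" for x
      unfolding abs_mult using gb[of x] component_le_norm_cart[of "g x" i] Kf
      by (intro mult_mono order_trans[OF component_le_norm_cart gb]) auto
  qed (use R in auto)
  ultimately show ?thesis unfolding P_def by simp
qed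

lemma abs_ln_diff_le:
  fixes s x y :: real
  assumes "s \<le> x" "s \<le> y" "0 < s"
  shows "\<bar>ln x - ln y\<bar> \<le> \<bar>x - y\<bar> / s"
proof -
  have *: "ln x - ln y \<le> \<bar>x - y\<bar> / s" if "s \<le> x" "s \<le> y" for x y
  proof -
    have xy: "0 < x" "0 < y" using that assms by auto
    have "ln x - ln y = ln (x / y)" using xy by (simp add: ln_div)
    also have "\<dots> \<le> x / y - 1" using xy by (intro ln_le_minus_one) auto
    also have "\<dots> = (x - y) / y" using xy by (simp add: diff_divide_distrib)
    also have "\<dots> \<le> \<bar>x - y\<bar> / y" using xy by (intro divide_right_mono) auto
    also have "\<dots> \<le> \<bar>x - y\<bar> / s" using that assms by (intro divide_left_mono) auto
    finally show ?thesis .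
  qed
  from *[of x y] *[of y x] assms show ?thesis by (simp add: abs_minus_commute abs_le_iff)
qed

section \<open>The truncated logarithm and its norms\<close>

locale moser =
  fixes T :: real and dummy :: "'n::finite itself"
  assumes T: "0 < T" and card2: "2 \<le> CARD('n)"
begin

definition "n = real CARD('n)"
definition "b = unit_ball_vol n"
text \<open>Normalises the gradient: its N-th power integrates to K^n * n * b * T over the
  annulus.\<close>

definition "K = (n * b * T) powr (- 1 / n)"
text \<open>Clipping the radius on both sides before taking the logarithm makes \<open>u\<close>
  Lipschitz with constant K exp T and constant on either side of the annulus.\<close>

definition "clip r = max (exp (- T)) (min 1 r)"
definition u :: "real ^ 'n \<Rightarrow> real" where "u x = - (K * ln (clip (norm x)))"
definition g :: "real ^ 'n \<Rightarrow> real ^ 'n" where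
  "g x = (if exp (- T) < norm x \<and> norm x < 1 then - (K / (norm x)\<^sup>2) *\<^sub>R x else 0)"

lemma n2: "2 \<le> n" using card2 by (simp add: n_def)

lemma b_pos: "0 < b" using n2 by (simp add: b_def)

lemma K_pos: "0 < K" using n2 b_pos T by (simp add: K_def)

lemma K_powr: "K powr n = 1 / (n * b * T)"
proof -
  have "K powr n = (n * b * T) powr (-1)" unfolding K_def powr_powr using n2 by simp
  also have "\<dots> = 1 / (n * b * T) powr 1" by (rule powr_minus_divide)
  finally show ?thesis using n2 b_pos T by simp
qed

lemma clip_bounds: "exp (- T) \<le> clip r" "clip r \<le> 1" "0 < clip r"
  using T by (auto simp: clip_def less_max_iff_disj)

lemma u_lip: "\<bar>u x - u y\<bar> \<le> (K * exp T) * norm (x - y)"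
proof -
  have "\<bar>u x - u y\<bar> = K * \<bar>ln (clip (norm x)) - ln (clip (norm y))\<bar>"
    using K_pos by (simp add: u_def right_diff_distrib[symmetric] abs_mult abs_minus_commute)
  also have "\<dots> \<le> K * (\<bar>clip (norm x) - clip (norm y)\<bar> / exp (- T))"
    using K_pos by (intro mult_left_mono abs_ln_diff_le clip_bounds) auto
  also have "\<dots> \<le> K * (norm (x - y) / exp (- T))"
  proof -
    have "\<bar>clip (norm x) - clip (norm y)\<bar> \<le> \<bar>norm x - norm y\<bar>" by (auto simp: clip_def)
    also have "\<bar>norm x - norm y\<bar> \<le> norm (x - y)" by (rule norm_triangle_ineq3)
    finally show ?thesis using K_pos by (intro mult_left_mono divide_right_mono) auto
  qed
  also have "\<dots> = (K * exp T) * norm (x - y)" by (simp add: exp_minus divide_inverse)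
  finally show ?thesis .
qed

lemma u_bounds: "0 \<le> u x" "u x \<le> K * T"
proof -
  have "ln (clip (norm x)) \<le> 0" using clip_bounds by simp
  then show "0 \<le> u x" using K_pos by (simp add: u_def mult_nonneg_nonpos)
  have "ln (exp (- T)) \<le> ln (clip (norm x))" using clip_bounds by (intro ln_mono) auto
  then have "K * (- ln (clip (norm x))) \<le> K * T" using K_pos by (intro mult_left_mono) auto
  then show "u x \<le> K * T" by (simp add: u_def)
qed

lemma u_inner: "norm x \<le> exp (- T) \<Longrightarrow> u x = K * T"
  by (simp add: u_def clip_def max_absorb1 min.coboundedI2)

lemma u_outer: "1 \<le> norm x \<Longrightarrow> u x = 0"
  using T by (simp add: u_def clip_def max_def min_def)

lemma u_deriv: "AE x in lborel. (u has_derivative (\<lambda>h. g x \<bullet> h)) (at x)"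
  using AE_norm_neq[of "exp (- T)"] AE_norm_neq[of 1]
proof eventually_elim
  case (elim x)
  consider "norm x < exp (- T)" | "exp (- T) < norm x" "norm x < 1" | "1 < norm x" using elim by linarith
  then show ?case
  proof cases
    case 1
    have op: "open {y::real ^ 'n. norm y < exp (- T)}" by (intro open_Collect_less continuous_intros)
    have "(u has_derivative (\<lambda>_. 0)) (at x)"
      by (rule has_derivative_transform_within_open[OF has_derivative_const[of "K * T"] op]) (use 1 u_inner in auto)
    then show ?thesis using 1 by (simp add: g_def)
  next
    case 3
    have op: "open {y::real ^ 'n. 1 < norm y}" by (intro open_Collect_less continuous_intros)
    have "(u has_derivative (\<lambda>_. 0)) (at x)"
      by (rule has_derivative_transform_within_open[OF has_derivative_const[of 0] op]) (use 3 u_outer in auto)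
    then show ?thesis using 3 by (simp add: g_def)
  next
    case 2
    have x0: "0 < norm x" using 2 exp_gt_zero[of "-T"] by linarith
    have op: "open {y::real ^ 'n. exp (- T) < norm y \<and> norm y < 1}"
      by (intro open_Collect_conj open_Collect_less continuous_intros)
    have nd: "(norm has_derivative (\<lambda>h. sgn x \<bullet> h)) (at x)" using has_derivative_norm[of x] x0 by (simp add: inner_commute)
    have "DERIV (\<lambda>r. - (K * ln r)) (norm x) :> - (K * (1 / norm x))"
      using x0 by (auto intro!: derivative_eq_intros)
    from DERIV_compose_FDERIV[OF this nd]
    have "((\<lambda>y. - (K * ln (norm y))) has_derivative (\<lambda>h. (sgn x \<bullet> h) * - (K * (1 / norm x)))) (at x)" .
    then have "((\<lambda>y. - (K * ln (norm y))) has_derivative (\<lambda>h. g x \<bullet> h)) (at x)"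
      by (rule has_derivative_eq_rhs) (use 2 x0 in \<open>auto simp: g_def sgn_div_norm power2_eq_square divide_inverse\<close>)
    then show ?thesis
      by (rule has_derivative_transform_within_open[OF _ op]) (use 2 in \<open>auto simp: u_def clip_def\<close>)
  qed
qed

lemma u_meas[measurable]: "u \<in> borel_measurable borel"
proof -
  have [measurable]: "clip \<in> borel_measurable borel" unfolding clip_def[abs_def] by measurable
  show ?thesis unfolding u_def[abs_def] by measurable
qed

lemma g_meas[measurable]: "g \<in> borel_measurable borel"
  unfolding g_def[abs_def] by measurable

lemma norm_g: "norm (g x) = (if exp (- T) < norm x \<and> norm x < 1 then K / norm x else 0)"
  using K_pos by (auto simp: g_def power2_eq_square)

lemma g_bound: "norm (g x) \<le> K * exp T"
proof (cases "exp (- T) < norm x \<and> norm x < 1")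
  case True
  then have "K / norm x \<le> K / exp (- T)" using K_pos exp_gt_zero[of "-T"] by (intro divide_left_mono mult_pos_pos) (auto intro: less_trans)
  then show ?thesis using True by (simp add: norm_g exp_minus divide_inverse)
next
  case False
  then have "norm (g x) = 0" unfolding norm_g by (rule if_not_P)
  then show ?thesis using K_pos by simp
qed

lemma g_norm_integral: "(\<integral>\<^sup>+x. ennreal (norm (g x) powr n) \<partial>lborel) \<le> 1"
proof -
  have "(\<integral>\<^sup>+x. ennreal (norm (g x) powr n) \<partial>lborel)
    \<le> (\<integral>\<^sup>+x. ennreal (K powr n) * (ennreal (norm x powr (- real DIM(real ^ 'n))) * indicator {x :: real ^ 'n. exp (- T) \<le> norm x \<and> norm x \<le> 1} x) \<partial>lborel)"
  proof (rule nn_integral_mono)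
    fix x :: "real ^ 'n"
    have "(K / norm x) powr n = K powr n * norm x powr (- n)" by (simp only: powr_divide powr_minus_divide) simp
    then show "ennreal (norm (g x) powr n) \<le> ennreal (K powr n) * (ennreal (norm x powr (- real DIM(real ^ 'n))) * indicator {x. exp (- T) \<le> norm x \<and> norm x \<le> 1} x)"
      by (auto simp: norm_g n_def ennreal_mult split: split_indicator)
  qed
  also have "\<dots> = ennreal (K powr n) * ennreal (real DIM(real ^ 'n) * unit_ball_vol (real DIM(real ^ 'n)) * ln (1 / exp (- T)))"
    using T by (subst nn_integral_cmult, measurable) (subst nn_integral_norm_powr_annulus, auto)
  also have "ln (1 / exp (- T)) = T" by (simp add: ln_div)
  also have "ennreal (K powr n) * ennreal (real DIM(real ^ 'n) * unit_ball_vol (real DIM(real ^ 'n)) * T) = 1"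
    unfolding K_powr using n2 b_pos T by (simp add: ennreal_mult[symmetric] n_def[symmetric] b_def[symmetric])
  finally show ?thesis .
qed

text \<open>From -ln r \<le> 2 r^(-1/2) comes the majorant (2K)^n |x|^(-n/2) on the unit ball, which
  is integrable there, and K^n is of order 1/T. This decay of the norm supplies the factor T^((n -
  \<beta>)/n) in the quotient.\<close>

lemma u_norm_integral: "(\<integral>\<^sup>+x. ennreal (\<bar>u x\<bar> powr n) \<partial>lborel) \<le> ennreal (2 powr (n + 1) / T)"
proof -
  have "(\<integral>\<^sup>+x. ennreal (\<bar>u x\<bar> powr n) \<partial>lborel)
    \<le> (\<integral>\<^sup>+x. ennreal ((2 * K) powr n) * (ennreal (norm x powr (- (n / 2))) * indicator {x :: real ^ 'n. norm x \<le> 1} x) \<partial>lborel)"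
  proof (rule nn_integral_mono_AE)
    show "AE x in lborel. ennreal (\<bar>u x\<bar> powr n) \<le> ennreal ((2 * K) powr n) * (ennreal (norm x powr (- (n / 2))) * indicator {x :: real ^ 'n. norm x \<le> 1} x)"
      using AE_lborel_singleton[of "0 :: real ^ 'n"]
    proof eventually_elim
      case (elim x)
      show ?case
      proof (cases "norm x \<le> 1")
        case True
        have x0: "0 < norm x" using elim by simp
        have "norm x \<le> clip (norm x)" using True by (simp add: clip_def)
        then have "ln (norm x) \<le> ln (clip (norm x))" using x0 clip_bounds by (intro ln_mono) auto
        moreover have "- ln (norm x) \<le> 2 * norm x powr (- (1 / 2))"
          using ln_le_minus_one[of "norm x powr (- (1 / 2))"] x0 by (simp add: ln_powr)
        ultimately have "K * (- ln (clip (norm x))) \<le> K * (2 * norm x powr (- (1 / 2)))"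
          using K_pos by (intro mult_left_mono) auto
        then have "\<bar>u x\<bar> \<le> 2 * K * norm x powr (- (1 / 2))" using u_bounds(1)[of x] by (simp add: u_def)
        then have "\<bar>u x\<bar> powr n \<le> (2 * K * norm x powr (- (1 / 2))) powr n" using n2 by (intro powr_mono2) auto
        also have "\<dots> = (2 * K) powr n * norm x powr (- (n / 2))" using K_pos by (simp add: powr_mult powr_powr)
        finally have "\<bar>u x\<bar> powr n \<le> (2 * K) powr n * norm x powr (- (n / 2))" .
        then show ?thesis using True by (simp add: ennreal_mult[symmetric] ennreal_leI)
      next
        case False
        then show ?thesis by (simp add: u_outer)
      qed
    qed
  qed
  also have "\<dots> = ennreal ((2 * K) powr n) * ennreal (n * b / (n - n / 2) * 1 powr (n - n / 2))"
    using nn_integral_norm_powr_ball[where 'a="real ^ 'n", of "n / 2" 1] n2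
    by (subst nn_integral_cmult) (auto simp: n_def b_def)
  also have "\<dots> \<le> ennreal (2 powr (n + 1) / T)"
  proof -
    have "(2 * K) powr n * (n * b / (n - n / 2) * 1 powr (n - n / 2)) = 2 powr n * (1 / (n * b * T)) * (2 * b)"
      using n2 K_pos by (simp add: powr_mult K_powr)
    also have "\<dots> = 2 powr n * 2 / (n * T)" using b_pos by (simp add: field_simps)
    also have "\<dots> \<le> 2 powr n * 2 / (1 * T)" using n2 T by (intro divide_left_mono mult_right_mono mult_pos_pos) auto
    finally have le: "(2 * K) powr n * (n * b / (n - n / 2) * 1 powr (n - n / 2)) \<le> 2 powr (n + 1) / T" by (simp add: powr_add)
    have "ennreal ((2 * K) powr n) * ennreal (n * b / (n - n / 2) * 1 powr (n - n / 2)) = ennreal ((2 * K) powr n * (n * b / (n - n / 2) * 1 powr (n - n / 2)))"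
      using n2 b_pos by (intro ennreal_mult[symmetric]) auto
    then show ?thesis using le by (simp add: ennreal_leI)
  qed
  finally show ?thesis .
qed

lemma grad: "has_weak_gradient u g"
  unfolding has_weak_gradient_def
proof (intro conjI allI impI)
  show "locally_integrable u"
    by (rule locally_integrable_bounded[where B="K * T"]) (use u_bounds in auto)
  show "locally_integrable g"
    by (rule locally_integrable_bounded[OF g_meas g_bound])
  show "(\<integral>x. u x * partial_deriv i f x \<partial>lborel) = - (\<integral>x. g x $ i * f x \<partial>lborel)" if "test_function f" for f i
    by (rule lipschitz_imp_weak_partial[OF u_lip _ g_meas g_bound u_deriv that]) (use u_bounds in \<open>auto intro: order_trans\<close>)
qed

lemma u_int: "integrable lborel (\<lambda>x. norm (u x) powr n)"
proof (rule integrableI_bounded)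
  show "(\<integral>\<^sup>+x. ennreal (norm (norm (u x) powr n)) \<partial>lborel) < \<infinity>"
    using le_less_trans[OF u_norm_integral ennreal_less_top] by simp
qed simp

lemma g_int: "integrable lborel (\<lambda>x. norm (g x) powr n)"
proof (rule integrableI_bounded)
  show "(\<integral>\<^sup>+x. ennreal (norm (norm (g x) powr n)) \<partial>lborel) < \<infinity>"
    using le_less_trans[OF g_norm_integral ennreal_less_top[of 1, unfolded ennreal_1]] by simp
qed simp

lemma inner_ball_measure: "emeasure lborel {x :: real ^ 'n. norm x \<le> exp (- T)} = ennreal (b * exp (- T) ^ CARD('n))"
proof -
  have "{x :: real ^ 'n. norm x \<le> exp (- T)} = cball 0 (exp (- T))" by auto
  then show ?thesis by (simp add: emeasure_cball b_def n_def)
qed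

lemma u_nonzero: "\<not> (AE x in lborel. u x = 0)"
proof
  assume "AE x in lborel. u x = 0"
  then have "AE x in lborel. x \<notin> {x :: real ^ 'n. norm x \<le> exp (- T)}"
    by eventually_elim (use u_inner K_pos T in auto)
  then have "emeasure lborel {x :: real ^ 'n. norm x \<le> exp (- T)} = 0"
    by (subst (asm) AE_iff_null_sets[symmetric]) (auto simp: null_sets_def)
  moreover have "0 < b * exp (- T) ^ CARD('n)" using b_pos by simp
  ultimately show False unfolding inner_ball_measure by (simp add: ennreal_eq_0_iff)
qed

lemma admissible_u: "u \<in> admissible"
proof -
  have gL: "g \<in> Lp_space n" and uL: "u \<in> Lp_space n"
    using g_int u_int by (auto simp: Lp_space_def)
  have "(\<integral>x. norm (g x) powr n \<partial>lborel) \<le> 1"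
    using g_norm_integral nn_integral_eq_integral[OF g_int] by simp
  then have "Lp_norm n g \<le> 1"
    unfolding Lp_norm_def using n2 by (intro powr_le1) (auto intro!: integral_nonneg_AE)
  then show ?thesis using gL uL grad u_nonzero by (auto simp: admissible_def sobolev_W1_def n_def[symmetric])
qed

lemma Lp_norm_u: "0 < Lp_norm n u" "Lp_norm n u powr n \<le> 2 powr (n + 1) / T"
proof -
  define I where "I = (\<integral>x. norm (u x) powr n \<partial>lborel)"
  have "I \<noteq> 0"
  proof
    assume "I = 0"
    then have "AE x in lborel. norm (u x) powr n = 0"
      unfolding I_def by (subst (asm) integral_nonneg_eq_0_iff_AE[OF u_int]) auto
    then have "AE x in lborel. u x = 0" by eventually_elim auto
    with u_nonzero show False by simp
  qed
  moreover have "0 \<le> I" unfolding I_def by (intro integral_nonneg_AE) auto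
  ultimately have I: "0 < I" by simp
  have eq: "Lp_norm n u = I powr (1 / n)" by (simp only: Lp_norm_def I_def)
  then show "0 < Lp_norm n u" using I by simp
  have "ennreal I = (\<integral>\<^sup>+x. ennreal (norm (u x) powr n) \<partial>lborel)"
    unfolding I_def by (rule nn_integral_eq_integral[OF u_int, symmetric]) auto
  also have "\<dots> \<le> ennreal (2 powr (n + 1) / T)" using u_norm_integral by simp
  finally have "I \<le> 2 powr (n + 1) / T" using T by simp
  then show "Lp_norm n u powr n \<le> 2 powr (n + 1) / T" using I n2 by (simp add: eq powr_powr)
qed

text \<open>Only the inner ball is counted, where \<open>u\<close> equals K T: there the exponential
  is exp(\<alpha> / \<open>alpha_crit N\<close> * (n - \<beta>) T), while the weighted volume of the
  ball is of order exp(-(n - \<beta>) T). At the critical value these cancel and the small norm of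
  \<open>u\<close> decides.\<close>

lemma AT_quotient_u:
  fixes \<alpha> \<beta> t0 :: real
  assumes N: "N = CARD('n)" and \<beta>: "0 \<le> \<beta>" "\<beta> < n" and \<alpha>: "0 < \<alpha>"
    and t0: "\<And>t. t0 \<le> t \<Longrightarrow> exp t / 2 \<le> phi N t"
    and big: "t0 \<le> \<alpha> / alpha_crit N * (n - \<beta>) * T"
  shows "ennreal ((1 / 2 powr (n + 1)) powr ((n - \<beta>) / n) * (n * b / (n - \<beta>) / 2) * T powr ((n - \<beta>) / n) * exp (- (1 - \<alpha> / alpha_crit N) * (n - \<beta>) * T))
    \<le> AT_quotient \<alpha> \<beta> u"
proof -
  define p where "p = n / (n - 1)"
  define A where "A = n * (n * b) powr (1 / (n - 1))"
  have A_eq: "alpha_crit N = A" using N by (simp add: alpha_crit_eq A_def b_def n_def)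
  have A0: "0 < A" using n2 b_pos by (simp add: A_def)
  have p1: "1 < p" using n2 by (simp add: p_def)
  define \<tau> where "\<tau> = \<alpha> / A * (n - \<beta>) * T"
  \<comment> \<open>Linear in \<open>T\<close>: the powers T^(-1/(n-1)) from K^p and T^(1/(n-1))
    from T^p cancel, and the definition of \<open>A\<close> accounts for the rest.\<close>
  have KT: "(K * T) powr p = n * T / A"
  proof -
    have "(K * T) powr p = K powr p * T powr p" by (rule powr_mult)
    also have "K powr p = (n * b * T) powr (- (1 / (n - 1)))"
      using n2 by (simp add: K_def powr_powr p_def)
    also have "\<dots> = 1 / ((n * b) powr (1 / (n - 1)) * T powr (1 / (n - 1)))"
      by (simp only: powr_minus_divide powr_mult[of "n * b" T])
    also have "T powr p = T * T powr (1 / (n - 1))"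
    proof -
      have "p = 1 + 1 / (n - 1)" using n2 by (simp add: p_def field_simps)
      then show ?thesis using T by (simp add: powr_add)
    qed
    finally show ?thesis using n2 b_pos T by (simp add: A_def field_simps)
  qed
  have arg: "\<alpha> * (1 - \<beta> / n) * (K * T) powr p = \<tau>"
    unfolding KT \<tau>_def using n2 A0 by (simp add: field_simps)
  have phi: "exp \<tau> / 2 \<le> phi N \<tau>" by (rule t0) (use big in \<open>simp add: \<tau>_def A_eq\<close>)
  have phi0: "0 \<le> phi N \<tau>" using phi by (rule order_trans[rotated]) simp
  have int: "ennreal (exp \<tau> / 2 * (n * b / (n - \<beta>) * exp (- T) powr (n - \<beta>)))
    \<le> (\<integral>\<^sup>+x. ennreal (phi N (\<alpha> * (1 - \<beta> / n) * \<bar>u x\<bar> powr p) / norm x powr \<beta>) \<partial>lborel)"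
  proof -
    have "ennreal (exp \<tau> / 2 * (n * b / (n - \<beta>) * exp (- T) powr (n - \<beta>))) = ennreal (exp \<tau> / 2) * ennreal (n * b / (n - \<beta>) * exp (- T) powr (n - \<beta>))"
      using \<beta> n2 b_pos by (intro ennreal_mult) auto
    also have "ennreal (n * b / (n - \<beta>) * exp (- T) powr (n - \<beta>)) = (\<integral>\<^sup>+x. ennreal (norm x powr (-\<beta>)) * indicator {x :: real ^ 'n. norm x \<le> exp (- T)} x \<partial>lborel)"
      using nn_integral_norm_powr_ball[where 'a="real ^ 'n", of \<beta> "exp (- T)"] \<beta> by (simp add: n_def b_def)
    also have "ennreal (exp \<tau> / 2) * \<dots> = (\<integral>\<^sup>+x. ennreal (exp \<tau> / 2) * (ennreal (norm x powr (-\<beta>)) * indicator {x :: real ^ 'n. norm x \<le> exp (- T)} x) \<partial>lborel)"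
      by (rule nn_integral_cmult[symmetric]) measurable
    also have "\<dots> \<le> (\<integral>\<^sup>+x. ennreal (phi N (\<alpha> * (1 - \<beta> / n) * \<bar>u x\<bar> powr p) / norm x powr \<beta>) \<partial>lborel)"
    proof (rule nn_integral_mono)
      fix x :: "real ^ 'n"
      have "exp \<tau> / 2 * norm x powr (-\<beta>) \<le> phi N (\<alpha> * (1 - \<beta> / n) * \<bar>u x\<bar> powr p) / norm x powr \<beta>" if x: "norm x \<le> exp (- T)"
      proof -
        have "\<bar>u x\<bar> = K * T" using u_inner[OF x] K_pos T by simp
        then have "phi N (\<alpha> * (1 - \<beta> / n) * \<bar>u x\<bar> powr p) = phi N \<tau>" by (simp only: arg)
        then show ?thesis using mult_right_mono[OF phi, of "norm x powr (-\<beta>)"] by (simp add: powr_minus_divide)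
      qed
      then show "ennreal (exp \<tau> / 2) * (ennreal (norm x powr (-\<beta>)) * indicator {x :: real ^ 'n. norm x \<le> exp (- T)} x)
        \<le> ennreal (phi N (\<alpha> * (1 - \<beta> / n) * \<bar>u x\<bar> powr p) / norm x powr \<beta>)"
        by (auto simp: ennreal_mult[symmetric] intro!: ennreal_leI split: split_indicator)
    qed
    finally show ?thesis .
  qed
  define e where "e = (n - \<beta>) / n"
  have e: "0 < e" using \<beta> n2 by (simp add: e_def)
  have M: "(1 / 2 powr (n + 1)) powr e * T powr e \<le> 1 / Lp_norm n u powr (n - \<beta>)"
  proof -
    have "Lp_norm n u powr (n - \<beta>) = (Lp_norm n u powr n) powr e" using n2 by (simp add: powr_powr e_def)
    also have "\<dots> \<le> (2 powr (n + 1) / T) powr e" using Lp_norm_u e by (intro powr_mono2) auto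
    finally have "1 / (2 powr (n + 1) / T) powr e \<le> 1 / Lp_norm n u powr (n - \<beta>)"
      using Lp_norm_u(1) T by (intro divide_left_mono mult_pos_pos) auto
    also have "1 / (2 powr (n + 1) / T) powr e = (1 / 2 powr (n + 1)) powr e * T powr e"
      using T by (simp add: powr_divide)
    finally show ?thesis .
  qed
  have "(1 / 2 powr (n + 1)) powr e * (n * b / (n - \<beta>) / 2) * T powr e * exp (- (1 - \<alpha> / A) * (n - \<beta>) * T)
    = ((1 / 2 powr (n + 1)) powr e * T powr e) * (exp \<tau> / 2 * (n * b / (n - \<beta>) * exp (- T) powr (n - \<beta>)))"
  proof -
    have "exp (- (1 - \<alpha> / A) * (n - \<beta>) * T) = exp \<tau> * exp (- T) powr (n - \<beta>)"
      by (simp add: powr_def exp_add[symmetric] \<tau>_def algebra_simps)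
    moreover have "X * (Z / 2) * Y * (E * S) = (X * Y) * (E / 2 * (Z * S))" for X Y Z E S :: real by simp
    ultimately show ?thesis by (simp only:)
  qed
  also have "ennreal \<dots> = ennreal ((1 / 2 powr (n + 1)) powr e * T powr e) * ennreal (exp \<tau> / 2 * (n * b / (n - \<beta>) * exp (- T) powr (n - \<beta>)))"
    using \<beta> n2 b_pos by (intro ennreal_mult) auto
  also have "\<dots> \<le> ennreal (1 / Lp_norm n u powr (n - \<beta>)) * (\<integral>\<^sup>+x. ennreal (phi N (\<alpha> * (1 - \<beta> / n) * \<bar>u x\<bar> powr p) / norm x powr \<beta>) \<partial>lborel)"
    by (intro mult_mono int ennreal_leI M) auto
  also have "\<dots> = AT_quotient \<alpha> \<beta> u" using N by (simp add: AT_quotient_def Let_def n_def p_def)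
  finally show ?thesis by (simp only: A_eq e_def)
qed

end

text \<open>Both constants are fixed before \<alpha> and \<open>T\<close>, so one estimate serves
  the rate near the critical value and the divergence at it.\<close>

lemma AT_lower:
  fixes \<beta> :: real and N :: nat
  assumes N: "N = CARD('n::finite)" "2 \<le> N" and \<beta>: "0 \<le> \<beta>" "\<beta> < real N"
  shows "\<exists>c>0. \<exists>t0>0. \<forall>\<alpha> T. 0 < \<alpha> \<and> 0 < T \<and> t0 \<le> \<alpha> / alpha_crit N * (real N - \<beta>) * T \<longrightarrow>
    ennreal (c * T powr ((real N - \<beta>) / real N) * exp (- (1 - \<alpha> / alpha_crit N) * (real N - \<beta>) * T)) \<le> AT TYPE('n) \<alpha> \<beta>"
proof -
  obtain t0 where t0: "0 < t0" "\<And>t. t0 \<le> t \<Longrightarrow> exp t / 2 \<le> phi N t" using phi_ge_half_exp by blast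
  define n where "n = real N"
  define c where "c = (1 / 2 powr (n + 1)) powr ((n - \<beta>) / n) * (n * unit_ball_vol n / (n - \<beta>) / 2)"
  have n2: "2 \<le> n" using N by (simp add: n_def)
  have "0 < unit_ball_vol n" using n2 by simp
  then have c: "0 < c" unfolding c_def using \<beta> n2 by (intro mult_pos_pos divide_pos_pos) (auto simp: n_def)
  have "ennreal (c * T powr ((n - \<beta>) / n) * exp (- (1 - \<alpha> / alpha_crit N) * (n - \<beta>) * T)) \<le> AT TYPE('n) \<alpha> \<beta>"
    if "0 < \<alpha>" "0 < T" "t0 \<le> \<alpha> / alpha_crit N * (n - \<beta>) * T" for \<alpha> T
  proof -
    interpret moser T "TYPE('n)" by standard (use that N in auto)
    have nn: "local.n = n" using N by (simp add: local.n_def \<open>n \<equiv> real N\<close>)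
    have "ennreal (c * T powr ((n - \<beta>) / n) * exp (- (1 - \<alpha> / alpha_crit N) * (n - \<beta>) * T)) \<le> AT_quotient \<alpha> \<beta> u"
      using AT_quotient_u[OF N(1) \<beta>(1) _ that(1) t0(2), unfolded nn b_def, OF _ _ that(3)] \<beta>(2)
      unfolding c_def by (simp add: \<open>n \<equiv> real N\<close>)
    also have "\<dots> \<le> AT TYPE('n) \<alpha> \<beta>" unfolding AT_def by (intro SUP_upper admissible_u)
    finally show ?thesis .
  qed
  then show ?thesis using c t0 unfolding n_def by blast
qed

theorem theorem1p1:
  fixes \<beta> :: real and N :: nat
  assumes "N = CARD('n::finite)" and "N \<ge> 2" and "0 \<le> \<beta>" and "\<beta> < real N"
  shows "(\<exists>c C \<alpha>\<^sub>0. 0 < c \<and> 0 < C \<and> 0 \<le> \<alpha>\<^sub>0 \<and> \<alpha>\<^sub>0 < alpha_crit N \<and>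
            (\<forall>\<alpha>. \<alpha>\<^sub>0 < \<alpha> \<and> \<alpha> < alpha_crit N \<longrightarrow>
               ennreal (c / (1 - (\<alpha> / alpha_crit N) ^ (N - 1)) powr ((real N - \<beta>) / real N))
                 \<le> AT TYPE('n) \<alpha> \<beta> \<and>
               AT TYPE('n) \<alpha> \<beta>
                 \<le> ennreal (C / (1 - (\<alpha> / alpha_crit N) ^ (N - 1)) powr ((real N - \<beta>) / real N))))
         \<and> AT TYPE('n) (alpha_crit N) \<beta> = \<infinity>"
proof -
  define A where "A = alpha_crit N"
  define k where "k = real N - \<beta>"
  define e where "e = k / real N"
  have k: "0 < k" using assms by (simp add: k_def)
  have e: "0 < e" using k assms by (simp add: e_def)
  have A: "0 < A"
  proof -
    have "unit_ball_vol (real N) \<noteq> 0" using unit_ball_vol_pos[of "real N"] by linarith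
    then have "0 < (real N * unit_ball_vol (real N)) powr (1 / (real N - 1))" using assms(2) by simp
    then show ?thesis unfolding A_def alpha_crit_eq using assms(2) by (intro mult_pos_pos) auto
  qed
  obtain C where C: "0 < C" "\<And>\<alpha>. 0 < \<alpha> \<Longrightarrow> \<alpha> < A \<Longrightarrow>
      AT TYPE('n) \<alpha> \<beta> \<le> ennreal (C / (1 - (\<alpha> / A) ^ (N - 1)) powr e)"
    using AT_upper[OF assms] unfolding A_def e_def k_def by blast
  obtain c t0 where c: "0 < c" "0 < t0" and low: "\<And>\<alpha> T. 0 < \<alpha> \<Longrightarrow> 0 < T \<Longrightarrow> t0 \<le> \<alpha> / A * k * T \<Longrightarrow>
      ennreal (c * T powr e * exp (- (1 - \<alpha> / A) * k * T)) \<le> AT TYPE('n) \<alpha> \<beta>"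
    using AT_lower[OF assms] unfolding A_def e_def k_def by blast
  \<comment> \<open>For r = \<alpha> / A above \<open>s\<close> these bounds give r \<ge> 1/2 and 1
    - r \<le> k / (2 t0); with T = 1 / (1 - r) the argument r k T of \<open>phi\<close> is then at
    least \<open>t0\<close>.\<close>
  define s where "s = max (1 / 2) (1 - k / (2 * t0))"
  have s: "1 / 2 \<le> s" "s < 1" "1 - k / (2 * t0) \<le> s" using k c by (auto simp: s_def)
  have lower: "ennreal (c * exp (- k) / (1 - (\<alpha> / A) ^ (N - 1)) powr e) \<le> AT TYPE('n) \<alpha> \<beta>"
    if \<alpha>: "A * s < \<alpha>" "\<alpha> < A" for \<alpha>
  proof -
    define r where "r = \<alpha> / A"
    have r: "s < r" "r < 1" using \<alpha> A by (auto simp: r_def field_simps)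
    define T where "T = 1 / (1 - r)"
    have T: "0 < T" using r by (simp add: T_def)
    have "1 - r \<le> k / (2 * t0)" using r s by linarith
    then have "t0 * (1 - r) \<le> 1 / 2 * k" using c by (simp add: field_simps)
    also have "\<dots> \<le> r * k" using r s k by (intro mult_right_mono) auto
    finally have big: "t0 \<le> r * k * T" using r by (simp add: T_def le_divide_eq)
    have "0 < A * s" using A s by (intro mult_pos_pos) auto
    then have \<alpha>0: "0 < \<alpha>" using \<alpha>(1) by linarith
    \<comment> \<open>As N \<ge> 2, 1 - r \<le> 1 - r^(N-1): the quantity natural to the test
      functions may be replaced by the one in the statement.\<close>
    have "r ^ (N - 1) \<le> r ^ 1" using r s assms by (intro power_decreasing) auto
    then have "(1 - r) powr e \<le> (1 - r ^ (N - 1)) powr e" using r e by (intro powr_mono2) auto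
    then have "c * exp (- k) / (1 - r ^ (N - 1)) powr e \<le> c * exp (- k) / (1 - r) powr e"
      using c r by (intro divide_left_mono mult_pos_pos) (auto intro: less_le_trans[of 0 "(1 - r) powr e"])
    also have "\<dots> = c * T powr e * exp (- (1 - r) * k * T)"
    proof -
      \<comment> \<open>With this \<open>T\<close> the exponential factor is the constant exp(-k),
        which goes into the lower constant.\<close>
      have "(1 - r) * T = 1" using r by (simp add: T_def)
      moreover have "- (1 - r) * k * T = - (((1 - r) * T) * k)" by (simp only: mult_minus_left mult_ac)
      ultimately have "- (1 - r) * k * T = - k" by simp
      then show ?thesis using r by (simp only:) (simp add: T_def powr_divide)
    qed
    finally have "ennreal (c * exp (- k) / (1 - r ^ (N - 1)) powr e) \<le> ennreal (c * T powr e * exp (- (1 - r) * k * T))"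
      by (rule ennreal_leI)
    also have "\<dots> \<le> AT TYPE('n) \<alpha> \<beta>" using low[OF \<alpha>0 T] big by (simp add: r_def)
    finally show ?thesis by (simp add: r_def)
  qed
  have inf: "AT TYPE('n) A \<beta> = \<infinity>"
  proof (rule ccontr)
    assume "AT TYPE('n) A \<beta> \<noteq> \<infinity>"
    then obtain R where R: "AT TYPE('n) A \<beta> = ennreal R" "0 \<le> R" by (cases "AT TYPE('n) A \<beta>") auto
    \<comment> \<open>The first entry reaches the threshold \<open>t0\<close>, the second makes c
      T^e at least R + 1; at the critical value the exponential factor is 1.\<close>
    define T where "T = max (t0 / k) (((R + 1) / c) powr (1 / e))"
    have T: "0 < T" using c k by (simp add: T_def less_max_iff_disj)
    have "t0 / k \<le> T" by (simp add: T_def)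
    then have "t0 \<le> A / A * k * T" using k A by (simp add: divide_le_eq mult.commute)
    then have "ennreal (c * T powr e * exp (- (1 - A / A) * k * T)) \<le> ennreal R"
      using low[OF A T] R by simp
    then have 1: "c * T powr e \<le> R" using A R by simp
    have "(((R + 1) / c) powr (1 / e)) powr e \<le> T powr e" using e by (intro powr_mono2) (auto simp: T_def)
    then have "(R + 1) / c \<le> T powr e" using e c R by (simp add: powr_powr)
    then have "R + 1 \<le> c * T powr e" using c by (simp add: divide_le_eq mult.commute)
    with 1 show False by simp
  qed
  show ?thesis
    unfolding A_def[symmetric] k_def[symmetric] e_def[symmetric]
  proof (intro conjI exI allI impI)
    show "0 < c * exp (- k)" "0 < C" using c C by auto
    show "0 \<le> A * s" "A * s < A" using A s by auto
    show "ennreal (c * exp (- k) / (1 - (\<alpha> / A) ^ (N - 1)) powr e) \<le> AT TYPE('n) \<alpha> \<beta>" if "A * s < \<alpha> \<and> \<alpha> < A" for \<alpha>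
      using lower that by blast
    show "AT TYPE('n) \<alpha> \<beta> \<le> ennreal (C / (1 - (\<alpha> / A) ^ (N - 1)) powr e)" if "A * s < \<alpha> \<and> \<alpha> < A" for \<alpha>
    proof (rule C(2))
      have "0 < A * s" using A s by (intro mult_pos_pos) auto
      then show "0 < \<alpha>" using that by linarith
    qed (use that in blast)
  qed (rule inf)
qed

end
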